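(* Let $A$ be a unital $C^*$-algebra of (topological) stable rank one. Then $\mathrm{Dur}(A)=1$.
   Context: The topological stable rank $\mathrm{tsr}(A)$ of a unital $C^*$-algebra $A$ is the least $n$ such that for all $m\ge n$ the set $\{(a_1,\dots,a_m)\in A^m : \sum_{i=1}^m b_ia_i=1\text{ for some } b_1,\dots,b_m\in A\}$ is dense in $A^m$; stable rank one means $\mathrm{tsr}(A)=1$. For a unital $C^*$-algebra $B$, $U_0(B)$ is the connected component of the identity in the unitary group $U(B)$ (norm topology), and $CU(B)$ is the norm closure of the commutator subgroup of $U_0(B)$. For integers $n\ge m\ge1$ let $i_B^{(m,n)}\colon U_0(M_m(B))/CU(M_m(B))\to U_0(M_n(B))/CU(M_n(B))$ be the homomorphism induced by $u\mapsto\mathrm{diag}(u,1_{n-m})$. The determinant rank of $B$ is $\mathrm{Dur}(B)=\min\{m\in\mathbb N : i_B^{(m,n)}\text{ is an isomorphism for all } n>m\}$ (with $m\ge1$), and $\mathrm{Dur}(B)=\infty$ if no such $m$ exists. *)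

theory Defs
  imports
    "HOL-Library.Extended_Nat"
    "HOL-Analysis.Abstract_Metric_Spaces"
    "HOL-Analysis.Function_Topology"
    "HOL-Algebra.Generated_Groups"
    "Jordan_Normal_Form.Matrix"
begin

unbundle no vec_syntax
no_notation eq_closure_of (\<open>closure'_of\<index>\<close>)

section \<open>Unital C*-algebras\<close>

text \<open>
  The real scaling, the norm and completeness come from \<^class>\<open>real_normed_algebra_1\<close> and
  \<^class>\<open>banach\<close>; the complex scaling extends the real one. As usual, a unital C*-algebra is
  nonzero here (\<open>norm 1 = 1\<close>).
\<close>

class unital_cstar_algebra = real_normed_algebra_1 + banach +
  fixes scaleC :: "complex \<Rightarrow> 'a \<Rightarrow> 'a" (infixr \<open>*\<^sub>C\<close> 75)
    and star :: "'a \<Rightarrow> 'a"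
  assumes scaleC_add_right: "c *\<^sub>C (x + y) = c *\<^sub>C x + c *\<^sub>C y"
    and scaleC_add_left: "(c + d) *\<^sub>C x = c *\<^sub>C x + d *\<^sub>C x"
    and scaleC_scaleC: "c *\<^sub>C d *\<^sub>C x = (c * d) *\<^sub>C x"
    and scaleC_of_real: "complex_of_real r *\<^sub>C x = scaleR r x"
    and mult_scaleC_left: "(c *\<^sub>C x) * y = c *\<^sub>C (x * y)"
    and mult_scaleC_right: "x * (c *\<^sub>C y) = c *\<^sub>C (x * y)"
    and norm_scaleC: "norm (c *\<^sub>C x) = cmod c * norm x"
    and star_star: "star (star x) = x"
    and star_add: "star (x + y) = star x + star y"
    and star_scaleC: "star (c *\<^sub>C x) = cnj c *\<^sub>C star x"
    and star_mult: "star (x * y) = star y * star x"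
    and cstar_identity: "norm (star x * x) = (norm x)\<^sup>2"

section \<open>Topological stable rank\<close>

text \<open>The elements of \<open>A\<^sup>m\<close> are the extensional functions on \<open>{..<m}\<close>.\<close>

definition left_unimodular :: "nat \<Rightarrow> (nat \<Rightarrow> 'a :: unital_cstar_algebra) set" where
  "left_unimodular m = {a \<in> {..<m} \<rightarrow>\<^sub>E UNIV. \<exists>b. (\<Sum>i<m. b i * a i) = 1}"

definition tuple_topology :: "nat \<Rightarrow> (nat \<Rightarrow> 'a :: unital_cstar_algebra) topology" where
  "tuple_topology m = product_topology (\<lambda>_. euclidean) {..<m}"

definition tsr :: "'a :: unital_cstar_algebra itself \<Rightarrow> enat" where
  "tsr _ = Inf (enat ` {n. \<forall>m\<ge>n. tuple_topology m closure_of (left_unimodular m :: (nat \<Rightarrow> 'a) set)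
                                  = topspace (tuple_topology m)})"

section \<open>The C*-algebra of n by n matrices\<close>

definition mat_star :: "'a :: unital_cstar_algebra mat \<Rightarrow> 'a mat" where
  "mat_star a = mat (dim_col a) (dim_row a) (\<lambda>(i, j). star (a $$ (j, i)))"

text \<open>
  The norm of the Hilbert module \<open>A\<^sup>n\<close>, with \<open>A\<close>-valued inner product
  \<open>\<langle>x, y\<rangle> = \<Sum>i. x\<^sub>i\<^sup>* y\<^sub>i\<close>. The C*-norm of \<open>M\<^sub>n(A)\<close> is the operator norm for the left action
  of \<open>M\<^sub>n(A)\<close> on \<open>A\<^sup>n\<close>.
\<close>

definition module_norm :: "'a :: unital_cstar_algebra vec \<Rightarrow> real" where
  "module_norm x = sqrt (norm (\<Sum>i<dim_vec x. star (x $ i) * x $ i))"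

definition mat_norm :: "'a :: unital_cstar_algebra mat \<Rightarrow> real" where
  "mat_norm a = Sup {module_norm (a *\<^sub>v x) | x. x \<in> carrier_vec (dim_col a) \<and> module_norm x \<le> 1}"

text \<open>
  The case distinction is there because \<^locale>\<open>Metric_space\<close> requires the distance to be
  nonnegative and symmetric also outside the carrier.
\<close>

definition mat_dist :: "nat \<Rightarrow> 'a :: unital_cstar_algebra mat \<Rightarrow> 'a mat \<Rightarrow> real" where
  "mat_dist n a b =
    (if a \<in> carrier_mat n n \<and> b \<in> carrier_mat n n then mat_norm (a - b) else 0)"

definition mat_topology :: "nat \<Rightarrow> 'a :: unital_cstar_algebra mat topology" where
  "mat_topology n = Metric_space.mtopology (carrier_mat n n) (mat_dist n)"

section \<open>Unitary groups and the determinant rank\<close>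

definition unitaries :: "nat \<Rightarrow> 'a :: unital_cstar_algebra mat set" where
  "unitaries n = {u \<in> carrier_mat n n. mat_star u * u = 1\<^sub>m n \<and> u * mat_star u = 1\<^sub>m n}"

definition U0 :: "nat \<Rightarrow> 'a :: unital_cstar_algebra mat monoid" where
  "U0 n = \<lparr>carrier = connected_component_of_set (subtopology (mat_topology n) (unitaries n)) (1\<^sub>m n),
           monoid.mult = (*), one = 1\<^sub>m n\<rparr>"

definition CU :: "nat \<Rightarrow> 'a :: unital_cstar_algebra mat set" where
  "CU n = mat_topology n closure_of derived (U0 n) (carrier (U0 n))"

definition diag_one :: "nat \<Rightarrow> nat \<Rightarrow> 'a :: unital_cstar_algebra mat \<Rightarrow> 'a mat" where
  "diag_one m n u = four_block_mat u (0\<^sub>m m (n - m)) (0\<^sub>m (n - m) m) (1\<^sub>m (n - m))"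

text \<open>
  The map induced on cosets: \<open>diag_one m n\<close> followed by the quotient map is constant on every
  coset \<open>X\<close> of \<open>CU m\<close>, and its value there is the image of \<open>X\<close>.
\<close>

definition induced_map ::
  "nat \<Rightarrow> nat \<Rightarrow> 'a :: unital_cstar_algebra mat set \<Rightarrow> 'a mat set" where
  "induced_map m n X = the_elem ((\<lambda>u. CU n #>\<^bsub>U0 n\<^esub> diag_one m n u) ` X)"

definition Dur :: "'a :: unital_cstar_algebra itself \<Rightarrow> enat" where
  "Dur _ = Inf (enat ` {m. 1 \<le> m \<and> (\<forall>n>m.
     (induced_map m n :: 'a mat set \<Rightarrow> 'a mat set) \<in> iso (U0 m Mod CU m) (U0 n Mod CU n))})"

end

theory Submission
  imports Defs
    "HOL-Analysis.Weierstrass_Theorems"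
    "HOL-Analysis.Bounded_Continuous_Function"
    "HOL-Analysis.Lipschitz"
    "HOL-Analysis.Abstract_Topological_Spaces"
begin

unbundle no vec_syntax

text \<open>
  Surjectivity: \<open>U\<^sub>0(M\<^sub>n(A))\<close> is generated by exponentials of skew elements \<open>h\<close>, and
  \<open>h - tr(h) e\<^sub>1\<^sub>1\<close> is a sum of commutators of skew elements, whose exponentials lie in the closed
  commutator subgroup.

  Injectivity: the determinant \<open>\<Sum>\<^sub>j tr(g(t\<^sub>j\<^sub>+\<^sub>1) g(t\<^sub>j)\<^sup>-\<^sup>1 - 1)\<close> of a path of invertible matrices is,
  modulo commutators, additive and stable under perturbation of loops. If \<open>u\<close> in \<open>U\<^sub>0(A)\<close> becomes a limit of
  products of commutators in \<open>M\<^sub>n(A)\<close>, then a path from \<open>1\<close> to \<open>u\<close> in \<open>A\<close> and a path through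
  commutators close up, up to a small error, to a loop in \<open>GL\<^sub>n(A)\<close>. A loop is approximated by a
  matrix of Laurent polynomials, and the Euclidean algorithm reduces it to a loop in \<open>GL\<^sub>1(A)\<close>
  with the same determinant; stable rank one is used to make leading coefficients invertible. For a
  loop in \<open>GL\<^sub>1(A)\<close>, passing to unitary parts shows that the exponential of the skew part of the
  determinant lies in \<open>CU(A)\<close>, so \<open>u\<close> does as well.
\<close>

section \<open>Positivity in C*-algebras\<close>

text \<open>Two obstacles shape the argument. An element \<open>u\<close> of the closed commutator
  subgroup is only a limit of finite products of commutators, so the path to such a product is
  corrected by a small exponential, and the determinant of the resulting loop is known up to the
  trace of a small logarithm, which tends to 0. Moreover, the determinant is defined modulo
  commutators of arbitrary elements, whereas exponentials in the quotient by the closed commutator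
  subgroup are controlled on skew elements only, where the kernel is merely a closed additive group.
  Skew parts reconcile the two, since the skew part of a commutator is a sum of commutators of skew
  elements. Lipschitz paths are chosen because an error of order 1/m^2 per step adds up to 1/m over
  a grid of m steps, and because products, exponentials, small logarithms and square roots preserve
  them. Square roots come from the binomial series and positivity from a norm inequality, so the
  polar decomposition of a path is given by formulas that stay Lipschitz.\<close>

lemma star_one [simp]: "star (1 :: 'a :: unital_cstar_algebra) = 1"
  by (metis mult_1 mult_1_right star_mult star_star)

lemma star_zero [simp]: "star (0 :: 'a :: unital_cstar_algebra) = 0"
  by (metis add_cancel_left_left star_add)

lemma star_scaleR: "star (r *\<^sub>R x) = r *\<^sub>R star (x :: 'a :: unital_cstar_algebra)"
  by (metis complex_cnj_complex_of_real scaleC_of_real star_scaleC)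

lemma norm_star [simp]: "norm (star x) = norm (x :: 'a :: unital_cstar_algebra)"
proof -
  have le: "norm y \<le> norm (star y)" for y :: 'a
  proof (cases "y = 0")
    case False
    have "(norm y)\<^sup>2 \<le> norm (star y) * norm y"
      by (metis cstar_identity norm_mult_ineq)
    then show ?thesis using False by (simp add: power2_eq_square)
  qed simp
  from le[of x] le[of "star x"] show ?thesis by (simp add: star_star)
qed

lemma bounded_linear_star: "bounded_linear (star :: 'a :: unital_cstar_algebra \<Rightarrow> 'a)"
  by (rule bounded_linear_intro[where K = 1]) (simp_all add: star_add star_scaleR)

lemmas star_minus = linear_neg[OF bounded_linear.linear[OF bounded_linear_star]]
lemmas star_diff = linear_diff[OF bounded_linear.linear[OF bounded_linear_star]]
lemmas star_sum = linear_sum[OF bounded_linear.linear[OF bounded_linear_star]]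

lemma star_power: "star (x ^ n) = star (x :: 'a :: unital_cstar_algebra) ^ n"
  by (induction n) (simp_all add: star_mult power_commutes)

section \<open>The binomial series for the square root of 1 - x\<close>

definition sqrt_coeff :: "nat \<Rightarrow> real" where
  "sqrt_coeff n = (1/2 gchoose n) * (-1) ^ n"

lemma sqrt_coeff_Suc: "sqrt_coeff (Suc n) = sqrt_coeff n * (real n - 1/2) / real (Suc n)"
proof -
  have "((1/2::real) gchoose Suc n) * real (Suc n) = (1/2 gchoose n) * (1/2 - real n)"
    using gbinomial_mult_1[of "1/2::real" n] by (simp add: algebra_simps)
  then have *: "((1/2::real) gchoose Suc n) = (1/2 gchoose n) * (1/2 - real n) / real (Suc n)"
    by (simp only: eq_divide_eq) simp
  show ?thesis
    unfolding sqrt_coeff_def * by (simp add: algebra_simps diff_divide_distrib)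
qed

lemma sqrt_coeff_nonpos: "sqrt_coeff (Suc n) \<le> 0"
proof (induction n)
  case 0
  then show ?case by (simp add: sqrt_coeff_def)
next
  case (Suc n)
  have "sqrt_coeff (Suc (Suc n)) = sqrt_coeff (Suc n) * ((real (Suc n) - 1/2) / real (Suc (Suc n)))"
    by (subst sqrt_coeff_Suc) simp
  also have "\<dots> \<le> 0"
    using Suc by (intro mult_nonpos_nonneg) auto
  finally show ?case .
qed

text \<open>Alternating partial sums of generalized binomial coefficients collapse to a single
  coefficient for exponent -1/2, and there the signs cancel.\<close>

lemma sum_sqrt_coeff_nonneg: "(\<Sum>k\<le>n. sqrt_coeff k) \<ge> 0"
proof -
  have "(\<Sum>k\<le>n. sqrt_coeff k) = (-1) ^ n * (-1/2 gchoose n)"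
    unfolding sqrt_coeff_def using gbinomial_sum_lower_neg[of "1/2::real" n] by simp
  also have "\<dots> = pochhammer (1/2) n / fact n"
    by (simp add: gbinomial_pochhammer power_mult_distrib[symmetric])
  also have "\<dots> \<ge> 0"
    by (simp add: pochhammer_prod prod_nonneg)
  finally show ?thesis .
qed

text \<open>Only the zeroth coefficient, which is 1, is positive, so the absolute sum is 2 minus the
  partial sum itself.\<close>

lemma sum_abs_sqrt_coeff: "(\<Sum>k\<le>n. \<bar>sqrt_coeff k\<bar>) \<le> 2"
proof -
  have "(\<Sum>k\<le>n. \<bar>sqrt_coeff k\<bar>) = 2 - (\<Sum>k\<le>n. sqrt_coeff k)"
  proof (induction n)
    case (Suc n)
    then show ?case using sqrt_coeff_nonpos[of n] by simp
  qed (simp add: sqrt_coeff_def)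
  then show ?thesis using sum_sqrt_coeff_nonneg[of n] by simp
qed

lemma summable_sqrt_coeff: "summable (\<lambda>n. \<bar>sqrt_coeff n\<bar>)"
  by (rule bounded_imp_summable[where B = 2]) (auto intro: sum_abs_sqrt_coeff)

lemma abs_sqrt_coeff_le: "\<bar>sqrt_coeff n\<bar> \<le> 2"
proof -
  have "\<bar>sqrt_coeff n\<bar> \<le> (\<Sum>k\<le>n. \<bar>sqrt_coeff k\<bar>)"
    by (rule member_le_sum) auto
  with sum_abs_sqrt_coeff[of n] show ?thesis by linarith
qed

text \<open>By Vandermonde's identity the Cauchy square of the series has the coefficients of (1 -
  x)^1.\<close>

lemma sqrt_coeff_convolution:
  "(\<Sum>k\<le>n. sqrt_coeff k * sqrt_coeff (n - k)) = (if n = 0 then 1 else if n = 1 then -1 else 0)"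
proof -
  have "(\<Sum>k\<le>n. sqrt_coeff k * sqrt_coeff (n - k))
      = (\<Sum>k=0..n. (1/2 gchoose k) * (1/2 gchoose (n - k))) * (-1) ^ n"
    unfolding sqrt_coeff_def sum_distrib_right atLeast0AtMost
    by (intro sum.cong) (auto simp: power_add[symmetric] algebra_simps)
  also have "\<dots> = (1 gchoose n) * (-1) ^ n"
    by (subst gbinomial_Vandermonde) simp
  also have "\<dots> = (if n = 0 then 1 else if n = 1 then -1 else 0)"
  proof -
    have "(1::real) gchoose n = of_nat (1 choose n)"
      by (simp only: binomial_gbinomial of_nat_1)
    then show ?thesis by (auto simp: binomial_eq_0)
  qed
  finally show ?thesis .
qed

definition sqrt_series :: "'a :: {real_normed_algebra_1, banach} \<Rightarrow> 'a" where
  "sqrt_series y = (\<Sum>n. sqrt_coeff n *\<^sub>R y ^ n)"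

lemma summable_sqrt_series:
  fixes y :: "'a :: {real_normed_algebra_1, banach}"
  assumes "norm y \<le> 1"
  shows "summable (\<lambda>n. norm (sqrt_coeff n *\<^sub>R y ^ n))"
proof (rule summable_comparison_test'[OF summable_sqrt_coeff, of 0])
  fix n
  have "norm (y ^ n) \<le> 1"
    using norm_power_ineq[of y n] power_le_one[OF norm_ge_zero assms, of n] by linarith
  then show "norm (norm (sqrt_coeff n *\<^sub>R y ^ n)) \<le> \<bar>sqrt_coeff n\<bar>"
    by (simp add: mult_left_le)
qed

lemma sqrt_series_square:
  fixes y :: "'a :: {real_normed_algebra_1, banach}"
  assumes "norm y \<le> 1"
  shows "sqrt_series y * sqrt_series y = 1 - y"
proof -
  let ?a = "\<lambda>n. sqrt_coeff n *\<^sub>R y ^ n"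
  let ?f = "\<lambda>n::nat. (if n = 0 then 1 else if n = 1 then -1 else 0) *\<^sub>R y ^ n"
  have "(\<lambda>n. \<Sum>k\<le>n. ?a k * ?a (n - k)) sums (sqrt_series y * sqrt_series y)"
    unfolding sqrt_series_def
    by (rule Cauchy_product_sums[OF summable_sqrt_series[OF assms] summable_sqrt_series[OF assms]])
  moreover have "(\<Sum>k\<le>n. ?a k * ?a (n - k)) = ?f n" for n
    by (simp flip: sqrt_coeff_convolution
        add: scaleR_sum_left power_add[symmetric] mult.commute[of "sqrt_coeff (n - _)"])
  ultimately have "?f sums (sqrt_series y * sqrt_series y)" by simp
  moreover have "?f sums (\<Sum>n\<in>{0,1}. ?f n)"
    by (rule sums_finite) auto
  ultimately show ?thesis
    using sums_unique2 by fastforce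
qed

lemma sqrt_series_commute:
  fixes y :: "'a :: {real_normed_algebra_1, banach}"
  assumes "norm y \<le> 1" "x * y = y * x"
  shows "x * sqrt_series y = sqrt_series y * x"
proof -
  have s: "summable (\<lambda>n. sqrt_coeff n *\<^sub>R y ^ n)"
    by (rule summable_norm_cancel[OF summable_sqrt_series[OF assms(1)]])
  have "x * y ^ n = y ^ n * x" for n
    by (induction n) (simp_all add: assms(2) mult.assoc, metis assms(2) mult.assoc)
  then show ?thesis
    unfolding sqrt_series_def by (simp add: suminf_mult[OF s, symmetric] suminf_mult2[OF s])
qed

lemma star_sqrt_series:
  fixes y :: "'a :: unital_cstar_algebra"
  assumes "norm y \<le> 1"
  shows "star (sqrt_series y) = sqrt_series (star y)"
  unfolding sqrt_series_def
  by (simp add: bounded_linear.suminf[OF bounded_linear_star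
        summable_norm_cancel[OF summable_sqrt_series[OF assms]]] star_scaleR star_power)

text \<open>Without its constant term the series has absolute coefficient sum at most 2 - 1. Being
  within distance 1 of the unit is what makes the root \<open>positive\<close>.\<close>

lemma norm_one_minus_sqrt_series:
  fixes y :: "'a :: {real_normed_algebra_1, banach}"
  assumes "norm y \<le> 1"
  shows "norm (1 - sqrt_series y) \<le> 1"
proof -
  let ?a = "\<lambda>n. sqrt_coeff n *\<^sub>R y ^ n"
  have s: "summable ?a"
    by (rule summable_norm_cancel[OF summable_sqrt_series[OF assms]])
  have "sqrt_series y = (\<Sum>n. ?a (Suc n)) + 1"
    unfolding sqrt_series_def using suminf_split_head[OF s] by (simp add: sqrt_coeff_def)
  then have "norm (1 - sqrt_series y) = norm (\<Sum>n. ?a (Suc n))"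
    by (simp add: norm_minus_commute)
  also have "\<dots> \<le> (\<Sum>n. \<bar>sqrt_coeff (Suc n)\<bar>)"
  proof (rule norm_suminf_le)
    show "summable (\<lambda>n. \<bar>sqrt_coeff (Suc n)\<bar>)"
      using summable_Suc_iff[of "\<lambda>n. \<bar>sqrt_coeff n\<bar>"] summable_sqrt_coeff by simp
    show "norm (?a (Suc n)) \<le> \<bar>sqrt_coeff (Suc n)\<bar>" for n
      using norm_power_ineq[of y "Suc n"] power_le_one[OF norm_ge_zero assms, of "Suc n"]
      by (simp add: mult_left_le)
  qed
  also have "\<dots> = (\<Sum>n. \<bar>sqrt_coeff n\<bar>) - 1"
    using suminf_split_head[OF summable_sqrt_coeff] by (simp add: sqrt_coeff_def)
  also have "\<dots> \<le> 1"
  proof -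
    have "(\<Sum>k<n. \<bar>sqrt_coeff k\<bar>) \<le> 2" for n
      using sum_abs_sqrt_coeff[of "n - 1"] by (cases n) (auto simp: lessThan_Suc_atMost)
    then show ?thesis using suminf_le_const[OF summable_sqrt_coeff, of 2] by simp
  qed
  finally show ?thesis .
qed

text \<open>A description of nonnegative spectrum by norms: a self-adjoint h qualifies when it lies
  in the ball of radius t around t for some t. Sums are immediate, and 1 - h/t becomes an admissible
  argument of \<open>sqrt_series\<close>.\<close>

definition positive :: "'a :: unital_cstar_algebra \<Rightarrow> bool" where
  "positive h \<longleftrightarrow> star h = h \<and> (\<exists>t. norm (t *\<^sub>R 1 - h) \<le> t)"

lemma positive_selfadjoint: "positive h \<Longrightarrow> star h = h"
  by (simp add: positive_def)

lemma positive_add: "positive h \<Longrightarrow> positive k \<Longrightarrow> positive (h + k)"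
  unfolding positive_def
proof (elim conjE exE, intro conjI)
  fix s t assume "norm (s *\<^sub>R 1 - h) \<le> s" "norm (t *\<^sub>R 1 - k) \<le> t"
  then have "norm ((s + t) *\<^sub>R 1 - (h + k)) \<le> s + t"
    using norm_triangle_ineq[of "s *\<^sub>R 1 - h" "t *\<^sub>R 1 - k"] by (simp add: algebra_simps)
  then show "\<exists>t. norm (t *\<^sub>R 1 - (h + k)) \<le> t" by blast
qed (simp add: star_add)

lemma positive_scaleR:
  assumes "positive h" "r \<ge> 0"
  shows "positive (r *\<^sub>R h)"
proof -
  obtain t where "norm (t *\<^sub>R 1 - h) \<le> t" using assms(1) by (auto simp: positive_def)
  then have "norm ((r * t) *\<^sub>R 1 - r *\<^sub>R h) \<le> r * t"
    using assms(2) by (simp flip: scaleR_scaleR scaleR_diff_right add: mult_left_mono)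
  then show ?thesis using assms(1) by (auto simp: positive_def star_scaleR)
qed

lemma positive_of_real: "r \<ge> 0 \<Longrightarrow> positive (r *\<^sub>R 1)"
  unfolding positive_def by (auto simp: star_scaleR intro!: exI[of _ r])

lemma positive_zero [simp]: "positive 0"
  using positive_of_real[of 0] by simp

lemma positive_sum: "(\<And>i. i \<in> I \<Longrightarrow> positive (f i)) \<Longrightarrow> positive (sum f I)"
  by (induction I rule: infinite_finite_induct) (auto intro: positive_add)

lemma positive_norm_minus:
  assumes "star h = h" "norm h \<le> t"
  shows "positive (t *\<^sub>R 1 - h)"
  using assms by (auto simp: positive_def star_diff star_scaleR intro!: exI[of _ t])

text \<open>Rescaling gives h = t (1 - y) with y of norm at most 1. The last clause, commutation
  with everything that commutes with h, allows roots of commuting elements to be multiplied.\<close>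

lemma positive_sqrt:
  assumes "positive h"
  obtains c where "positive c" "c * c = h" "\<And>x. x * h = h * x \<Longrightarrow> x * c = c * x"
proof -
  obtain t where t: "norm (t *\<^sub>R 1 - h) \<le> t" and h: "star h = h"
    using assms by (auto simp: positive_def)
  show ?thesis
  proof (cases "t = 0")
    case True
    then have "h = 0" using t by simp
    then show ?thesis by (intro that[of 0]) auto
  next
    case False
    then have tp: "t > 0" using t norm_ge_zero[of "t *\<^sub>R 1 - h"] by linarith
    define y where "y = 1 - (1/t) *\<^sub>R h"
    have y_eq: "y = (1/t) *\<^sub>R (t *\<^sub>R 1 - h)"
      using tp by (simp add: y_def scaleR_diff_right)
    have y: "norm y \<le> 1" unfolding y_eq using t tp by simp
    have ys: "star y = y" by (simp add: y_def star_diff star_scaleR h)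
    show ?thesis
    proof (rule that[of "sqrt t *\<^sub>R sqrt_series y"])
      have "positive (sqrt_series y)"
        unfolding positive_def using norm_one_minus_sqrt_series[OF y]
        by (auto simp: star_sqrt_series[OF y] ys intro!: exI[of _ 1])
      then show "positive (sqrt t *\<^sub>R sqrt_series y)"
        using tp by (simp add: positive_scaleR)
      have "sqrt t *\<^sub>R sqrt_series y * (sqrt t *\<^sub>R sqrt_series y) = t *\<^sub>R (1 - y)"
        using tp by (simp add: sqrt_series_square[OF y])
      then show "sqrt t *\<^sub>R sqrt_series y * (sqrt t *\<^sub>R sqrt_series y) = h"
        using tp by (simp add: y_def)
    next
      fix x assume "x * h = h * x"
      then have "x * y = y * x" by (simp add: y_def algebra_simps)
      then show "x * (sqrt t *\<^sub>R sqrt_series y) = sqrt t *\<^sub>R sqrt_series y * x"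
        by (simp add: sqrt_series_commute[OF y])
    qed
  qed
qed

lemma scaleC_minus_left: "(- c) *\<^sub>C x = - (c *\<^sub>C (x :: 'a :: unital_cstar_algebra))"
proof -
  have "(- c) *\<^sub>C x + c *\<^sub>C x = complex_of_real 0 *\<^sub>C x"
    by (simp flip: scaleC_add_left)
  also have "\<dots> = 0" by (simp only: scaleC_of_real scaleR_zero_left)
  finally show ?thesis by (simp add: eq_neg_iff_add_eq_0)
qed

lemma scaleC_one [simp]: "1 *\<^sub>C x = (x :: 'a :: unital_cstar_algebra)"
  using scaleC_of_real[of 1 x] by simp

lemma scaleC_zero_right [simp]: "c *\<^sub>C (0 :: 'a :: unital_cstar_algebra) = 0"
  by (metis add_cancel_left_left scaleC_add_right)

lemma scaleC_minus_right: "c *\<^sub>C (- x) = - (c *\<^sub>C (x :: 'a :: unital_cstar_algebra))"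
  by (metis add.left_inverse eq_neg_iff_add_eq_0 scaleC_add_right scaleC_zero_right)

lemma scaleC_diff_right: "c *\<^sub>C (x - y) = c *\<^sub>C x - c *\<^sub>C (y :: 'a :: unital_cstar_algebra)"
  using scaleC_add_right[of c x "- y"] by (simp add: scaleC_minus_right)

lemma scaleC_i_i [simp]: "\<i> *\<^sub>C \<i> *\<^sub>C x = - (x :: 'a :: unital_cstar_algebra)"
  by (simp add: scaleC_scaleC scaleC_minus_left)

lemma scaleC_scaleR: "c *\<^sub>C (r *\<^sub>R x) = r *\<^sub>R c *\<^sub>C (x :: 'a :: unital_cstar_algebra)"
  by (simp add: scaleC_of_real[symmetric] scaleC_scaleC mult.commute)

text \<open>The elements \<open>a + i b\<close> with \<open>a\<close>, \<open>b\<close> self-adjoint, commuting and \<open>a\<^sup>2 + b\<^sup>2 = s\<^sup>2\<close>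
  are multiples of unitaries; this bounds the norms of their real and imaginary parts.\<close>

lemma norm_le_of_squares:
  fixes a b :: "'a :: unital_cstar_algebra"
  assumes "star a = a" "star b = b" "a * b = b * a" "a * a + b * b = (s\<^sup>2) *\<^sub>R 1" "s \<ge> 0"
  shows "norm a \<le> s"
proof -
  define u where "u = a + \<i> *\<^sub>C b"
  have su: "star u = a - \<i> *\<^sub>C b"
    by (simp add: u_def star_add star_scaleC assms scaleC_minus_left)
  have "star u * u = (a - \<i> *\<^sub>C b) * (a + \<i> *\<^sub>C b)"
    by (simp only: su) (simp only: u_def)
  also have "\<dots> = a * a + b * b"
    by (simp add: distrib_left left_diff_distrib mult_scaleC_left mult_scaleC_right assms(3)
        scaleC_diff_right)
  finally have "star u * u = (s\<^sup>2) *\<^sub>R 1"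
    using assms by simp
  then have "(norm u)\<^sup>2 = s\<^sup>2" using cstar_identity[of u] by simp
  then have "norm u = s" using assms(5) by (simp add: power2_eq_iff_nonneg)
  moreover have "a = (1/2) *\<^sub>R (u + star u)"
    unfolding su by (simp add: u_def scaleR_2[symmetric])
  ultimately show ?thesis
    using norm_triangle_ineq[of u "star u"] by simp
qed

text \<open>With a scaled to norm 1, let b be the series root of 1 - a^2. Then a^2 + b^2 = 1, so b
  is a contraction, and 1 - a^2 = b^2 has norm at most 1. This is the defining inequality, with t
  the square of the original norm.\<close>

lemma positive_square:
  assumes "star a = a"
  shows "positive (a * a)"
proof (cases "a = 0")
  case False
  define y where "y = (1 / (norm a)\<^sup>2) *\<^sub>R (a * a)"
  have na: "norm (a * a) = (norm a)\<^sup>2" using cstar_identity[of a] assms by simp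
  have y: "norm y \<le> 1" using False by (simp add: y_def na)
  have ys: "star y = y" by (simp add: y_def star_scaleR star_mult assms)
  define b where "b = sqrt_series y"
  define a' where "a' = (1 / norm a) *\<^sub>R a"
  have b: "star b = b" "b * b = 1 - y"
    by (simp_all add: b_def star_sqrt_series[OF y] ys sqrt_series_square[OF y])
  have "a' * y = y * a'" by (simp add: a'_def y_def mult.assoc)
  then have comm: "a' * b = b * a'" unfolding b_def by (rule sqrt_series_commute[OF y])
  have "a' * a' = y" by (simp add: a'_def y_def power2_eq_square)
  then have "norm b \<le> 1"
    by (intro norm_le_of_squares[of b a' 1])
       (simp_all add: b comm, simp add: a'_def star_scaleR assms)
  then have "norm (b * b) \<le> 1"
    using norm_mult_ineq[of b b] mult_le_one[of "norm b" "norm b"] by simp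
  moreover have "(norm a)\<^sup>2 *\<^sub>R 1 - a * a = (norm a)\<^sup>2 *\<^sub>R (b * b)"
    using False by (simp add: b y_def scaleR_diff_right)
  ultimately have "norm ((norm a)\<^sup>2 *\<^sub>R 1 - a * a) \<le> (norm a)\<^sup>2"
    by (simp add: mult_left_le)
  then show ?thesis by (auto simp: positive_def star_mult assms)
qed simp

text \<open>Commuting roots c and d exhibit the product as the square of the self-adjoint element c
  d.\<close>

lemma positive_mult:
  assumes "positive h" "positive k" "h * k = k * h"
  shows "positive (h * k)"
proof -
  obtain c where c: "positive c" "c * c = h" "\<And>x. x * h = h * x \<Longrightarrow> x * c = c * x"
    using positive_sqrt[OF assms(1)] by blast
  obtain d where d: "positive d" "d * d = k" "\<And>x. x * k = k * x \<Longrightarrow> x * d = d * x"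
    using positive_sqrt[OF assms(2)] by blast
  have "k * c = c * k" using c(3) assms(3) by metis
  then have cd: "c * d = d * c" using d(3) by metis
  have "h * k = (c * d) * (c * d)"
    by (metis c(2) cd d(2) mult.assoc)
  moreover have "star (c * d) = c * d" 
    by (simp add: star_mult c(1) d(1) positive_selfadjoint cd)
  ultimately show ?thesis using positive_square by metis
qed

text \<open>A root d of (t - h) (t + h) commutes with h and satisfies h^2 + d^2 = t^2, which is the
  situation of \<open>norm_le_of_squares\<close>.\<close>

lemma norm_le_of_positive:
  assumes "positive (t *\<^sub>R 1 - h)" "positive (t *\<^sub>R 1 + h)"
  shows "norm h \<le> t"
proof -
  have h: "star h = h"
    using positive_selfadjoint[OF assms(2)] by (simp add: star_add star_scaleR)
  have t: "t \<ge> 0"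
  proof -
    have "positive ((t + t) *\<^sub>R 1 :: 'a)"
      using positive_add[OF assms] unfolding scaleR_add_left by simp
    then obtain s where "norm (s *\<^sub>R 1 - (t + t) *\<^sub>R (1 :: 'a)) \<le> s"
      unfolding positive_def by blast
    then have "\<bar>s - (t + t)\<bar> \<le> s"
      unfolding scaleR_diff_left[symmetric] by simp
    then show ?thesis by linarith
  qed
  have "(t *\<^sub>R 1 - h) * (t *\<^sub>R 1 + h) = (t *\<^sub>R 1 + h) * (t *\<^sub>R 1 - h)"
    by (simp add: algebra_simps)
  from positive_mult[OF assms this]
  obtain d where d: "positive d" "d * d = (t *\<^sub>R 1 - h) * (t *\<^sub>R 1 + h)"
    "\<And>x. x * ((t *\<^sub>R 1 - h) * (t *\<^sub>R 1 + h)) = ((t *\<^sub>R 1 - h) * (t *\<^sub>R 1 + h)) * x \<Longrightarrow> x * d = d * x"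
    using positive_sqrt by blast
  have "h * d = d * h" by (rule d(3)) (simp add: algebra_simps)
  moreover have "h * h + d * d = (t\<^sup>2) *\<^sub>R 1"
    by (simp add: d(2) algebra_simps power2_eq_square)
  ultimately show ?thesis 
    using norm_le_of_squares[of h d t] h positive_selfadjoint[OF d(1)] t by simp
qed

text \<open>The definition grants this inequality for one t only. Applying
  \<open>norm_le_of_positive\<close> to t - h extends it to every t from the norm of h
  upwards.\<close>

lemma positive_minus_real:
  assumes "positive h" "norm h \<le> t"
  shows "norm (t *\<^sub>R 1 - h) \<le> t"
proof (rule norm_le_of_positive)
  show "positive (t *\<^sub>R 1 - (t *\<^sub>R 1 - h))" using assms by simp
  have "positive (t *\<^sub>R 1 + (t *\<^sub>R 1 - h))"
    using assms order_trans[OF norm_ge_zero assms(2)]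
    by (intro positive_add positive_of_real positive_norm_minus positive_selfadjoint) auto
  then show "positive (t *\<^sub>R 1 + (t *\<^sub>R 1 - h))" .
qed

lemma norm_mono_positive:
  assumes "positive h" "positive (k - h)"
  shows "norm h \<le> norm k"
proof (rule norm_le_of_positive)
  have k: "star k = k"
    using positive_selfadjoint[OF positive_add[OF assms]] by simp
  have "positive ((norm k *\<^sub>R 1 - k) + (k - h))"
    by (intro positive_add assms positive_norm_minus k order_refl)
  then show "positive (norm k *\<^sub>R 1 - h)" by simp
  show "positive (norm k *\<^sub>R 1 + h)"
    by (intro positive_add assms positive_of_real norm_ge_zero)
qed

text \<open>The contradiction is that \<open>star y * y\<close> would be minus a positive element \<open>p\<close>, and
  \<open>q = y * star y\<close> positive. Since \<open>y * p = - q * y\<close>, the norm of \<open>p + p\<^sup>2 = - star y * (1 - q) * y\<close>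
  is then too small.\<close>

lemma negative_star_mult_eq_zero:
  fixes y :: "'a :: unital_cstar_algebra"
  assumes "positive (- (star y * y))"
  shows "y = 0"
proof (rule ccontr)
  assume "y \<noteq> 0"
  define z where "z = (1 / norm y) *\<^sub>R y"
  define p where "p = - (star z * z)"
  define q where "q = z * star z"
  have nz: "norm z = 1" using \<open>y \<noteq> 0\<close> by (simp add: z_def)
  have "p = (1 / norm y)\<^sup>2 *\<^sub>R (- (star y * y))"
    by (simp add: p_def z_def star_scaleR power2_eq_square)
  then have p: "positive p" by (simp only: positive_scaleR[OF assms] zero_le_power2)
  have np: "norm p = 1" by (simp add: p_def cstar_identity nz)
  have nq: "norm q = 1" using cstar_identity[of "star z"] by (simp add: q_def star_star nz)
  \<comment> \<open>With a and b the real and imaginary parts of z,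
    \<open>star z * z + z * star z\<close> is 2 (a^2 + b^2), and q is this sum plus p.\<close>
  have q: "positive q"
  proof -
    define a where "a = (1/2) *\<^sub>R (z + star z)"
    define b where "b = (1/2) *\<^sub>R (\<i> *\<^sub>C (star z - z))"
    have a: "star a = a" by (simp add: a_def star_scaleR star_add star_star add.commute)
      have b: "star b = b"
      by (simp add: b_def star_scaleR star_scaleC star_diff star_star scaleC_minus_left
          flip: scaleC_minus_right)
    have "4 *\<^sub>R (a * a) = (z + star z) * (z + star z)" by (simp add: a_def)
    moreover have "4 *\<^sub>R (b * b) = - ((star z - z) * (star z - z))"
      by (simp add: b_def mult_scaleC_left mult_scaleC_right scaleC_scaleR)
    ultimately have "4 *\<^sub>R (a * a + b * b) = (star z * z + z * star z) + (star z * z + z * star z)"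
      by (simp add: scaleR_add_right algebra_simps)
    then have "4 *\<^sub>R (a * a + b * b) = 2 *\<^sub>R (star z * z + z * star z)"
      by (simp only: scaleR_2[symmetric])
    then have "(1/2) *\<^sub>R 4 *\<^sub>R (a * a + b * b) = (1/2) *\<^sub>R 2 *\<^sub>R (star z * z + z * star z)"
      by (simp only:)
    then have "2 *\<^sub>R (a * a + b * b) = star z * z + z * star z" by simp
    then have "q = p + 2 *\<^sub>R (a * a + b * b)" by (simp add: p_def q_def)
    then show ?thesis
      using p positive_square[OF a] positive_square[OF b] by (simp add: positive_add positive_scaleR)
  qed
  have "p + p * p = - (star z * (1 - q) * z)"
    by (simp add: p_def q_def algebra_simps)
  then have "norm (p + p * p) \<le> norm (star z) * norm (1 - q) * norm z"
    by (metis (no_types, lifting) dual_order.trans mult_right_mono norm_ge_zero norm_minus_cancel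
        norm_mult_ineq)
  also have "\<dots> \<le> 1" using positive_minus_real[OF q, of 1] by (simp add: nz nq)
  finally have le: "norm (p + p * p) \<le> 1" .
  have "positive (1 - p)"
    using positive_norm_minus[of p 1] positive_selfadjoint[OF p] np by simp
  then have "positive (p * (1 - p))"
    by (intro positive_mult p) (simp_all add: algebra_simps)
  \<comment> \<open>Since p is at most 1, p + p^2 dominates 2 p^2, an element of norm 2; its own
    norm is at most 1.\<close>
  then have "positive ((p + p * p) - 2 *\<^sub>R (p * p))"
    by (simp add: scaleR_2 algebra_simps)
  moreover have "positive (2 *\<^sub>R (p * p))"
    by (intro positive_scaleR positive_square positive_selfadjoint p) simp
  ultimately have "norm (2 *\<^sub>R (p * p)) \<le> norm (p + p * p)"
    by (intro norm_mono_positive)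
  moreover have "norm (p * p) = 1"
    using cstar_identity[of p] positive_selfadjoint[OF p] np by simp
  ultimately show False using le by simp
qed

text \<open>Here b is the absolute value of h = \<open>star x * x\<close>, and z = b - h is twice
  the negative part. Since h z = - b z, the element x z satisfies the hypothesis of
  \<open>negative_star_mult_eq_zero\<close>. Hence x z = 0, which forces z = 0 and h = b.\<close>

lemma positive_star_mult: "positive (star x * x)"
proof -
  define h where "h = star x * x"
  have h: "star h = h" by (simp add: h_def star_mult star_star)
  obtain b where b: "positive b" "b * b = h * h" "\<And>x. x * (h * h) = h * h * x \<Longrightarrow> x * b = b * x"
    using positive_sqrt[OF positive_square[OF h]] by blast
  have hb: "h * b = b * h" by (rule b(3)) (simp add: mult.assoc)
  obtain c where c: "positive c" "c * c = b" "\<And>x. x * b = b * x \<Longrightarrow> x * c = c * x"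
    using positive_sqrt[OF b(1)] by blast
  have hc: "h * c = c * h" by (rule c(3)[OF hb])
  define z where "z = b - h"
  have sz: "star z = z" by (simp add: z_def star_diff h positive_selfadjoint[OF b(1)])
  have zc: "z * c = c * z" using hc c(3)[of b] by (simp add: z_def algebra_simps)
  have hz: "h * z = - (b * z)" using b(2) hb by (simp add: z_def algebra_simps)
  have zz: "z * z = 2 *\<^sub>R (b * z)" using b(2) hb by (simp add: z_def algebra_simps scaleR_2)
  have bz: "z * b = b * z" using hb by (simp add: z_def algebra_simps)
  have "star (x * z) * (x * z) = z * (h * z)"
    by (simp add: star_mult sz h_def mult.assoc)
  also have "\<dots> = - ((c * z) * (c * z))"
    unfolding hz by (metis bz c(2) mult.assoc mult_minus_right zc)
  finally have "positive (- (star (x * z) * (x * z)))"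
    using positive_square[of "c * z"] by (simp add: star_mult sz zc positive_selfadjoint[OF c(1)])
  then have xz: "x * z = 0" by (rule negative_star_mult_eq_zero)
  then have "h * z = 0" by (simp add: h_def mult.assoc)
  then have "z * z = 0" using hz zz by simp
  then have "z = 0" using cstar_identity[of z] by (simp add: sz)
  then show ?thesis using b(1) by (simp add: z_def h_def)
qed

section \<open>The Hilbert module of tuples\<close>

lemma positive_conj:
  assumes "positive h"
  shows "positive (star x * h * x)"
proof -
  obtain c where c: "positive c" "c * c = h" using positive_sqrt[OF assms] by blast
  have "star x * h * x = star (c * x) * (c * x)"
    unfolding c(2)[symmetric] by (simp only: star_mult positive_selfadjoint[OF c(1)] mult.assoc)
  then show ?thesis using positive_star_mult by simp
qed

lemma norm_le_module:
  fixes x :: "'i \<Rightarrow> 'a :: unital_cstar_algebra"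
  assumes "finite I" "i \<in> I"
  shows "norm (x i) \<le> sqrt (norm (\<Sum>i\<in>I. star (x i) * x i))"
proof -
  have "norm (star (x i) * x i) \<le> norm (\<Sum>i\<in>I. star (x i) * x i)"
  proof (rule norm_mono_positive)
    show "positive ((\<Sum>i\<in>I. star (x i) * x i) - star (x i) * x i)"
      by (simp add: sum.remove[OF assms] positive_sum positive_star_mult)
  qed (rule positive_star_mult)
  then show ?thesis by (simp add: cstar_identity real_le_rsqrt)
qed

text \<open>The usual expansion of the square of y - x a with a = Z / s. Since X and Z need not
  commute, s is the norm of X, and \<open>star a * X * a\<close> is replaced by the larger
  \<open>s *\<^sub>R (star a * a)\<close>.\<close>

lemma module_Cauchy_Schwarz:
  fixes x y :: "'i \<Rightarrow> 'a :: unital_cstar_algebra"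
  assumes "finite I"
  shows "(norm (\<Sum>i\<in>I. star (x i) * y i))\<^sup>2
    \<le> norm (\<Sum>i\<in>I. star (x i) * x i) * norm (\<Sum>i\<in>I. star (y i) * y i)"
proof -
  define X Y Z where "X = (\<Sum>i\<in>I. star (x i) * x i)" and "Y = (\<Sum>i\<in>I. star (y i) * y i)"
    and "Z = (\<Sum>i\<in>I. star (x i) * y i)"
  have sZ: "star Z = (\<Sum>i\<in>I. star (y i) * x i)"
    by (simp add: Z_def star_sum star_mult star_star)
  have X: "positive X" by (simp add: X_def positive_sum positive_star_mult)
  show ?thesis
  proof (cases "norm X = 0")
    case True
    then have "x i = 0" if "i \<in> I" for i
      using norm_le_module[OF assms that, of x] by (simp add: X_def)
    then show ?thesis by simp
  next
    case False
    define s where "s = norm X"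
    have s: "s > 0" using False by (simp add: s_def)
    define a where "a = (1/s) *\<^sub>R Z"
    have "(\<Sum>i\<in>I. star (y i - x i * a) * (y i - x i * a))
        = (\<Sum>i\<in>I. star (y i) * y i - star (y i) * x i * a - star a * (star (x i) * y i)
            + star a * (star (x i) * x i) * a)"
      by (simp add: star_diff star_mult algebra_simps)
    also have "\<dots> = Y - star Z * a - star a * Z + star a * X * a"
      unfolding sZ by (simp only: X_def Y_def Z_def sum.distrib sum_subtractf
          sum_distrib_left sum_distrib_right)
    finally have "Y - star Z * a - star a * Z + star a * X * a
        = (\<Sum>i\<in>I. star (y i - x i * a) * (y i - x i * a))" ..
    then have "positive (Y - star Z * a - star a * Z + star a * X * a)"
      by (simp only: positive_sum positive_star_mult)
    moreover have "positive (star a * (s *\<^sub>R 1 - X) * a)"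
      by (intro positive_conj positive_norm_minus positive_selfadjoint X) (simp add: s_def)
    ultimately have "positive ((Y - star Z * a - star a * Z + star a * X * a)
        + star a * (s *\<^sub>R 1 - X) * a)"
      by (rule positive_add)
    also have "(Y - star Z * a - star a * Z + star a * X * a) + star a * (s *\<^sub>R 1 - X) * a
        = Y - (1/s) *\<^sub>R (star Z * Z)"
      using s by (simp add: a_def star_scaleR right_diff_distrib left_diff_distrib scaleR_diff_right)
    finally have "norm ((1/s) *\<^sub>R (star Z * Z)) \<le> norm Y"
      using s by (intro norm_mono_positive positive_scaleR positive_star_mult) auto
    then have "(norm Z)\<^sup>2 \<le> s * norm Y"
      using s by (simp add: cstar_identity field_simps)
    then show ?thesis by (simp add: s_def X_def Y_def Z_def)
  qed
qed

lemma module_norm_triangle: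
  fixes x y :: "'i \<Rightarrow> 'a :: unital_cstar_algebra"
  assumes "finite I"
  shows "sqrt (norm (\<Sum>i\<in>I. star (x i + y i) * (x i + y i)))
    \<le> sqrt (norm (\<Sum>i\<in>I. star (x i) * x i)) + sqrt (norm (\<Sum>i\<in>I. star (y i) * y i))"
    (is "_ \<le> sqrt (norm ?X) + sqrt (norm ?Y)")
proof -
  define Z where "Z = (\<Sum>i\<in>I. star (x i) * y i)"
  have sZ: "star Z = (\<Sum>i\<in>I. star (y i) * x i)"
    by (simp add: Z_def star_sum star_mult star_star)
  have nZ: "norm Z \<le> sqrt (norm ?X) * sqrt (norm ?Y)"
    unfolding real_sqrt_mult[symmetric] Z_def
    by (rule real_le_rsqrt[OF module_Cauchy_Schwarz[OF assms]])
  have "(\<Sum>i\<in>I. star (x i + y i) * (x i + y i)) = ?X + Z + star Z + ?Y"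
    unfolding sZ unfolding Z_def by (simp add: star_add algebra_simps sum.distrib)
  then have "norm (\<Sum>i\<in>I. star (x i + y i) * (x i + y i)) = norm (?X + Z + star Z + ?Y)"
    by (simp only:)
  also have "\<dots> \<le> norm ?X + norm Z + norm (star Z) + norm ?Y"
    by (intro order_trans[OF norm_triangle_ineq] add_right_mono order_refl)
  also have "\<dots> \<le> (sqrt (norm ?X) + sqrt (norm ?Y))\<^sup>2"
    using nZ by (simp add: power2_sum)
  finally show ?thesis by (intro real_le_lsqrt) auto
qed

section \<open>Lipschitz paths\<close>

text \<open>Paths are total functions on the reals, looked at on the unit interval only. On a grid
  of mesh 1/m their increments are of order 1/m.\<close>

definition lip_path :: "(real \<Rightarrow> 'a :: real_normed_vector) \<Rightarrow> bool" where
  "lip_path f \<longleftrightarrow> (\<exists>L. L-lipschitz_on {0..1} f)"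

lemma lip_pathI:
  assumes "\<And>s t. s \<in> {0..1} \<Longrightarrow> t \<in> {0..1} \<Longrightarrow> norm (f s - f t) \<le> L * \<bar>s - t\<bar>"
  shows "lip_path f"
  unfolding lip_path_def
proof (intro exI lipschitz_onI)
  show "dist (f s) (f t) \<le> \<bar>L\<bar> * dist s t" if "s \<in> {0..1}" "t \<in> {0..1}" for s t
    using order_trans[OF assms[OF that], of "\<bar>L\<bar> * \<bar>s - t\<bar>"]
    by (simp add: dist_norm mult_right_mono)
qed simp

lemma lip_pathE:
  assumes "lip_path f"
  obtains L where "L \<ge> 0" "\<And>s t. s \<in> {0..1} \<Longrightarrow> t \<in> {0..1} \<Longrightarrow> norm (f s - f t) \<le> L * \<bar>s - t\<bar>"
proof -
  obtain L where "L-lipschitz_on {0..1} f" using assms by (auto simp: lip_path_def)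
  then show thesis
    using that[of L] lipschitz_onD[of L "{0..1}" f] lipschitz_on_nonneg[of L "{0..1}" f]
    by (auto simp: dist_norm)
qed

lemma lip_path_const [simp]: "lip_path (\<lambda>t. c)"
  by (rule lip_pathI[of _ 0]) simp

lemma lip_path_bounded:
  assumes "lip_path f"
  obtains M where "M > 0" "\<And>t. t \<in> {0..1} \<Longrightarrow> norm (f t) \<le> M"
proof -
  obtain L where L: "L \<ge> 0" "\<And>s t. s \<in> {0..1} \<Longrightarrow> t \<in> {0..1} \<Longrightarrow> norm (f s - f t) \<le> L * \<bar>s - t\<bar>"
    using lip_pathE[OF assms] by blast
  have "norm (f t) \<le> norm (f 0) + L + 1" if t: "t \<in> {0..1}" for t
  proof -
    have "norm (f t) \<le> norm (f 0) + norm (f t - f 0)"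
      by (metis add.commute diff_add_cancel norm_triangle_ineq)
    also have "norm (f t - f 0) \<le> L * \<bar>t - 0\<bar>" using L(2)[OF t, of 0] by simp
    also have "\<dots> \<le> L" using L(1) t by (simp add: mult_left_le)
    finally show ?thesis by simp
  qed
  then show thesis using L(1) by (intro that[of "norm (f 0) + L + 1"]) (auto simp: add_nonneg_pos)
qed

lemma lip_path_cong:
  assumes "lip_path f" "\<And>t. t \<in> {0..1} \<Longrightarrow> f t = g t"
  shows "lip_path g"
  using assms lipschitz_on_transform unfolding lip_path_def by (metis lipschitz_on_def)

lemma lip_path_add: "lip_path f \<Longrightarrow> lip_path g \<Longrightarrow> lip_path (\<lambda>t. f t + g t)"
  unfolding lip_path_def using lipschitz_on_add by blast

lemma lip_path_bounded_linear:
  assumes "bounded_linear T" "lip_path f"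
  shows "lip_path (\<lambda>t. T (f t))"
proof -
  obtain L where L: "L \<ge> 0" "\<And>s t. s \<in> {0..1} \<Longrightarrow> t \<in> {0..1} \<Longrightarrow> norm (f s - f t) \<le> L * \<bar>s - t\<bar>"
    using lip_pathE[OF assms(2)] by blast
  obtain K where K: "K > 0" "\<And>x. norm (T x) \<le> norm x * K"
    using bounded_linear.pos_bounded[OF assms(1)] by blast
  show ?thesis
  proof (rule lip_pathI[of _ "L * K"])
    fix s t :: real assume "s \<in> {0..1}" "t \<in> {0..1}"
    then have "norm (f s - f t) * K \<le> (L * \<bar>s - t\<bar>) * K"
      using L(2)[of s t] K(1) by (intro mult_right_mono) auto
    then show "norm (T (f s) - T (f t)) \<le> L * K * \<bar>s - t\<bar>"
      using K(2)[of "f s - f t"]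
      by (simp add: linear_diff[OF bounded_linear.linear[OF assms(1)]] mult.assoc mult.commute[of K])
  qed
qed

lemma lip_path_mult:
  fixes f g :: "real \<Rightarrow> 'a :: real_normed_algebra"
  assumes "lip_path f" "lip_path g"
  shows "lip_path (\<lambda>t. f t * g t)"
proof -
  obtain L where L: "L \<ge> 0" "\<And>s t. s \<in> {0..1} \<Longrightarrow> t \<in> {0..1} \<Longrightarrow> norm (f s - f t) \<le> L * \<bar>s - t\<bar>"
    using lip_pathE[OF assms(1)] by blast
  obtain L' where L': "L' \<ge> 0" "\<And>s t. s \<in> {0..1} \<Longrightarrow> t \<in> {0..1} \<Longrightarrow> norm (g s - g t) \<le> L' * \<bar>s - t\<bar>"
    using lip_pathE[OF assms(2)] by blast
  obtain M where M: "M > 0" "\<And>t. t \<in> {0..1} \<Longrightarrow> norm (f t) \<le> M" using lip_path_bounded[OF assms(1)] by blast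
  obtain M' where M': "M' > 0" "\<And>t. t \<in> {0..1} \<Longrightarrow> norm (g t) \<le> M'" using lip_path_bounded[OF assms(2)] by blast
  show ?thesis
  proof (rule lip_pathI[of _ "L * M' + M * L'"])
    fix s t :: real assume st: "s \<in> {0..1}" "t \<in> {0..1}"
    have "norm (f s * g s - f t * g t) = norm ((f s - f t) * g s + f t * (g s - g t))"
      by (simp add: algebra_simps)
    also have "\<dots> \<le> norm (f s - f t) * norm (g s) + norm (f t) * norm (g s - g t)"
      by (intro norm_triangle_le add_mono norm_mult_ineq)
    also have "\<dots> \<le> (L * \<bar>s - t\<bar>) * M' + M * (L' * \<bar>s - t\<bar>)"
      using st L L' M M' by (intro add_mono mult_mono) (auto simp: less_imp_le)
    finally show "norm (f s * g s - f t * g t) \<le> (L * M' + M * L') * \<bar>s - t\<bar>"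
      by (simp add: algebra_simps)
  qed
qed

lemma lip_path_scaleR: "lip_path f \<Longrightarrow> lip_path (\<lambda>t. r *\<^sub>R f t)"
  by (rule lip_path_bounded_linear[OF bounded_linear_scaleR_right])

lemma lip_path_minus: "lip_path f \<Longrightarrow> lip_path (\<lambda>t. - f t)"
  by (rule lip_path_bounded_linear[OF bounded_linear_minus[OF bounded_linear_ident]])

lemma lip_path_diff: "lip_path f \<Longrightarrow> lip_path g \<Longrightarrow> lip_path (\<lambda>t. f t - g t)"
  using lip_path_add[OF _ lip_path_minus, of f g] by simp

lemma lip_path_sum: "(\<And>i. i \<in> I \<Longrightarrow> lip_path (f i)) \<Longrightarrow> lip_path (\<lambda>t. \<Sum>i\<in>I. f i t)"
  by (induction I rule: infinite_finite_induct) (auto intro: lip_path_add)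

lemma lip_path_compose:
  assumes "lip_path f" "\<And>t. t \<in> {0..1} \<Longrightarrow> f t \<in> X" "C-lipschitz_on X h"
  shows "lip_path (\<lambda>t. h (f t))"
proof -
  obtain L where "L-lipschitz_on {0..1} f" using assms(1) by (auto simp: lip_path_def)
  then have "(C * L)-lipschitz_on {0..1} (\<lambda>t. h (f t))"
    using assms(2) by (intro lipschitz_on_compose2 lipschitz_on_subset[OF assms(3)]) auto
  then show ?thesis by (auto simp: lip_path_def)
qed

section \<open>Polar decomposition\<close>

lemma norm_power_diff_le:
  fixes y z :: "'a :: real_normed_algebra_1"
  assumes "norm y \<le> r" "norm z \<le> r"
  shows "norm (y ^ n - z ^ n) \<le> real n * r ^ (n - 1) * norm (y - z)"
proof (induction n)
  case (Suc n)
  have r: "r \<ge> 0" using assms(1) norm_ge_zero[of y] by linarith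
  have "y ^ Suc n - z ^ Suc n = (y - z) * y ^ n + z * (y ^ n - z ^ n)"
    by (simp add: algebra_simps)
  then have "norm (y ^ Suc n - z ^ Suc n) \<le> norm (y - z) * norm (y ^ n) + norm z * norm (y ^ n - z ^ n)"
    by (metis add_mono norm_mult_ineq norm_triangle_le)
  also have "\<dots> \<le> norm (y - z) * r ^ n + r * (real n * r ^ (n - 1) * norm (y - z))"
    using assms r norm_power_ineq[of y n] power_mono[OF assms(1) norm_ge_zero, of n]
    by (intro add_mono mult_mono Suc) auto
  also have "\<dots> = real (Suc n) * r ^ (Suc n - 1) * norm (y - z)"
    by (cases n) (simp_all add: algebra_simps)
  finally show ?case .
qed simp

text \<open>The n-th power is Lipschitz with constant n r^(n - 1) on the ball of radius r, and these
  constants are summable only for r < 1. A uniform distance from the unit sphere therefore has to be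
  secured before roots of paths are taken.\<close>

lemma sqrt_series_lipschitz:
  assumes "r < 1"
  obtains C where "C-lipschitz_on {y :: 'a :: {real_normed_algebra_1, banach}. norm y \<le> r} sqrt_series"
proof (cases "r < 0")
  case True
  then have "{y :: 'a. norm y \<le> r} = {}"
    by (auto simp: not_le intro: less_le_trans[OF _ norm_ge_zero])
  then show thesis by (intro that[of 0]) simp
next
  case False
  then have r: "0 \<le> r" "r < 1" using assms by auto
  define C where "C = (\<Sum>n. 2 * (real n * r ^ (n - 1)))"
  have s: "summable (\<lambda>n. 2 * (real n * r ^ (n - 1)))"
  proof -
    have "summable (\<lambda>n. of_nat (Suc n) * r ^ n)"
      using geometric_deriv_sums[of r] r by (auto simp: sums_iff)
    then have "summable (\<lambda>n. real (Suc n) * r ^ (Suc n - 1))" by simp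
    then have "summable (\<lambda>n. real n * r ^ (n - 1))"
      using summable_Suc_iff[of "\<lambda>n. real n * r ^ (n - 1)"] by blast
    then show ?thesis by (rule summable_mult)
  qed
  show thesis
  proof (rule that[of C], rule lipschitz_onI)
    fix y z :: 'a assume yz: "y \<in> {y. norm y \<le> r}" "z \<in> {y. norm y \<le> r}"
    have sy: "summable (\<lambda>n. sqrt_coeff n *\<^sub>R y ^ n)" and sz: "summable (\<lambda>n. sqrt_coeff n *\<^sub>R z ^ n)"
      using yz r by (auto intro!: summable_norm_cancel[OF summable_sqrt_series])
    have "norm (sqrt_series y - sqrt_series z) = norm (\<Sum>n. sqrt_coeff n *\<^sub>R y ^ n - sqrt_coeff n *\<^sub>R z ^ n)"
      unfolding sqrt_series_def by (simp add: suminf_diff[OF sy sz])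
    also have "\<dots> \<le> (\<Sum>n. 2 * (real n * r ^ (n - 1)) * norm (y - z))"
    proof (rule norm_suminf_le)
      show "summable (\<lambda>n. 2 * (real n * r ^ (n - 1)) * norm (y - z))" by (rule summable_mult2[OF s])
      fix n
      have "norm (sqrt_coeff n *\<^sub>R y ^ n - sqrt_coeff n *\<^sub>R z ^ n) = \<bar>sqrt_coeff n\<bar> * norm (y ^ n - z ^ n)"
        by (simp flip: scaleR_diff_right)
      also have "\<dots> \<le> 2 * (real n * r ^ (n - 1) * norm (y - z))"
        using yz r by (intro mult_mono abs_sqrt_coeff_le norm_power_diff_le) auto
      finally show "norm (sqrt_coeff n *\<^sub>R y ^ n - sqrt_coeff n *\<^sub>R z ^ n) \<le> 2 * (real n * r ^ (n - 1)) * norm (y - z)"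
        by simp
    qed
    also have "\<dots> = C * norm (y - z)" unfolding C_def by (rule suminf_mult2[OF s, symmetric])
    finally show "dist (sqrt_series y) (sqrt_series z) \<le> C * dist y z" by (simp add: dist_norm)
  qed (unfold C_def, rule suminf_nonneg[OF s], use r in simp)
qed

text \<open>The inverse of h = \<open>star k * k\<close> is at most M^2, so h is at least 1/M^2.
  After division by M^2 this leaves the gap 1/M^4 that the root series requires.\<close>

lemma norm_one_minus_star_mult_le:
  fixes k ki :: "'a :: unital_cstar_algebra"
  assumes "k * ki = 1" "ki * k = 1" "norm k \<le> M" "norm ki \<le> M" "M \<ge> 1"
  shows "norm (1 - (1/M\<^sup>2) *\<^sub>R (star k * k)) \<le> 1 - 1 / M ^ 4"
proof -
  define h where "h = star k * k"
  define g where "g = ki * star ki"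
  define m where "m = M\<^sup>2"
  have m: "m \<ge> 1" using assms(5) by (simp add: m_def)
  have sk: "star k * star ki = 1" "star ki * star k = 1"
    using assms(1,2) by (metis star_mult star_one)+
  have h: "positive h" unfolding h_def by (rule positive_star_mult)
  have g: "positive g" unfolding g_def using positive_star_mult[of "star ki"] by (simp add: star_star)
  have gh: "g * h = 1" "h * g = 1"
    using assms(1,2) sk by (simp_all add: g_def h_def mult.assoc) (simp_all add: mult.assoc[symmetric])
  have nh: "norm h \<le> m"
    unfolding h_def m_def cstar_identity using assms(3) by (simp add: power_mono)
  have ng: "norm g \<le> m"
    using cstar_identity[of "star ki"] assms(4) by (simp add: g_def m_def star_star power_mono)
  \<comment> \<open>This product of commuting positive elements equals m h - 1.\<close>
  have "positive (h * (m *\<^sub>R 1 - g))"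
    by (intro positive_mult h positive_norm_minus positive_selfadjoint g ng) (simp add: algebra_simps gh)
  then have "positive ((1/m) *\<^sub>R (m *\<^sub>R h - 1))"
    using m by (intro positive_scaleR) (simp_all add: right_diff_distrib gh)
  then have 1: "positive (h - (1/m) *\<^sub>R 1)"
    using m by (simp add: scaleR_diff_right)
  have "norm (m *\<^sub>R 1 - h) \<le> m - 1/m"
  proof (rule norm_le_of_positive)
    show "positive ((m - 1/m) *\<^sub>R 1 - (m *\<^sub>R 1 - h))"
      using 1 by (simp add: scaleR_diff_left)
    have "1 / m \<le> 1" using m by simp
    then have "1 / m \<le> m" using m by linarith
    then show "positive ((m - 1/m) *\<^sub>R 1 + (m *\<^sub>R 1 - h))"
      by (intro positive_add positive_of_real positive_norm_minus positive_selfadjoint h nh) simp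
  qed
  moreover have "1 - (1/m) *\<^sub>R h = (1/m) *\<^sub>R (m *\<^sub>R 1 - h)"
    using m by (simp add: scaleR_diff_right)
  ultimately have "norm (1 - (1/m) *\<^sub>R h) \<le> (1/m) * (m - 1/m)"
    using m by (simp add: divide_right_mono)
  also have "\<dots> = 1 - 1 / M ^ 4"
  proof -
    have "M ^ 4 = m * m" by (simp add: m_def flip: power_add)
    then show ?thesis using m by (simp add: right_diff_distrib)
  qed
  finally show ?thesis by (simp add: h_def m_def)
qed

text \<open>The positive part p is M times the series root of \<open>star k * k\<close> / M^2, its
  inverse is p g with g the inverse of \<open>star k * k\<close>, and w = k p^(-1). All are
  pointwise formulas in k and ki, hence Lipschitz, and w closes up when k does.\<close>

lemma lip_path_polar:
  fixes k ki :: "real \<Rightarrow> 'a :: unital_cstar_algebra"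
  assumes lip: "lip_path k" "lip_path ki"
    and inv: "\<And>t. t \<in> {0..1} \<Longrightarrow> k t * ki t = 1" "\<And>t. t \<in> {0..1} \<Longrightarrow> ki t * k t = 1"
  obtains w p pinv :: "real \<Rightarrow> 'a" where
    "lip_path w" "lip_path p" "lip_path pinv"
    "\<And>t. t \<in> {0..1} \<Longrightarrow> k t = w t * p t"
    "\<And>t. t \<in> {0..1} \<Longrightarrow> star (w t) * w t = 1" "\<And>t. t \<in> {0..1} \<Longrightarrow> w t * star (w t) = 1"
    "\<And>t. t \<in> {0..1} \<Longrightarrow> p t * pinv t = 1" "\<And>t. t \<in> {0..1} \<Longrightarrow> pinv t * p t = 1"
    "\<And>t. t \<in> {0..1} \<Longrightarrow> star (p t) = p t" "\<And>t. t \<in> {0..1} \<Longrightarrow> star (pinv t) = pinv t"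
    "k 0 = k 1 \<Longrightarrow> w 0 = w 1"
proof -
  obtain M1 where M1: "M1 > 0" "\<And>t. t \<in> {0..1} \<Longrightarrow> norm (k t) \<le> M1" using lip_path_bounded[OF lip(1)] by blast
  obtain M2 where M2: "M2 > 0" "\<And>t. t \<in> {0..1} \<Longrightarrow> norm (ki t) \<le> M2" using lip_path_bounded[OF lip(2)] by blast
  define M where "M = max 1 (max M1 M2)"
  have M: "M \<ge> 1" "\<And>t. t \<in> {0..1} \<Longrightarrow> norm (k t) \<le> M" "\<And>t. t \<in> {0..1} \<Longrightarrow> norm (ki t) \<le> M"
    using M1 M2 by (force simp: M_def)+
  define r where "r = 1 - 1 / M ^ 4"
  have r: "r < 1" using M(1) by (simp add: r_def)
  define h where "h t = star (k t) * k t" for t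
  define g where "g t = ki t * star (ki t)" for t
  define y where "y t = 1 - (1/M\<^sup>2) *\<^sub>R h t" for t
  define p where "p t = M *\<^sub>R sqrt_series (y t)" for t
  define pinv where "pinv t = p t * g t" for t
  define w where "w t = k t * pinv t" for t
  have y: "norm (y t) \<le> r" if "t \<in> {0..1}" for t
    unfolding y_def h_def r_def using norm_one_minus_star_mult_le inv M that by blast
  then have y1: "norm (y t) \<le> 1" if "t \<in> {0..1}" for t
    using r that by force
  have sy: "star (y t) = y t" for t
    by (simp add: y_def h_def star_diff star_scaleR star_mult star_star)
  have lip_h: "lip_path h" "lip_path g"
    unfolding h_def g_def
    by (intro lip_path_mult lip lip_path_bounded_linear[OF bounded_linear_star])+
  have lip_y: "lip_path y"
    unfolding y_def by (intro lip_path_diff lip_path_scaleR lip_h lip_path_const)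
  obtain C where "C-lipschitz_on {y :: 'a. norm y \<le> r} sqrt_series"
    using sqrt_series_lipschitz[OF r] by blast
  then have "lip_path (\<lambda>t. sqrt_series (y t))"
    using y by (intro lip_path_compose[OF lip_y]) auto
  then have lip_p: "lip_path p" unfolding p_def by (rule lip_path_scaleR)
  then have lip_pinv: "lip_path pinv" unfolding pinv_def by (intro lip_path_mult lip_h)
  then have lip_w: "lip_path w" unfolding w_def by (intro lip_path_mult lip)
  have sp: "star (p t) = p t" if "t \<in> {0..1}" for t
    by (simp add: p_def star_scaleR star_sqrt_series[OF y1[OF that]] sy)
  have pp: "p t * p t = h t" if "t \<in> {0..1}" for t
  proof -
    have "p t * p t = M\<^sup>2 *\<^sub>R (1 - y t)"
      by (simp add: p_def sqrt_series_square[OF y1[OF that]] power2_eq_square)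
    then show ?thesis using M(1) by (simp add: y_def)
  qed
  have gh: "g t * h t = 1" "h t * g t = 1" if "t \<in> {0..1}" for t
  proof -
    have sk: "star (k t) * star (ki t) = 1" "star (ki t) * star (k t) = 1"
      using inv[OF that] by (metis star_mult star_one)+
    have "g t * h t = ki t * (star (ki t) * star (k t)) * k t"
      "h t * g t = star (k t) * (k t * ki t) * star (ki t)"
      by (simp_all only: g_def h_def mult.assoc)
    then show "g t * h t = 1" "h t * g t = 1" using sk inv[OF that] by simp_all
  qed
  have sg: "star (g t) = g t" for t by (simp add: g_def star_mult star_star)
  have pg: "p t * g t = g t * p t" if "t \<in> {0..1}" for t
  proof -
    have "g t * y t = y t * g t" using gh[OF that] by (simp add: y_def algebra_simps)
    from sqrt_series_commute[OF y1[OF that] this] show ?thesis by (simp add: p_def)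
  qed
  have ppi: "p t * pinv t = 1" "pinv t * p t = 1" if "t \<in> {0..1}" for t
  proof -
    show "p t * pinv t = 1"
      using pp[OF that] gh[OF that] by (simp add: pinv_def flip: mult.assoc)
    have "pinv t * p t = g t * (p t * p t)" by (simp add: pinv_def pg[OF that] mult.assoc)
    then show "pinv t * p t = 1" using pp[OF that] gh[OF that] by simp
  qed
  have spi: "star (pinv t) = pinv t" if "t \<in> {0..1}" for t
    by (simp add: pinv_def star_mult sg sp[OF that] pg[OF that])
  have kwp: "k t = w t * p t" if "t \<in> {0..1}" for t
    using ppi[OF that] by (simp add: w_def mult.assoc)
  have w1: "star (w t) * w t = 1" if "t \<in> {0..1}" for t
  proof -
    have "star (w t) * w t = pinv t * h t * pinv t"
      by (simp add: w_def star_mult spi[OF that] h_def mult.assoc)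
    also have "\<dots> = (pinv t * p t) * (p t * pinv t)"
      by (simp only: pp[OF that, symmetric] mult.assoc)
    finally show ?thesis by (simp add: ppi[OF that])
  qed
  \<comment> \<open>So far w is only an isometry. The right inverse p ki must coincide with the left
    inverse \<open>star w\<close>.\<close>
  have w2: "w t * star (w t) = 1" if "t \<in> {0..1}" for t
  proof -
    have "w t * (p t * ki t) = 1"
      using kwp[OF that] inv[OF that] by (simp flip: mult.assoc)
    then have "star (w t) = p t * ki t"
      using w1[OF that] by (metis mult.assoc mult.left_neutral mult.right_neutral)
    then show ?thesis using \<open>w t * (p t * ki t) = 1\<close> by simp
  qed
  have loop: "w 0 = w 1" if "k 0 = k 1"
  proof -
    have "ki 0 = (ki 0 * k 0) * ki 1" using inv(1)[of 1] by (simp add: that mult.assoc)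
    then have "ki 0 = ki 1" using inv(2)[of 0] by simp
    then show ?thesis using that by (simp add: w_def pinv_def p_def y_def h_def g_def)
  qed
  show thesis by (rule that[OF lip_w lip_p lip_pinv kwp w1 w2 ppi sp spi loop])
qed

section \<open>A Banach algebra containing all matrix algebras\<close>

text \<open>Bounded operators on bounded sequences. The \<open>n\<close> by \<open>n\<close> matrices \<open>x\<close> embed as the
  operators \<open>corner n x\<close>, zero outside the first \<open>n\<close> coordinates, and \<open>diag(u, 1)\<close> becomes the
  same operator as \<open>u\<close>, namely \<open>1 + corner n (u - 1)\<close>.\<close>

instantiation nat :: metric_space
begin

text \<open>Any metric inducing the discrete topology would do: every bounded sequence is then a
  bounded continuous function, and these functions form a Banach space.\<close>

definition dist_nat :: "nat \<Rightarrow> nat \<Rightarrow> real" where "dist_nat m n = \<bar>real m - real n\<bar>"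
definition uniformity_nat :: "(nat \<times> nat) filter"
  where "uniformity_nat = (INF e\<in>{0 <..}. principal {(x, y). dist x y < e})"

instance
proof
  fix U :: "nat set"
  have eq: "x = y" if "dist x y < 1" for x y :: nat
    using that unfolding dist_nat_def by linarith
  have "\<forall>\<^sub>F (x', y) in uniformity. x' = x \<longrightarrow> y \<in> U" if "x \<in> U" for x
  proof (rule filter_leD)
    show "uniformity \<le> principal {(x, y). dist x (y :: nat) < 1}"
      unfolding uniformity_nat_def by (rule INF_lower) simp
    show "\<forall>\<^sub>F (x', y) in principal {(x, y). dist x (y :: nat) < 1}. x' = x \<longrightarrow> y \<in> U"
      using that eq by (auto simp: eventually_principal)
  qed
  then show "open U = (\<forall>x\<in>U. \<forall>\<^sub>F (x', y) in uniformity. x' = x \<longrightarrow> y \<in> U)"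
    by (simp add: open_discrete)
qed (auto simp: dist_nat_def uniformity_nat_def)

end

text \<open>A separate copy of the bounded operators, so that composition becomes the multiplication
  of a Banach algebra.\<close>

typedef (overloaded) 'a seq_op =
  "UNIV :: ((nat \<Rightarrow>\<^sub>C 'a :: {real_normed_algebra_1, banach}) \<Rightarrow>\<^sub>L (nat \<Rightarrow>\<^sub>C 'a)) set"
  morphisms blinfun_of Seq_op
  by simp

setup_lifting type_definition_seq_op

instantiation seq_op :: ("{real_normed_algebra_1, banach}") real_normed_algebra_1
begin

lift_definition zero_seq_op :: "'a seq_op" is 0 .
lift_definition one_seq_op :: "'a seq_op" is id_blinfun .
lift_definition plus_seq_op :: "'a seq_op \<Rightarrow> 'a seq_op \<Rightarrow> 'a seq_op" is "(+)" .
lift_definition minus_seq_op :: "'a seq_op \<Rightarrow> 'a seq_op \<Rightarrow> 'a seq_op" is "(-)" .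
lift_definition uminus_seq_op :: "'a seq_op \<Rightarrow> 'a seq_op" is uminus .
lift_definition times_seq_op :: "'a seq_op \<Rightarrow> 'a seq_op \<Rightarrow> 'a seq_op" is "blinfun_compose" .
lift_definition scaleR_seq_op :: "real \<Rightarrow> 'a seq_op \<Rightarrow> 'a seq_op" is scaleR .
lift_definition norm_seq_op :: "'a seq_op \<Rightarrow> real" is norm .
definition sgn_seq_op :: "'a seq_op \<Rightarrow> 'a seq_op" where "sgn_seq_op x = scaleR (inverse (norm x)) x"
definition dist_seq_op :: "'a seq_op \<Rightarrow> 'a seq_op \<Rightarrow> real" where "dist_seq_op x y = norm (x - y)"
definition uniformity_seq_op :: "('a seq_op \<times> 'a seq_op) filter"
  where "uniformity_seq_op = (INF e\<in>{0 <..}. principal {(x, y). dist x y < e})"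
definition open_seq_op :: "'a seq_op set \<Rightarrow> bool"
  where "open_seq_op S = (\<forall>x\<in>S. \<forall>\<^sub>F (x', y) in uniformity. x' = x \<longrightarrow> y \<in> S)"

lemma norm_id_blinfun_bcontfun:
  "norm (id_blinfun :: (nat \<Rightarrow>\<^sub>C 'a :: {real_normed_algebra_1, banach}) \<Rightarrow>\<^sub>L _) = 1"
proof (rule antisym)
  let ?x = "const_bcontfun 1 :: nat \<Rightarrow>\<^sub>C 'a"
  have "norm ?x \<ge> 1" using norm_bounded[of ?x 0] by simp
  moreover have "norm ?x \<le> norm (id_blinfun :: (nat \<Rightarrow>\<^sub>C 'a) \<Rightarrow>\<^sub>L _) * norm ?x"
    using norm_blinfun[of id_blinfun ?x] by simp
  ultimately have "1 * norm ?x \<le> norm (id_blinfun :: (nat \<Rightarrow>\<^sub>C 'a) \<Rightarrow>\<^sub>L _) * norm ?x" "norm ?x > 0"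
    by linarith+
  then show "1 \<le> norm (id_blinfun :: (nat \<Rightarrow>\<^sub>C 'a) \<Rightarrow>\<^sub>L _)"
    using mult_le_cancel_right_pos by blast
qed (rule norm_blinfun_id_le)

instance
proof
  fix x y z :: "'a seq_op" and r s :: real
  show "x * y * z = x * (y * z)" by transfer (auto intro!: blinfun_eqI)
  show "(x + y) * z = x * z + y * z" by transfer (auto intro!: blinfun_eqI simp: blinfun.bilinear_simps)
  show "x * (y + z) = x * y + x * z" by transfer (auto intro!: blinfun_eqI simp: blinfun.bilinear_simps)
  show "r *\<^sub>R x * y = r *\<^sub>R (x * y)" by transfer (auto intro!: blinfun_eqI simp: blinfun.bilinear_simps)
  show "x * r *\<^sub>R y = r *\<^sub>R (x * y)" by transfer (auto intro!: blinfun_eqI simp: blinfun.bilinear_simps)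
  show "1 * x = x" by transfer (auto intro!: blinfun_eqI)
  show "x * 1 = x" by transfer (auto intro!: blinfun_eqI)
  show "(0 :: 'a seq_op) \<noteq> 1"
    by transfer (metis norm_id_blinfun_bcontfun norm_zero zero_neq_one)
  show "norm (x * y) \<le> norm x * norm y" by transfer (rule norm_blinfun_compose)
  show "norm (1 :: 'a seq_op) = 1" by transfer (rule norm_id_blinfun_bcontfun)
  show "x + y + z = x + (y + z)" "x + y = y + x" "0 + x = x" "- x + x = 0" "x - y = x + - y"
    by (transfer, simp add: algebra_simps)+
  show "r *\<^sub>R (x + y) = r *\<^sub>R x + r *\<^sub>R y" "(r + s) *\<^sub>R x = r *\<^sub>R x + s *\<^sub>R x"
    "r *\<^sub>R s *\<^sub>R x = (r * s) *\<^sub>R x" "1 *\<^sub>R x = x"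
    by (transfer, simp add: algebra_simps)+
  show "(norm x = 0) = (x = 0)" "norm (x + y) \<le> norm x + norm y" "norm (r *\<^sub>R x) = \<bar>r\<bar> * norm x"
    by (transfer, simp add: norm_triangle_ineq)+
qed (simp_all add: sgn_seq_op_def dist_seq_op_def uniformity_seq_op_def open_seq_op_def)

end

instance bcontfun :: (metric_space, banach) banach ..

instance seq_op :: ("{real_normed_algebra_1, banach}") banach
proof
  fix X :: "nat \<Rightarrow> 'a seq_op"
  assume "Cauchy X"
  then have "Cauchy (\<lambda>n. blinfun_of (X n))"
    by (simp add: Cauchy_def dist_norm norm_seq_op.rep_eq minus_seq_op.rep_eq)
  then have "convergent (\<lambda>n. blinfun_of (X n))" by (rule Cauchy_convergent)
  then obtain l where "(\<lambda>n. blinfun_of (X n)) \<longlonglongrightarrow> l"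
    unfolding convergent_def by blast
  then have "X \<longlonglongrightarrow> Seq_op l"
    by (simp add: LIMSEQ_iff norm_seq_op.rep_eq minus_seq_op.rep_eq Seq_op_inverse)
  then show "convergent X" by (auto simp: convergent_def)
qed

lemma bcontfun_nat: "(\<And>i. norm (f i) \<le> B) \<Longrightarrow> (f :: nat \<Rightarrow> 'a :: real_normed_vector) \<in> bcontfun"
  by (auto intro!: bcontfun_normI[of f B] simp: continuous_on_def filterlim_def)

section \<open>Matrix entries and finite upper left blocks\<close>

definition unit_seq :: "nat \<Rightarrow> nat \<Rightarrow>\<^sub>C 'a :: {real_normed_algebra_1, banach}" where
  "unit_seq j = Bcontfun (\<lambda>i. if i = j then 1 else 0)"

lemma unit_seq_apply: "apply_bcontfun (unit_seq j) i = (if i = j then 1 else 0)"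
  unfolding unit_seq_def by (subst Bcontfun_inverse) (auto intro: bcontfun_nat[where B = 1])

lemma norm_unit_seq: "norm (unit_seq j) \<le> 1"
  by (rule norm_bound) (simp add: unit_seq_apply)

text \<open>Entries alone do not determine an operator on bounded sequences, since unit sequences do
  not span a dense subspace. Entrywise arguments are therefore confined to
  \<open>corners n\<close>.\<close>

definition entry :: "nat \<Rightarrow> nat \<Rightarrow> 'a :: {real_normed_algebra_1, banach} seq_op \<Rightarrow> 'a" where
  "entry i j T = apply_bcontfun (blinfun_apply (blinfun_of T) (unit_seq j)) i"

lemma norm_entry_le: "norm (entry i j T) \<le> norm T"
proof -
  have "norm (entry i j T) \<le> norm (blinfun_apply (blinfun_of T) (unit_seq j))"
    unfolding entry_def by (rule norm_bounded)
  also have "\<dots> \<le> norm T * norm (unit_seq j :: nat \<Rightarrow>\<^sub>C 'a)"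
    unfolding norm_seq_op.rep_eq by (rule norm_blinfun)
  also have "\<dots> \<le> norm T" by (intro mult_left_le norm_unit_seq norm_ge_zero)
  finally show ?thesis .
qed

lemma bounded_linear_entry: "bounded_linear (entry i j)"
proof (rule bounded_linear_intro[where K = 1])
  show "entry i j (x + y) = entry i j x + entry i j y" for x y :: "'a seq_op"
    by (simp add: entry_def plus_seq_op.rep_eq blinfun.bilinear_simps)
  show "entry i j (r *\<^sub>R x) = r *\<^sub>R entry i j x" for r and x :: "'a seq_op"
    by (simp add: entry_def scaleR_seq_op.rep_eq blinfun.bilinear_simps)
  show "norm (entry i j x) \<le> norm x * 1" for x :: "'a seq_op"
    using norm_entry_le by simp
qed

lemmas entry_add = linear_add[OF bounded_linear.linear[OF bounded_linear_entry]]
lemmas entry_diff = linear_diff[OF bounded_linear.linear[OF bounded_linear_entry]]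
lemmas entry_minus = linear_neg[OF bounded_linear.linear[OF bounded_linear_entry]]
lemmas entry_zero [simp] = linear_0[OF bounded_linear.linear[OF bounded_linear_entry]]
lemmas entry_sum = linear_sum[OF bounded_linear.linear[OF bounded_linear_entry]]

lemma entry_one: "entry i j 1 = (if i = j then 1 else 0)"
  by (simp add: entry_def one_seq_op.rep_eq unit_seq_apply)

definition corner_fun :: "nat \<Rightarrow> (nat \<Rightarrow> nat \<Rightarrow> 'a) \<Rightarrow> (nat \<Rightarrow>\<^sub>C 'a :: {real_normed_algebra_1, banach}) \<Rightarrow> nat \<Rightarrow>\<^sub>C 'a" where
  "corner_fun n f v = Bcontfun (\<lambda>i. if i < n then \<Sum>j<n. f i j * apply_bcontfun v j else 0)"

lemma corner_fun_bound:
  fixes i n :: nat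
  shows "norm (if i < n then \<Sum>j<n. f i j * apply_bcontfun v j else 0)
    \<le> norm v * (\<Sum>i<n. \<Sum>j<n. norm (f i j :: 'a :: {real_normed_algebra_1, banach}))"
proof (cases "i < n")
  case True
  have "norm (\<Sum>j<n. f i j * apply_bcontfun v j) \<le> (\<Sum>j<n. norm (f i j) * norm v)"
  proof (rule sum_norm_le)
    fix j
    show "norm (f i j * apply_bcontfun v j) \<le> norm (f i j) * norm v"
      by (rule order_trans[OF norm_mult_ineq mult_left_mono[OF norm_bounded]]) simp
  qed
  also have "\<dots> = norm v * (\<Sum>j<n. norm (f i j))" by (simp add: sum_distrib_left mult.commute)
  also have "(\<Sum>j<n. norm (f i j)) \<le> (\<Sum>i<n. \<Sum>j<n. norm (f i j))"
    using True by (intro member_le_sum[where f = "\<lambda>i. \<Sum>j<n. norm (f i j)"]) (auto intro: sum_nonneg)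
  finally show ?thesis using True by (simp add: mult_left_mono)
qed (simp add: sum_nonneg)

lemma corner_fun_apply:
  "apply_bcontfun (corner_fun n f v) i = (if i < n then \<Sum>j<n. f i j * apply_bcontfun v j else 0)"
  unfolding corner_fun_def by (subst Bcontfun_inverse) (auto intro!: bcontfun_nat corner_fun_bound)

lemma bounded_linear_corner_fun: "bounded_linear (corner_fun n f)"
proof (rule bounded_linear_intro[where K = "\<Sum>i<n. \<Sum>j<n. norm (f i j)"])
  show "norm (corner_fun n f v) \<le> norm v * (\<Sum>i<n. \<Sum>j<n. norm (f i j))" for v
    by (rule norm_bound) (simp only: corner_fun_apply corner_fun_bound)
qed (auto intro!: bcontfun_eqI simp: corner_fun_apply algebra_simps sum.distrib scaleR_sum_right)

definition corner :: "nat \<Rightarrow> (nat \<Rightarrow> nat \<Rightarrow> 'a) \<Rightarrow> 'a :: {real_normed_algebra_1, banach} seq_op" where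
  "corner n f = Seq_op (Blinfun (corner_fun n f))"

lemma corner_apply: "blinfun_apply (blinfun_of (corner n f)) v = corner_fun n f v"
  by (simp add: corner_def Seq_op_inverse bounded_linear_Blinfun_apply[OF bounded_linear_corner_fun])

lemma norm_corner_le: "norm (corner n f) \<le> (\<Sum>i<n. \<Sum>j<n. norm (f i j))"
  unfolding norm_seq_op.rep_eq
proof (rule norm_blinfun_bound)
  show "norm (blinfun_apply (blinfun_of (corner n f)) v) \<le> (\<Sum>i<n. \<Sum>j<n. norm (f i j)) * norm v" for v
    unfolding corner_apply
    by (rule norm_bound) (use corner_fun_bound[of _ n f v] in \<open>simp only: corner_fun_apply mult.commute\<close>)
qed (simp add: sum_nonneg)

lemma seq_op_eqI: "(\<And>v i. apply_bcontfun (blinfun_apply (blinfun_of S) v) i = apply_bcontfun (blinfun_apply (blinfun_of T) v) i) \<Longrightarrow> S = T"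
  by (simp add: blinfun_of_inject[symmetric] blinfun_eqI bcontfun_eqI)

lemma entry_corner: "entry i j (corner n f) = (if i < n \<and> j < n then f i j else 0)"
  by (simp add: entry_def corner_apply corner_fun_apply unit_seq_apply if_distrib[of "\<lambda>x. _ * x"] cong: if_cong)

lemma corner_cong: "(\<And>i j. i < n \<Longrightarrow> j < n \<Longrightarrow> f i j = g i j) \<Longrightarrow> corner n f = corner n g"
  by (rule seq_op_eqI) (simp add: corner_apply corner_fun_apply)

lemma corner_mult: "corner n f * corner n g = corner n (\<lambda>i k. \<Sum>j<n. f i j * g j k)"
proof (rule seq_op_eqI)
  show "apply_bcontfun (blinfun_apply (blinfun_of (corner n f * corner n g)) v) i
     = apply_bcontfun (blinfun_apply (blinfun_of (corner n (\<lambda>i k. \<Sum>j<n. f i j * g j k))) v) i" for v i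
    by (simp add: times_seq_op.rep_eq corner_apply corner_fun_apply sum_distrib_left sum_distrib_right mult.assoc)
       (rule impI, rule sum.swap)
qed

lemma corner_add: "corner n f + corner n g = corner n (\<lambda>i j. f i j + g i j)"
  by (rule seq_op_eqI) (simp add: corner_apply corner_fun_apply plus_seq_op.rep_eq blinfun.bilinear_simps
      algebra_simps sum.distrib)

lemma corner_scaleR: "r *\<^sub>R corner n f = corner n (\<lambda>i j. r *\<^sub>R f i j)"
  by (rule seq_op_eqI) (simp add: corner_apply corner_fun_apply scaleR_seq_op.rep_eq blinfun.bilinear_simps
      scaleR_sum_right)

lemma corner_zero: "corner n (\<lambda>i j. 0) = 0"
  by (rule seq_op_eqI) (simp add: corner_apply corner_fun_apply zero_seq_op.rep_eq)

lemma corner_diff: "corner n f - corner n g = corner n (\<lambda>i j. f i j - g i j)"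
  using corner_add[of n f "\<lambda>i j. - g i j"] corner_scaleR[of "-1" n g] by (metis (no_types, lifting) corner_cong
      diff_conv_add_uminus scaleR_minus1_left)

lemma corner_mono: "m \<le> n \<Longrightarrow> corner m f = corner n (\<lambda>i j. if i < m \<and> j < m then f i j else 0)"
proof (rule seq_op_eqI)
  fix v i assume "m \<le> n"
  then have "{..<n} \<inter> {j. j < m} = {..<m}" by auto
  then show "apply_bcontfun (blinfun_apply (blinfun_of (corner m f)) v) i
    = apply_bcontfun (blinfun_apply (blinfun_of (corner n (\<lambda>i j. if i < m \<and> j < m then f i j else 0))) v) i"
    using \<open>m \<le> n\<close> by (auto simp: corner_apply corner_fun_apply if_distrib[of "\<lambda>x. x * _"] sum.If_cases cong: if_cong)
qed

definition corners :: "nat \<Rightarrow> 'a :: {real_normed_algebra_1, banach} seq_op set" where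
  "corners n = range (corner n)"

text \<open>Membership becomes the fixed-point equation of a bounded linear map; closedness and
  entrywise equality both come from it.\<close>

lemma corners_iff: "x \<in> corners n \<longleftrightarrow> corner n (\<lambda>i j. entry i j x) = x"
proof
  show "x \<in> corners n \<Longrightarrow> corner n (\<lambda>i j. entry i j x) = x"
    by (auto simp: corners_def entry_corner intro: corner_cong)
  show "corner n (\<lambda>i j. entry i j x) = x \<Longrightarrow> x \<in> corners n"
    unfolding corners_def by (metis rangeI)
qed

lemma corner_in_corners [simp]: "corner n f \<in> corners n"
  by (simp add: corners_def)

lemma corners_eqI:
  assumes "x \<in> corners n" "y \<in> corners n" "\<And>i j. i < n \<Longrightarrow> j < n \<Longrightarrow> entry i j x = entry i j y"
  shows "x = y"
  by (metis (no_types, lifting) assms corner_cong corners_iff)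

lemma corners_mono: "m \<le> n \<Longrightarrow> corners m \<subseteq> corners n"
  unfolding corners_def by (auto simp: corner_mono)

lemma entry_mult_corners:
  assumes "x \<in> corners n" "y \<in> corners n" "i < n" "j < n"
  shows "entry i j (x * y) = (\<Sum>k<n. entry i k x * entry k j y)"
  using corner_mult[of n "\<lambda>i j. entry i j x" "\<lambda>i j. entry i j y"] assms
  by (simp add: corners_iff entry_corner)

lemma entry_corners_zero: "x \<in> corners n \<Longrightarrow> \<not> (i < n \<and> j < n) \<Longrightarrow> entry i j x = 0"
  by (auto simp: corners_def entry_corner)

lemma subspace_corners: "subspace (corners n)"
  unfolding subspace_def corners_def
proof (intro conjI ballI allI)
  show "0 \<in> range (corner n)" by (metis corner_zero rangeI)
qed (auto simp: corner_add corner_scaleR)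

lemma corners_mult: "x \<in> corners n \<Longrightarrow> y \<in> corners n \<Longrightarrow> x * y \<in> corners n"
  by (auto simp: corners_def corner_mult)

lemma bounded_linear_corner_of:
  fixes F :: "'b :: real_normed_vector \<Rightarrow> nat \<Rightarrow> nat \<Rightarrow> 'a :: {real_normed_algebra_1, banach}"
  assumes "\<And>i j. bounded_linear (\<lambda>x. F x i j)"
  shows "bounded_linear (\<lambda>x. corner n (F x))"
proof -
  have "\<exists>K. \<forall>x. norm (F x i j) \<le> norm x * K" for i j
    using bounded_linear.bounded[OF assms] by blast
  then obtain K where K: "\<And>i j x. norm (F x i j) \<le> norm x * K i j" by metis
  show ?thesis
  proof (rule bounded_linear_intro[where K = "\<Sum>i<n. \<Sum>j<n. K i j"])
    show "corner n (F (x + y)) = corner n (F x) + corner n (F y)" for x y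
      unfolding corner_add by (rule corner_cong) (simp add: linear_add[OF bounded_linear.linear[OF assms]])
    show "corner n (F (r *\<^sub>R x)) = r *\<^sub>R corner n (F x)" for r x
      unfolding corner_scaleR by (rule corner_cong) (simp add: linear_cmul[OF bounded_linear.linear[OF assms]])
    show "norm (corner n (F x)) \<le> norm x * (\<Sum>i<n. \<Sum>j<n. K i j)" for x
      unfolding sum_distrib_left by (rule order_trans[OF norm_corner_le]) (intro sum_mono K)
  qed
qed

lemma closed_corners: "closed (corners n :: 'a :: {real_normed_algebra_1, banach} seq_op set)"
proof -
  have "bounded_linear (\<lambda>x :: 'a seq_op. corner n (\<lambda>i j. entry i j x))"
    by (rule bounded_linear_corner_of) (rule bounded_linear_entry)
  then have "continuous_on UNIV (\<lambda>x :: 'a seq_op. corner n (\<lambda>i j. entry i j x))"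
    by (rule linear_continuous_on)
  then have "closed {x :: 'a seq_op. corner n (\<lambda>i j. entry i j x) = x}"
    by (intro closed_Collect_eq continuous_on_id)
  then show ?thesis by (simp flip: corners_iff add: Collect_mem_eq)
qed

text \<open>The conjugate transpose of the upper left block, extended by zero. The involution exists
  on the blocks and not on the ambient operators, which explains the index n.\<close>

definition corner_star :: "nat \<Rightarrow> 'a seq_op \<Rightarrow> 'a :: unital_cstar_algebra seq_op" where
  "corner_star n x = corner n (\<lambda>i j. star (entry j i x))"

lemma bounded_linear_corner_star: "bounded_linear (corner_star n)"
  unfolding corner_star_def
  by (rule bounded_linear_corner_of)
     (intro bounded_linear_compose[OF bounded_linear_star] bounded_linear_entry)

lemma corner_star_corner: "corner_star n (corner n f) = corner n (\<lambda>i j. star (f j i))"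
  unfolding corner_star_def by (rule corner_cong) (simp add: entry_corner)

lemma corner_star_in_corners: "corner_star n x \<in> corners n"
  by (simp add: corner_star_def)

lemma corner_star_star: "x \<in> corners n \<Longrightarrow> corner_star n (corner_star n x) = x"
  by (auto simp: corners_def corner_star_corner star_star)

lemma corner_star_mult:
  "x \<in> corners n \<Longrightarrow> y \<in> corners n \<Longrightarrow> corner_star n (x * y) = corner_star n y * corner_star n x"
  by (auto simp: corners_def corner_star_corner corner_mult star_sum star_mult)

lemma corner_star_mono: "m \<le> n \<Longrightarrow> x \<in> corners m \<Longrightarrow> corner_star n x = corner_star m x"
proof -
  assume mn: "m \<le> n" and "x \<in> corners m"
  then obtain f where x: "x = corner m f" by (auto simp: corners_def)
  show "corner_star n x = corner_star m x"
    unfolding x corner_star_corner unfolding corner_mono[OF mn] corner_star_corner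
    by (auto intro!: corner_cong)
qed

section \<open>Exponentials in Banach algebras\<close>

text \<open>Comparing the series term by term after removing the linear terms leaves the series of
  exp r - 1. Near 0 the exponential is thus a small Lipschitz perturbation of the identity.\<close>

lemma exp_minus_id_lipschitz:
  fixes y z :: "'a :: {real_normed_algebra_1, banach}"
  assumes "norm y \<le> r" "norm z \<le> r"
  shows "norm ((exp y - exp z) - (y - z)) \<le> (exp r - 1) * norm (y - z)"
proof -
  let ?f = "\<lambda>n. (y ^ n - z ^ n) /\<^sub>R fact n"
  have "(\<lambda>n. y ^ n /\<^sub>R fact n - z ^ n /\<^sub>R fact n) sums (exp y - exp z)"
    by (intro sums_diff exp_converges)
  then have f: "?f sums (exp y - exp z)" by (simp add: scaleR_diff_right)
  have "(\<lambda>n. ?f (n + 2)) sums ((exp y - exp z) - (\<Sum>n<2. ?f n))"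
    by (rule sums_split_initial_segment[OF f])
  moreover have "(\<Sum>n<2. ?f n) = y - z" by (simp add: numeral_2_eq_2)
  ultimately have f2: "(\<lambda>n. ?f (n + 2)) sums ((exp y - exp z) - (y - z))" by simp
  have r: "r \<ge> 0" using assms(1) norm_ge_zero[of y] by linarith
  have "(\<lambda>n. r ^ n /\<^sub>R fact n) sums exp r" by (rule exp_converges)
  from sums_split_initial_segment[OF this, of 1]
  have g: "(\<lambda>n. r ^ (n + 1) / fact (n + 1)) sums (exp r - 1)" by (simp add: divide_inverse mult.commute)
  from sums_mult2[OF g]
  have g: "(\<lambda>n. r ^ (n + 1) / fact (n + 1) * norm (y - z)) sums ((exp r - 1) * norm (y - z))" .
  have "norm (\<Sum>n. ?f (n + 2)) \<le> (\<Sum>n. r ^ (n + 1) / fact (n + 1) * norm (y - z))"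
  proof (rule norm_suminf_le[OF _ sums_summable[OF g]])
    fix n
    have "norm (?f (n + 2)) \<le> (real (n + 2) * r ^ (n + 1) * norm (y - z)) / fact (n + 2)"
    proof -
      have "norm (?f (n + 2)) = norm (y ^ (n + 2) - z ^ (n + 2)) / fact (n + 2)"
        by (simp only: norm_scaleR) (simp add: divide_inverse)
      then show ?thesis
        using divide_right_mono[OF norm_power_diff_le[OF assms, of "n + 2"], of "fact (n + 2)"] by simp
    qed
    also have "\<dots> = r ^ (n + 1) / fact (n + 1) * norm (y - z)"
      by (simp add: divide_simps)
    finally show "norm (?f (n + 2)) \<le> r ^ (n + 1) / fact (n + 1) * norm (y - z)" .
  qed
  then show ?thesis using f2 g by (simp add: sums_iff)
qed

lemma exp_minus_one_le: "0 \<le> r \<Longrightarrow> r \<le> 1 \<Longrightarrow> exp r - 1 \<le> 2 * (r :: real)"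
  using exp_bound[of r] mult_left_le[of r r] by (simp add: power2_eq_square)

lemma norm_exp_minus_one_minus_id:
  fixes x :: "'a :: {real_normed_algebra_1, banach}"
  assumes "norm x \<le> 1"
  shows "norm (exp x - 1 - x) \<le> 2 * (norm x)\<^sup>2"
proof -
  have "norm ((exp x - exp 0) - (x - 0)) \<le> (exp (norm x) - 1) * norm (x - 0)"
    by (rule exp_minus_id_lipschitz) auto
  also have "\<dots> \<le> (2 * norm x) * norm x"
    using assms exp_minus_one_le[of "norm x"] by (simp add: mult_right_mono)
  finally show ?thesis by (simp add: power2_eq_square)
qed

lemma norm_exp_diff_le:
  fixes y z :: "'a :: {real_normed_algebra_1, banach}"
  assumes "norm y \<le> r" "norm z \<le> r"
  shows "norm (exp y - exp z) \<le> exp r * norm (y - z)"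
  using exp_minus_id_lipschitz[OF assms] norm_triangle_ineq[of "(exp y - exp z) - (y - z)" "y - z"]
  by (simp add: algebra_simps)

lemma tendsto_exp_banach:
  fixes f :: "'b \<Rightarrow> 'a :: {real_normed_algebra_1, banach}"
  assumes "(f \<longlongrightarrow> l) F"
  shows "((\<lambda>x. exp (f x)) \<longlongrightarrow> exp l) F"
proof (rule LIM_zero_cancel, rule Lim_null_comparison)
  show "((\<lambda>x. exp (norm l + 1) * norm (f x - l)) \<longlongrightarrow> 0) F"
    using tendsto_mult_right_zero[OF tendsto_norm_zero[OF LIM_zero[OF assms]]] .
  have "\<forall>\<^sub>F x in F. dist (f x) l < 1" using assms by (rule tendstoD) simp
  then show "\<forall>\<^sub>F x in F. norm (exp (f x) - exp l) \<le> exp (norm l + 1) * norm (f x - l)"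
  proof eventually_elim
    case (elim x)
    have "norm (f x) \<le> norm l + 1"
      using elim norm_triangle_ineq2[of "f x" l] by (simp add: dist_norm)
    then show ?case by (intro norm_exp_diff_le) auto
  qed
qed

lemma continuous_on_exp_banach:
  fixes f :: "'b :: topological_space \<Rightarrow> 'a :: {real_normed_algebra_1, banach}"
  shows "continuous_on S f \<Longrightarrow> continuous_on S (\<lambda>x. exp (f x))"
  unfolding continuous_on_def by (auto intro: tendsto_exp_banach)

text \<open>At radius 1/4 the Lipschitz constant of exp - id is at most 1/2. This provides
  uniqueness of small logarithms, and Lipschitz bounds for them along a path.\<close>

lemma exp_expanding:
  fixes y z :: "'a :: {real_normed_algebra_1, banach}"
  assumes "norm y \<le> 1/4" "norm z \<le> 1/4"
  shows "norm (y - z) \<le> 2 * norm (exp y - exp z)"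
proof -
  have "exp (1/4) - 1 \<le> 2 * (1/4 :: real)" by (rule exp_minus_one_le) auto
  then have "(exp (1/4) - 1) * norm (y - z) \<le> (1/2) * norm (y - z)"
    by (intro mult_right_mono) auto
  then have "norm ((exp y - exp z) - (y - z)) \<le> (1/2) * norm (y - z)"
    using exp_minus_id_lipschitz[OF assms] by linarith
  then show ?thesis
    using norm_triangle_ineq2[of "y - z" "exp y - exp z"] by (simp add: norm_minus_commute)
qed

lemma exp_scaleR_nat:
  fixes x :: "'a :: {real_normed_algebra_1, banach}"
  shows "exp (real n *\<^sub>R x) = exp x ^ n"
proof (induction n)
  case (Suc n)
  have "exp (x + real n *\<^sub>R x) = exp x * exp (real n *\<^sub>R x)"
    by (rule exp_add_commuting) simp
  then show ?case using Suc by (simp add: algebra_simps)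
qed simp

lemma exp_conjugate:
  fixes x :: "'a :: {real_normed_algebra_1, banach}"
  assumes "w * w' = 1" "w' * w = 1"
  shows "exp (w * x * w') = w * exp x * w'"
proof -
  have p: "(w * x * w') ^ n = w * x ^ n * w'" for n
  proof (induction n)
    case (Suc n)
    have "(w * x * w') * (w * x ^ n * w') = w * x * (w' * w) * x ^ n * w'"
      by (simp only: mult.assoc)
    then show ?case using Suc assms by (simp add: mult.assoc)
  qed (simp add: assms)
  have "(\<lambda>n. w * (x ^ n /\<^sub>R fact n) * w') sums (w * exp x * w')"
    by (intro sums_mult sums_mult2 exp_converges)
  then have "(\<lambda>n. (w * x * w') ^ n /\<^sub>R fact n) sums (w * exp x * w')" by (simp add: p)
  then show ?thesis using exp_converges sums_unique2 by blast
qed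

lemma tendsto_scaleR_exp:
  fixes a :: "'a :: {real_normed_algebra_1, banach}"
  shows "(\<lambda>n. real (Suc n) *\<^sub>R (exp (a /\<^sub>R real (Suc n)) - 1)) \<longlonglongrightarrow> a"
proof (rule LIM_zero_cancel, rule Lim_null_comparison)
  have "(\<lambda>n. 2 * (norm a)\<^sup>2 / real (Suc n)) \<longlonglongrightarrow> 0"
    by (intro LIMSEQ_Suc) (rule lim_const_over_n)
  then show "(\<lambda>n. 2 * (norm a)\<^sup>2 / real (Suc n)) \<longlonglongrightarrow> 0" .
  obtain N where N: "norm a \<le> real N" using real_arch_simple by blast
  show "\<forall>\<^sub>F n in sequentially. norm (real (Suc n) *\<^sub>R (exp (a /\<^sub>R real (Suc n)) - 1) - a)
      \<le> 2 * (norm a)\<^sup>2 / real (Suc n)"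
    using eventually_ge_at_top[of N]
  proof eventually_elim
    case (elim n)
    define b where "b = a /\<^sub>R real (Suc n)"
    have a: "a = real (Suc n) *\<^sub>R b" by (simp add: b_def)
    have nb: "norm b = norm a / real (Suc n)" by (simp add: b_def divide_inverse)
    have "norm b \<le> 1" using N elim by (simp add: nb)
    from norm_exp_minus_one_minus_id[OF this]
    have "real (Suc n) * norm (exp b - 1 - b) \<le> real (Suc n) * (2 * (norm b)\<^sup>2)"
      by (intro mult_left_mono) auto
    also have "\<dots> = 2 * (norm a)\<^sup>2 / real (Suc n)"
      unfolding nb by (simp add: power2_eq_square)
    finally show ?case
      unfolding b_def[symmetric] by (subst a) (simp flip: scaleR_diff_right)
  qed
qed

text \<open>One factor and its target \<open>exp (a' + b')\<close> differ by order 1/n^2 and both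
  are bounded by exp (s/n), so their n-th powers differ by order 1/n.\<close>

lemma Trotter:
  fixes a b :: "'a :: {real_normed_algebra_1, banach}"
  shows "(\<lambda>n. (exp (a /\<^sub>R real (Suc n)) * exp (b /\<^sub>R real (Suc n))) ^ Suc n) \<longlonglongrightarrow> exp (a + b)"
proof (rule LIM_zero_cancel, rule Lim_null_comparison)
  define s where "s = norm a + norm b"
  have s: "s \<ge> 0" by (simp add: s_def)
  have "(\<lambda>n. 13 * s\<^sup>2 * exp s / real (Suc n)) \<longlonglongrightarrow> 0"
    by (intro LIMSEQ_Suc) (rule lim_const_over_n)
  then show "(\<lambda>n. 13 * s\<^sup>2 * exp s / real (Suc n)) \<longlonglongrightarrow> 0" .
  obtain N where N: "s \<le> real N" using real_arch_simple by blast
  show "\<forall>\<^sub>F n in sequentially. norm ((exp (a /\<^sub>R real (Suc n)) * exp (b /\<^sub>R real (Suc n))) ^ Suc n - exp (a + b))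
      \<le> 13 * s\<^sup>2 * exp s / real (Suc n)"
    using eventually_ge_at_top[of N]
  proof eventually_elim
    case (elim n)
    define e where "e = s / real (Suc n)"
    define a' where "a' = a /\<^sub>R real (Suc n)"
    define b' where "b' = b /\<^sub>R real (Suc n)"
    have e: "0 \<le> e" "e \<le> 1" using s N elim by (simp_all add: e_def)
    have ne: "norm a' + norm b' = e" by (simp add: a'_def b'_def e_def s_def divide_inverse algebra_simps)
    have na: "norm a' \<le> e" "norm b' \<le> e" using ne norm_ge_zero[of a'] norm_ge_zero[of b'] by linarith+
    have nab: "norm (a' + b') \<le> e" using ne norm_triangle_ineq[of a' b'] by simp
    have second: "norm (exp x - 1 - x) \<le> 2 * e\<^sup>2" if "norm x \<le> e" for x :: 'a
    proof -
      have "norm (exp x - 1 - x) \<le> 2 * (norm x)\<^sup>2"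
        using that e by (intro norm_exp_minus_one_minus_id) simp
      also have "\<dots> \<le> 2 * e\<^sup>2" using that by (simp add: power_mono)
      finally show ?thesis .
    qed
    have eb: "norm (exp b') \<le> 3"
    proof -
      have "norm (exp b') \<le> exp (norm b')" by (rule norm_exp)
      also have "\<dots> \<le> exp 1" using na e by simp
      also have "\<dots> \<le> 3" by (rule exp_le)
      finally show ?thesis .
    qed
    have "norm (1 + a') \<le> 2" using norm_triangle_ineq[of 1 a'] na e by simp
    \<comment> \<open>The four terms contribute 6, 4, 1 and 2 times e^2, using the bounds 3 for
      \<open>exp b'\<close> and 2 for \<open>1 + a'\<close>.\<close>
    have "exp a' * exp b' - exp (a' + b')
      = (exp a' - 1 - a') * exp b' + (1 + a') * (exp b' - 1 - b') + a' * b'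
        - (exp (a' + b') - 1 - (a' + b'))"
      by (simp add: algebra_simps)
    also have "norm \<dots> \<le> 2 * e\<^sup>2 * 3 + 2 * (2 * e\<^sup>2) + e * e + 2 * e\<^sup>2"
      by (intro order_trans[OF norm_triangle_ineq4] order_trans[OF norm_triangle_ineq] add_mono
          order_trans[OF norm_mult_ineq] mult_mono second na nab eb \<open>norm (1 + a') \<le> 2\<close>) (use e in auto)
    also have "\<dots> = 13 * e\<^sup>2" by (simp add: power2_eq_square)
    finally have d: "norm (exp a' * exp b' - exp (a' + b')) \<le> 13 * e\<^sup>2" .
    have X: "norm (exp a' * exp b') \<le> exp e"
    proof -
      have "norm (exp a' * exp b') \<le> exp (norm a') * exp (norm b')"
        by (intro order_trans[OF norm_mult_ineq] mult_mono norm_exp) auto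
      then show ?thesis by (simp add: ne flip: exp_add)
    qed
    have Y: "norm (exp (a' + b')) \<le> exp e"
      by (rule order_trans[OF norm_exp]) (use nab in simp)
    have "exp (a + b) = exp (a' + b') ^ Suc n"
      by (simp only: exp_scaleR_nat[symmetric]) (simp add: a'_def b'_def scaleR_add_right)
    then have "norm ((exp a' * exp b') ^ Suc n - exp (a + b))
        \<le> real (Suc n) * exp e ^ (Suc n - 1) * norm (exp a' * exp b' - exp (a' + b'))"
      using norm_power_diff_le[OF X Y, of "Suc n"] by simp
    also have "\<dots> \<le> real (Suc n) * exp s * (13 * e\<^sup>2)"
    proof (intro mult_mono d order_refl)
      have "exp e ^ (Suc n - 1) \<le> exp e ^ Suc n" using e by (intro power_increasing) auto
      also have "\<dots> = exp s" by (simp only: exp_of_nat_mult[symmetric]) (simp add: e_def)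
      finally show "exp e ^ (Suc n - 1) \<le> exp s" .
    qed auto
    also have "\<dots> = 13 * s\<^sup>2 * exp s / real (Suc n)"
      by (simp add: e_def power2_eq_square)
    finally show ?case by (simp add: a'_def b'_def)
  qed
qed

text \<open>The instances are the n by n blocks, which do not contain the ambient unit when
  embedded, and the C*-algebra itself. Group elements belong to the coset 1 + K, expressed as
  \<open>u - 1 \<in> K\<close>.\<close>

locale closed_subalgebra =
  fixes K :: "'a :: {real_normed_algebra_1, banach} set"
  assumes subspace_K: "subspace K" and closed_K: "closed K"
    and mult_K: "x \<in> K \<Longrightarrow> y \<in> K \<Longrightarrow> x * y \<in> K"
begin

lemmas K_add = subspace_add[OF subspace_K] and K_scale = subspace_scale[OF subspace_K]
  and K_diff = subspace_diff[OF subspace_K] and K_neg = subspace_neg[OF subspace_K]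
  and K_zero = subspace_0[OF subspace_K] and K_sum = subspace_sum[OF subspace_K]

lemma power_Suc_K: "x \<in> K \<Longrightarrow> x ^ Suc n \<in> K"
  by (induction n) (auto intro: mult_K)

lemma exp_minus_one_sums: "(\<lambda>n. x ^ Suc n /\<^sub>R fact (Suc n)) sums (exp x - (1 :: 'a))"
  using sums_split_initial_segment[OF exp_converges, of 1 x] by simp

lemma exp_minus_one_K:
  assumes "x \<in> K"
  shows "exp x - 1 \<in> K"
  using exp_minus_one_sums[of x] unfolding sums_def
  by (rule closed_sequentially[OF closed_K, rotated])
     (intro allI K_sum K_scale power_Suc_K assms)

lemma mult_aff: "u - 1 \<in> K \<Longrightarrow> v - 1 \<in> K \<Longrightarrow> u * v - 1 \<in> K"
proof -
  assume "u - 1 \<in> K" "v - 1 \<in> K"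
  then have "(u - 1) * (v - 1) + (u - 1) + (v - 1) \<in> K" by (intro K_add mult_K)
  then show ?thesis by (simp add: algebra_simps)
qed

lemma mult_aff_K: "u - 1 \<in> K \<Longrightarrow> x \<in> K \<Longrightarrow> u * x \<in> K"
  using K_add[OF mult_K[of "u - 1" x], of x] by (simp add: algebra_simps)

lemma mult_K_aff: "u - 1 \<in> K \<Longrightarrow> x \<in> K \<Longrightarrow> x * u \<in> K"
  using K_add[OF mult_K[of x "u - 1"], of x] by (simp add: algebra_simps)

text \<open>A logarithm is a fixed point of y \<mapsto> u - exp y + y, a contraction with constant
  1/2 on the ball of radius 1/4. Running the iteration inside the closed set K keeps the logarithm
  in K.\<close>

lemma log_exists:
  assumes "u - 1 \<in> K" "norm (u - 1) \<le> 1/8"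
  obtains y where "y \<in> K" "norm y \<le> 2 * norm (u - 1)" "exp y = u"
proof -
  define S where "S = K \<inter> cball 0 (1/4)"
  define \<phi> where "\<phi> y = u - exp y + y" for y
  have k: "exp (1/4) - 1 \<le> 2 * (1/4 :: real)" by (rule exp_minus_one_le) auto
  have lip: "norm (\<phi> y - \<phi> z) \<le> (1/2) * norm (y - z)" if "norm y \<le> 1/4" "norm z \<le> 1/4" for y z
  proof -
    have "norm (\<phi> y - \<phi> z) = norm ((exp y - exp z) - (y - z))"
      unfolding \<phi>_def by (subst norm_minus_commute) (simp add: algebra_simps)
    also have "\<dots> \<le> (exp (1/4) - 1) * norm (y - z)" by (rule exp_minus_id_lipschitz[OF that])
    also have "\<dots> \<le> (1/2) * norm (y - z)" using k by (intro mult_right_mono) auto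
    finally show ?thesis .
  qed
  have "\<exists>!y\<in>S. \<phi> y = y"
  proof (rule Banach_fix[where c = "1/2"])
    show "complete S" unfolding S_def
      by (intro closed_Int closed_K closed_cball complete_eq_closed[THEN iffD2])
    show "S \<noteq> {}" unfolding S_def using K_zero by auto
    show "\<phi> ` S \<subseteq> S"
    proof
      fix x assume "x \<in> \<phi> ` S"
      then obtain y where y: "y \<in> K" "norm y \<le> 1/4" "x = \<phi> y" by (auto simp: S_def)
      have "x = (u - 1) - (exp y - 1) + y" by (simp add: y \<phi>_def)
      also have "\<dots> \<in> K" by (intro K_add K_diff exp_minus_one_K y assms(1))
      finally have "x \<in> K" .
      \<comment> \<open>The first summand is at most half of 1/4, the second is the norm of u - 1,
        at most 1/8; this is the origin of the bound 1/8.\<close>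
      moreover have "norm (\<phi> y) \<le> norm (\<phi> y - \<phi> 0) + norm (\<phi> 0)"
        by (metis diff_add_cancel norm_triangle_ineq)
      then have "norm x \<le> 1/4"
        using lip[of y 0] y assms(2) by (simp add: \<phi>_def)
      ultimately show "x \<in> S" by (simp add: S_def)
    qed
    show "dist (\<phi> y) (\<phi> z) \<le> 1/2 * dist y z" if "y \<in> S" "z \<in> S" for y z
      using lip[of y z] that by (simp add: S_def dist_norm)
  qed auto
  then obtain y where y: "y \<in> K" "norm y \<le> 1/4" "\<phi> y = y" by (auto simp: S_def)
  have "exp y = u" using y(3) by (simp add: \<phi>_def)
  moreover have "norm y \<le> 2 * norm (u - 1)"
    using exp_expanding[of y 0] y(2) \<open>exp y = u\<close> by simp
  ultimately show thesis using that y(1) by blast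
qed

end

section \<open>Unitary groups of subalgebras\<close>

text \<open>\<open>K\<close> need not contain the unit; its unitaries live in \<open>1 + K\<close>.\<close>

locale star_subalgebra = closed_subalgebra K for K :: "'a :: {real_normed_algebra_1, banach} set" +
  fixes \<sigma> :: "'a \<Rightarrow> 'a"
  assumes bl_\<sigma>: "bounded_linear \<sigma>"
    and \<sigma>_K: "x \<in> K \<Longrightarrow> \<sigma> x \<in> K"
    and \<sigma>_\<sigma>: "x \<in> K \<Longrightarrow> \<sigma> (\<sigma> x) = x"
    and \<sigma>_mult: "x \<in> K \<Longrightarrow> y \<in> K \<Longrightarrow> \<sigma> (x * y) = \<sigma> y * \<sigma> x"
begin

lemmas \<sigma>_add = linear_add[OF bounded_linear.linear[OF bl_\<sigma>]]
  and \<sigma>_diff = linear_diff[OF bounded_linear.linear[OF bl_\<sigma>]]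
  and \<sigma>_scaleR = linear_cmul[OF bounded_linear.linear[OF bl_\<sigma>]]
  and \<sigma>_minus = linear_neg[OF bounded_linear.linear[OF bl_\<sigma>]]
  and \<sigma>_zero = linear_0[OF bounded_linear.linear[OF bl_\<sigma>]]

definition adj :: "'a \<Rightarrow> 'a" where "adj u = 1 + \<sigma> (u - 1)"

definition unitary_group :: "'a set" where
  "unitary_group = {u. u - 1 \<in> K \<and> u * adj u = 1 \<and> adj u * u = 1}"

definition skew :: "'a set" where "skew = {h \<in> K. \<sigma> h = - h}"

lemma adj_aff: "u - 1 \<in> K \<Longrightarrow> adj u - 1 \<in> K"
  by (simp add: adj_def \<sigma>_K)

lemma adj_adj: "u - 1 \<in> K \<Longrightarrow> adj (adj u) = u"
  by (simp add: adj_def \<sigma>_\<sigma>)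

lemma adj_one [simp]: "adj 1 = 1"
  by (simp add: adj_def \<sigma>_zero)

lemma adj_mult:
  assumes "u - 1 \<in> K" "v - 1 \<in> K"
  shows "adj (u * v) = adj v * adj u"
proof -
  have "u * v - 1 = (u - 1) * (v - 1) + (u - 1) + (v - 1)" by (simp add: algebra_simps)
  then have "\<sigma> (u * v - 1) = \<sigma> (v - 1) * \<sigma> (u - 1) + \<sigma> (u - 1) + \<sigma> (v - 1)"
    using assms by (simp only: \<sigma>_add \<sigma>_mult)
  then show ?thesis unfolding adj_def by (simp add: algebra_simps)
qed

lemma continuous_adj: "continuous_on S adj"
  unfolding adj_def by (intro continuous_intros bounded_linear.continuous_on[OF bl_\<sigma>])

lemma tendsto_adj: "(f \<longlongrightarrow> l) F \<Longrightarrow> ((\<lambda>x. adj (f x)) \<longlongrightarrow> adj l) F"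
  unfolding adj_def by (intro tendsto_intros bounded_linear.tendsto[OF bl_\<sigma>])

lemma skew_K: "h \<in> skew \<Longrightarrow> h \<in> K" by (simp add: skew_def)

lemma subspace_skew: "subspace skew"
  unfolding subspace_def skew_def
  by (auto simp: K_zero K_add K_scale \<sigma>_zero \<sigma>_add \<sigma>_scaleR)

lemmas skew_add = subspace_add[OF subspace_skew] and skew_scale = subspace_scale[OF subspace_skew]
  and skew_diff = subspace_diff[OF subspace_skew] and skew_neg = subspace_neg[OF subspace_skew]
  and skew_zero = subspace_0[OF subspace_skew]

lemma closed_skew: "closed skew"
proof -
  have "closed (K \<inter> {h. \<sigma> h = - h})"
    by (intro closed_Int closed_K closed_Collect_eq continuous_intros
        bounded_linear.continuous_on[OF bl_\<sigma>])
  then show ?thesis by (simp add: skew_def Collect_conj_eq Collect_mem_eq)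
qed

lemma \<sigma>_power_Suc: "x \<in> K \<Longrightarrow> \<sigma> (x ^ Suc n) = \<sigma> x ^ Suc n"
proof (induction n)
  case (Suc n)
  have "\<sigma> (x ^ Suc (Suc n)) = \<sigma> (x ^ Suc n) * \<sigma> x"
    using \<sigma>_mult[OF Suc.prems power_Suc_K[OF Suc.prems, of n]] by simp
  then show ?case by (simp only: Suc.IH[OF Suc.prems] power_Suc2[of _ "Suc n"])
qed simp

lemma adj_exp: "x \<in> K \<Longrightarrow> adj (exp x) = exp (\<sigma> x)"
proof -
  assume x: "x \<in> K"
  have "(\<lambda>n. \<sigma> (x ^ Suc n /\<^sub>R fact (Suc n))) sums \<sigma> (exp x - 1)"
    by (rule bounded_linear.sums[OF bl_\<sigma> exp_minus_one_sums])
  then have "(\<lambda>n. \<sigma> x ^ Suc n /\<^sub>R fact (Suc n)) sums \<sigma> (exp x - 1)"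
    by (simp only: \<sigma>_scaleR \<sigma>_power_Suc[OF x])
  then have "\<sigma> (exp x - 1) = exp (\<sigma> x) - 1"
    using exp_minus_one_sums sums_unique2 by blast
  then show ?thesis by (simp add: adj_def)
qed

lemma unitaryD:
  assumes "u \<in> unitary_group"
  shows "u - 1 \<in> K" "u * adj u = 1" "adj u * u = 1"
  using assms by (auto simp: unitary_group_def)

lemma unitary_one: "1 \<in> unitary_group"
  by (simp add: unitary_group_def K_zero)

lemma unitary_mult:
  assumes "u \<in> unitary_group" "v \<in> unitary_group"
  shows "u * v \<in> unitary_group"
proof -
  note u = unitaryD[OF assms(1)] and v = unitaryD[OF assms(2)]
  have "u * v * (adj v * adj u) = u * (v * adj v) * adj u"
    "adj v * adj u * (u * v) = adj v * (adj u * u) * v"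
    by (simp_all only: mult.assoc)
  then show ?thesis using u v by (simp add: unitary_group_def adj_mult mult_aff)
qed

lemma unitary_adj: "u \<in> unitary_group \<Longrightarrow> adj u \<in> unitary_group"
  by (simp add: unitary_group_def adj_adj adj_aff)

lemma unitary_exp: "h \<in> skew \<Longrightarrow> exp h \<in> unitary_group"
  by (simp add: unitary_group_def skew_K exp_minus_one_K adj_exp)
     (simp add: skew_def exp_minus_inverse, metis exp_minus_inverse minus_minus)

lemma adj_exp_skew: "h \<in> skew \<Longrightarrow> adj (exp h) = exp (- h)"
  by (simp add: adj_exp skew_K) (simp add: skew_def)

lemma closed_unitary_group: "closed unitary_group"
proof -
  have "closed ((\<lambda>u. u - 1) -` K \<inter> {u. u * adj u = 1} \<inter> {u. adj u * u = 1})"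
    by (intro closed_Int closed_vimage closed_K closed_Collect_eq continuous_intros continuous_adj)
  then show ?thesis by (simp add: unitary_group_def Collect_conj_eq vimage_def Int_assoc)
qed

text \<open>For a small logarithm y of a unitary, \<open>exp (\<sigma> y)\<close> and
  \<open>exp (- y)\<close> are both its inverse, and \<open>exp_expanding\<close> yields \<sigma> y
  = - y. The map \<sigma> is only bounded, so its bound C enters the choice of \<delta>.\<close>

lemma unitary_log:
  obtains \<delta> where "\<delta> > 0"
    "\<And>u. u \<in> unitary_group \<Longrightarrow> norm (u - 1) < \<delta> \<Longrightarrow> \<exists>h\<in>skew. exp h = u"
proof -
  obtain C where C: "C > 0" "\<And>x. norm (\<sigma> x) \<le> norm x * C"
    using bounded_linear.pos_bounded[OF bl_\<sigma>] by blast
  define \<delta> where "\<delta> = min (1/8) (1 / (8 * C))"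
  show thesis
  proof (rule that[of \<delta>])
    show "\<delta> > 0" using C by (simp add: \<delta>_def)
    fix u assume u: "u \<in> unitary_group" "norm (u - 1) < \<delta>"
    then obtain y where y: "y \<in> K" "norm y \<le> 2 * norm (u - 1)" "exp y = u"
      using log_exists[of u] unitaryD(1)[of u] by (auto simp: \<delta>_def)
    have n1: "norm y \<le> 1/4" using y u by (simp add: \<delta>_def)
    have "norm y \<le> 2 * (1 / (8 * C))" using y u by (simp add: \<delta>_def)
    then have "norm y * C \<le> 2 * (1 / (8 * C)) * C" using C by (intro mult_right_mono) auto
    also have "\<dots> = 1/4" using C by simp
    finally have n2: "norm (\<sigma> y) \<le> 1/4" using C(2)[of y] by linarith
    have "exp (\<sigma> y) * u = 1" using unitaryD(3)[OF u(1)] adj_exp[OF y(1)] y(3) by simp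
    then have "exp (\<sigma> y) * (u * exp (- y)) = exp (- y)" by (simp flip: mult.assoc)
    then have "exp (\<sigma> y) = exp (- y)" using exp_minus_inverse[of y] by (simp add: y(3))
    then have "norm (\<sigma> y - (- y)) \<le> 0"
      using exp_expanding[OF n2, of "- y"] n1 by simp
    then have "y \<in> skew" using y(1) by (simp add: skew_def eq_neg_iff_add_eq_0)
    then show "\<exists>h\<in>skew. exp h = u" using y(3) by blast
  qed
qed

text \<open>The finite products of exponentials of skew elements, a description that supports
  induction over the factors. \<open>U0_component\<close> identifies it with the connected component
  of the unit.\<close>

definition U0_group :: "'a set" where
  "U0_group = {prod_list (map exp hs) | hs. set hs \<subseteq> skew}"

lemma exp_U0: "h \<in> skew \<Longrightarrow> exp h \<in> U0_group"
  unfolding U0_group_def by (auto intro!: exI[of _ "[h]"])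

lemma one_U0: "1 \<in> U0_group"
  unfolding U0_group_def by (auto intro!: exI[of _ "[]"])

lemma U0_mult: "u \<in> U0_group \<Longrightarrow> v \<in> U0_group \<Longrightarrow> u * v \<in> U0_group"
  unfolding U0_group_def
proof clarify
  fix gs hs assume "set gs \<subseteq> skew" "set hs \<subseteq> skew"
  then show "\<exists>ks. prod_list (map exp gs) * prod_list (map exp hs) = prod_list (map exp ks) \<and> set ks \<subseteq> skew"
    by (intro exI[of _ "gs @ hs"]) auto
qed

lemma U0_induct [consumes 1, case_names one mult]:
  assumes "u \<in> U0_group" "P 1" "\<And>h u. h \<in> skew \<Longrightarrow> u \<in> U0_group \<Longrightarrow> P u \<Longrightarrow> P (exp h * u)"
  shows "P u"
proof -
  obtain hs where hs: "u = prod_list (map exp hs)" "set hs \<subseteq> skew"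
    using assms(1) by (auto simp: U0_group_def)
  have "P (prod_list (map exp hs))" using hs(2)
  proof (induction hs)
    case (Cons h hs)
    then show ?case by (auto intro!: assms(3) simp: U0_group_def)
  qed (simp add: assms(2))
  then show ?thesis by (simp add: hs)
qed

lemma U0_unitary: "u \<in> U0_group \<Longrightarrow> u \<in> unitary_group"
  by (induction rule: U0_induct) (auto intro: unitary_one unitary_mult unitary_exp)

lemmas U0_aff = unitaryD(1)[OF U0_unitary] and U0_right = unitaryD(2)[OF U0_unitary]
  and U0_left = unitaryD(3)[OF U0_unitary]

lemma U0_adj: "u \<in> U0_group \<Longrightarrow> adj u \<in> U0_group"
proof (induction rule: U0_induct)
  case (mult h u)
  then show ?case
    by (auto simp: adj_mult unitaryD(1)[OF unitary_exp] U0_aff adj_exp_skew skew_neg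
        intro!: U0_mult exp_U0)
qed (simp add: one_U0)

lemma U0_near_one: "\<exists>\<delta>>0. \<forall>u\<in>unitary_group. norm (u - 1) < \<delta> \<longrightarrow> u \<in> U0_group"
  using unitary_log by (metis exp_U0)

lemma U0_limit:
  assumes "\<And>n. f n \<in> U0_group" "f \<longlonglongrightarrow> u"
  shows "u \<in> U0_group"
proof -
  have u: "u \<in> unitary_group"
    by (rule closed_sequentially[OF closed_unitary_group _ assms(2)]) (simp add: assms(1) U0_unitary)
  obtain \<delta> where \<delta>: "\<delta> > 0" "\<And>v. v \<in> unitary_group \<Longrightarrow> norm (v - 1) < \<delta> \<Longrightarrow> v \<in> U0_group"
    using U0_near_one by blast
  have "(\<lambda>n. adj (f n) * u) \<longlonglongrightarrow> adj u * u"
    by (intro tendsto_intros tendsto_adj assms(2))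
  then have "(\<lambda>n. adj (f n) * u) \<longlonglongrightarrow> 1" by (simp add: unitaryD(3)[OF u])
  then obtain n where n: "norm (adj (f n) * u - 1) < \<delta>"
    using \<delta>(1) by (auto simp: LIMSEQ_iff)
  have "adj (f n) * u \<in> U0_group"
    by (rule \<delta>(2)[OF _ n]) (intro unitary_mult unitary_adj U0_unitary assms(1) u)
  then have "f n * (adj (f n) * u) \<in> U0_group" by (rule U0_mult[OF assms(1)])
  then show ?thesis using U0_right[OF assms(1)[of n]] by (simp flip: mult.assoc)
qed

text \<open>Every product of exponentials is joined to 1 by shrinking its factors. Conversely the
  products form a relatively open and closed set, because v = u (u^(-1) v) and the second factor is
  an exponential as soon as v is near u.\<close>

lemma U0_component: "connected_component_set unitary_group 1 = U0_group"
proof (rule antisym)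
  show "U0_group \<subseteq> connected_component_set unitary_group 1"
  proof
    fix u assume "u \<in> U0_group"
    then show "u \<in> connected_component_set unitary_group 1"
    proof (induction rule: U0_induct)
      case one
      show ?case using unitary_one by simp
    next
      case (mult h u)
      have uu: "u \<in> unitary_group" using mult U0_unitary by blast
      define S where "S = (\<lambda>t. exp (t *\<^sub>R h) * u) ` {0..1}"
      have "connected S" unfolding S_def
        by (intro connected_continuous_image continuous_intros continuous_on_exp_banach connected_Icc)
      moreover have "S \<subseteq> unitary_group" unfolding S_def
        using mult(1) uu by (auto intro!: unitary_mult unitary_exp skew_scale)
      moreover have "u \<in> S" unfolding S_def by (auto intro!: image_eqI[of _ _ 0])
      moreover have "exp h * u \<in> S" unfolding S_def by (auto intro!: image_eqI[of _ _ 1])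
      ultimately have "connected_component unitary_group u (exp h * u)"
        by (auto simp: connected_component_def)
      then show ?case using mult(3) connected_component_trans by auto
    qed
  qed
  show "connected_component_set unitary_group 1 \<subseteq> U0_group" (is "?C \<subseteq> _")
  proof -
    obtain \<delta> where \<delta>: "\<delta> > 0" "\<And>v. v \<in> unitary_group \<Longrightarrow> norm (v - 1) < \<delta> \<Longrightarrow> v \<in> U0_group"
      using U0_near_one by blast
    have "openin (top_of_set ?C) (?C \<inter> U0_group)"
      unfolding openin_contains_ball
    proof (intro conjI ballI)
      fix u assume u: "u \<in> ?C \<inter> U0_group"
      have "isCont (\<lambda>v. adj u * v) u" by (intro continuous_intros)
      then obtain e where e: "e > 0" "\<And>v. dist v u < e \<Longrightarrow> dist (adj u * v) (adj u * u) < \<delta>"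
        using \<delta>(1) unfolding continuous_at_eps_delta by blast
      have "ball u e \<inter> ?C \<subseteq> ?C \<inter> U0_group"
      proof
        fix v assume v: "v \<in> ball u e \<inter> ?C"
        then have vu: "v \<in> unitary_group" using connected_component_subset by blast
        have "dist (adj u * v) (adj u * u) < \<delta>"
          using v by (intro e(2)) (simp add: dist_commute)
        then have "norm (adj u * v - 1) < \<delta>" using U0_left[of u] u by (simp add: dist_norm)
        then have "adj u * v \<in> U0_group"
        proof (rule \<delta>(2)[rotated])
          show "adj u * v \<in> unitary_group"
            using u by (intro unitary_mult unitary_adj vu U0_unitary[of u]) simp
        qed
        then have "u * (adj u * v) \<in> U0_group" using u by (intro U0_mult[of u]) auto
        then have "v \<in> U0_group" using U0_right[of u] u by (simp flip: mult.assoc)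
        then show "v \<in> ?C \<inter> U0_group" using v by simp
      qed
      then show "\<exists>e>0. ball u e \<inter> ?C \<subseteq> ?C \<inter> U0_group" using e(1) by blast
    qed simp
    moreover have "closedin (top_of_set ?C) (?C \<inter> U0_group)"
    proof -
      have "closed U0_group"
        unfolding closed_sequential_limits using U0_limit by blast
      then show ?thesis by (rule closedin_closed_Int)
    qed
    moreover have "connected ?C" by (rule connected_connected_component)
    moreover have "1 \<in> ?C" using connected_component_refl[OF unitary_one] by simp
    then have "?C \<inter> U0_group \<noteq> {}" using one_U0 by blast
    ultimately show ?thesis unfolding connected_clopen by blast
  qed
qed

section \<open>The commutator subgroup and the quotient by its closure\<close>

inductive_set DU_group :: "'a set" where
  one: "1 \<in> DU_group"
| step: "x \<in> U0_group \<Longrightarrow> y \<in> U0_group \<Longrightarrow> d \<in> DU_group \<Longrightarrow> x * y * adj x * adj y * d \<in> DU_group"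

definition CU_group :: "'a set" where "CU_group = closure DU_group"

lemma DU_U0: "d \<in> DU_group \<Longrightarrow> d \<in> U0_group"
  by (induction rule: DU_group.induct) (auto intro: one_U0 U0_mult U0_adj)

lemma DU_mult: "d \<in> DU_group \<Longrightarrow> e \<in> DU_group \<Longrightarrow> d * e \<in> DU_group"
proof (induction rule: DU_group.induct)
  case (step x y d)
  then show ?case using DU_group.step[of x y "d * e"] by (simp add: mult.assoc)
qed simp

lemma DU_commutator: "x \<in> U0_group \<Longrightarrow> y \<in> U0_group \<Longrightarrow> x * y * adj x * adj y \<in> DU_group"
  using DU_group.step[OF _ _ DU_group.one] by simp

text \<open>The inverse of the commutator of x and y is the commutator of y and x, so the words
  generated by the inductive definition are closed under inverses.\<close>

lemma DU_adj: "d \<in> DU_group \<Longrightarrow> adj d \<in> DU_group"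
proof (induction rule: DU_group.induct)
  case (step x y d)
  have "adj (x * y * adj x * adj y * d) = adj d * (y * x * adj y * adj x)"
    using step(1,2) DU_U0[OF step(3)]
    by (simp add: adj_mult mult_aff adj_aff U0_aff adj_adj mult.assoc)
  then show ?case using step by (simp add: DU_mult DU_commutator)
qed (simp add: DU_group.one)

lemma DU_conj:
  assumes "d \<in> DU_group" "u \<in> U0_group"
  shows "u * d * adj u \<in> DU_group"
  using assms(1)
proof (induction rule: DU_group.induct)
  case one
  show ?case using assms(2) by (simp add: U0_right DU_group.one)
next
  case (step x y d)
  have c: "adj u * (u * z) = z" for z
    using U0_left[OF assms(2)] by (simp flip: mult.assoc)
  have "u * (x * y * adj x * adj y * d) * adj u
    = (u * x * adj u) * (u * y * adj u) * adj (u * x * adj u) * adj (u * y * adj u) * (u * d * adj u)"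
    using step(1,2) assms(2)
    by (simp add: adj_mult mult_aff adj_aff U0_aff adj_adj mult.assoc c)
  moreover have "u * x * adj u \<in> U0_group" "u * y * adj u \<in> U0_group"
    using step assms(2) by (auto intro: U0_mult U0_adj)
  ultimately show ?case using DU_group.step step(4) by simp
qed

lemma CU_seq: "c \<in> CU_group \<longleftrightarrow> (\<exists>f. (\<forall>n. f n \<in> DU_group) \<and> f \<longlonglongrightarrow> c)"
  unfolding CU_group_def by (rule closure_sequential)

lemma DU_CU: "d \<in> DU_group \<Longrightarrow> d \<in> CU_group"
  unfolding CU_group_def using closure_subset by blast

lemma CU_U0: "c \<in> CU_group \<Longrightarrow> c \<in> U0_group"
  unfolding CU_seq using U0_limit DU_U0 by blast

lemma CU_mult:
  assumes "c \<in> CU_group" "d \<in> CU_group"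
  shows "c * d \<in> CU_group"
proof -
  obtain f g where "\<And>n. f n \<in> DU_group" "f \<longlonglongrightarrow> c" "\<And>n. g n \<in> DU_group" "g \<longlonglongrightarrow> d"
    using assms unfolding CU_seq by blast
  then have "\<forall>n. f n * g n \<in> DU_group" "(\<lambda>n. f n * g n) \<longlonglongrightarrow> c * d"
    by (auto intro: DU_mult tendsto_mult)
  then show ?thesis unfolding CU_seq by (intro exI[of _ "\<lambda>n. f n * g n"]) simp
qed

lemma CU_adj:
  assumes "c \<in> CU_group"
  shows "adj c \<in> CU_group"
proof -
  obtain f where "\<And>n. f n \<in> DU_group" "f \<longlonglongrightarrow> c" using assms unfolding CU_seq by blast
  then have "\<forall>n. adj (f n) \<in> DU_group" "(\<lambda>n. adj (f n)) \<longlonglongrightarrow> adj c"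
    by (auto intro: DU_adj tendsto_adj)
  then show ?thesis unfolding CU_seq by (intro exI[of _ "\<lambda>n. adj (f n)"]) simp
qed

lemma CU_one: "1 \<in> CU_group"
  by (rule DU_CU[OF DU_group.one])

lemma CU_conj:
  assumes "c \<in> CU_group" "u \<in> U0_group"
  shows "u * c * adj u \<in> CU_group"
proof -
  obtain f where "\<And>n. f n \<in> DU_group" "f \<longlonglongrightarrow> c" using assms unfolding CU_seq by blast
  then have "\<forall>n. u * f n * adj u \<in> DU_group" "(\<lambda>n. u * f n * adj u) \<longlonglongrightarrow> u * c * adj u"
    by (auto intro!: DU_conj assms tendsto_intros)
  then show ?thesis unfolding CU_seq by (intro exI[of _ "\<lambda>n. u * f n * adj u"]) simp
qed

lemma CU_limit: "(\<And>n. f n \<in> CU_group) \<Longrightarrow> f \<longlonglongrightarrow> c \<Longrightarrow> c \<in> CU_group"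
  using closed_sequentially[of CU_group f c] by (simp add: CU_group_def)

text \<open>Equality in the quotient by the closed commutator subgroup. Membership of both sides is
  part of the relation, so chains of equivalences carry it along.\<close>

definition CU_equiv :: "'a \<Rightarrow> 'a \<Rightarrow> bool" (infix \<open>\<approxeq>\<close> 50) where
  "u \<approxeq> v \<longleftrightarrow> u \<in> U0_group \<and> v \<in> U0_group \<and> u * adj v \<in> CU_group"

lemma CU_equiv_refl: "u \<in> U0_group \<Longrightarrow> u \<approxeq> u"
  by (simp add: CU_equiv_def U0_right CU_one)

lemma CU_equiv_sym: "u \<approxeq> v \<Longrightarrow> v \<approxeq> u"
  using CU_adj[of "u * adj v"] by (auto simp: CU_equiv_def adj_mult adj_aff U0_aff adj_adj)

lemma CU_equiv_trans [trans]: "u \<approxeq> v \<Longrightarrow> v \<approxeq> w \<Longrightarrow> u \<approxeq> w"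
proof -
  assume a: "u \<approxeq> v" "v \<approxeq> w"
  then have "(u * adj v) * (v * adj w) \<in> CU_group" by (simp add: CU_equiv_def CU_mult)
  moreover have "(u * adj v) * (v * adj w) = u * (adj v * v) * adj w" by (simp only: mult.assoc)
  ultimately show ?thesis using a U0_left[of v] by (simp add: CU_equiv_def)
qed

lemma CU_equiv_mult: "u \<approxeq> u' \<Longrightarrow> v \<approxeq> v' \<Longrightarrow> u * v \<approxeq> u' * v'"
proof -
  assume a: "u \<approxeq> u'" "v \<approxeq> v'"
  then have U: "u \<in> U0_group" "u' \<in> U0_group" "v \<in> U0_group" "v' \<in> U0_group"
    by (auto simp: CU_equiv_def)
  have "(u * (v * adj v') * adj u) * (u * adj u') \<in> CU_group"
    using a U by (auto simp: CU_equiv_def intro: CU_mult CU_conj)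
  moreover have "(u * (v * adj v') * adj u) * (u * adj u') = u * v * adj v' * (adj u * u) * adj u'"
    by (simp only: mult.assoc)
  moreover have "\<dots> = u * v * adj (u' * v')"
    using U by (simp add: U0_left adj_mult U0_aff mult.assoc)
  ultimately show ?thesis using U by (simp add: CU_equiv_def U0_mult)
qed

lemma CU_equiv_commute: "u \<in> U0_group \<Longrightarrow> v \<in> U0_group \<Longrightarrow> u * v \<approxeq> v * u"
  using DU_CU[OF DU_commutator[of u v]]
  by (simp add: CU_equiv_def U0_mult adj_mult U0_aff mult.assoc)

lemma CU_equiv_one: "u \<approxeq> 1 \<longleftrightarrow> u \<in> CU_group"
  using CU_U0 by (auto simp: CU_equiv_def one_U0)

lemma CU_equiv_limit:
  assumes "\<And>n. f n \<approxeq> v" "f \<longlonglongrightarrow> u"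
  shows "u \<approxeq> v"
proof -
  have "u \<in> U0_group" by (rule U0_limit[OF _ assms(2)]) (use assms(1) in \<open>simp add: CU_equiv_def\<close>)
  moreover have "u * adj v \<in> CU_group"
    by (rule CU_limit[of "\<lambda>n. f n * adj v"])
       (use assms in \<open>auto simp: CU_equiv_def intro!: tendsto_mult\<close>)
  ultimately show ?thesis using assms(1)[of 0] by (simp add: CU_equiv_def)
qed

lemma CU_equiv_power:
  assumes "u \<in> U0_group" "v \<in> U0_group"
  shows "(u * v) ^ n \<approxeq> u ^ n * v ^ n"
proof (induction n)
  case 0
  show ?case by (simp add: CU_equiv_refl one_U0)
next
  case (Suc n)
  have U: "u ^ k \<in> U0_group" "v ^ k \<in> U0_group" for k
    by (induction k) (auto intro: one_U0 U0_mult assms)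
  have "(u * v) ^ Suc n \<approxeq> (u * v) * (u ^ n * v ^ n)"
    using Suc by (simp add: CU_equiv_mult CU_equiv_refl U0_mult assms)
  also have "(u * v) * (u ^ n * v ^ n) = u * (v * u ^ n) * v ^ n" by (simp only: mult.assoc)
  also have "\<dots> \<approxeq> u * (u ^ n * v) * v ^ n"
    by (intro CU_equiv_mult CU_equiv_refl CU_equiv_commute U assms)
  also have "u * (u ^ n * v) * v ^ n = u ^ Suc n * v ^ Suc n" by (simp add: mult.assoc)
  finally show ?case .
qed

text \<open>The quotient is commutative, so each Trotter product is equivalent to exp a exp b, and
  equivalence survives limits because \<open>CU_group\<close> is closed.\<close>

lemma exp_add_equiv:
  assumes "a \<in> skew" "b \<in> skew"
  shows "exp (a + b) \<approxeq> exp a * exp b"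
proof (rule CU_equiv_limit[OF _ Trotter])
  fix n
  let ?a = "a /\<^sub>R real (Suc n)" and ?b = "b /\<^sub>R real (Suc n)"
  have "(exp ?a * exp ?b) ^ Suc n \<approxeq> exp ?a ^ Suc n * exp ?b ^ Suc n"
    by (intro CU_equiv_power exp_U0 skew_scale assms)
  also have "exp ?a ^ Suc n * exp ?b ^ Suc n = exp a * exp b"
    by (simp only: exp_scaleR_nat[symmetric]) simp
  finally show "(exp ?a * exp ?b) ^ Suc n \<approxeq> exp a * exp b" .
qed

lemma exp_equiv_conj:
  assumes "u \<in> U0_group" "h \<in> skew"
  shows "u * h * adj u \<in> skew" "exp (u * h * adj u) \<approxeq> exp h"
proof -
  have k: "u * h * adj u \<in> K"
    by (intro mult_K_aff mult_aff_K adj_aff U0_aff skew_K assms)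
  define w where "w = u - 1"
  have w: "w \<in> K" using assms U0_aff by (simp add: w_def)
  have hK: "h \<in> K" and sh: "\<sigma> h = - h" using assms(2) by (auto simp: skew_def)
  have "u * h * adj u = h + w * h + h * \<sigma> w + w * h * \<sigma> w"
  proof -
    have u: "u = 1 + w" by (simp add: w_def)
    show ?thesis unfolding adj_def w_def[symmetric] unfolding u by (simp add: algebra_simps)
  qed
  then have "\<sigma> (u * h * adj u) = - (u * h * adj u)"
    using w hK by (simp add: \<sigma>_add \<sigma>_mult \<sigma>_K \<sigma>_\<sigma> mult_K sh mult.assoc)
  with k show "u * h * adj u \<in> skew" by (simp add: skew_def)
  have "u * exp h * adj u = exp (u * h * adj u)"
    using assms by (intro exp_conjugate[symmetric] U0_left U0_right)
  moreover have "u * exp h * adj u \<approxeq> exp h"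
  proof -
    have "u * exp h * adj u \<approxeq> adj u * (u * exp h)"
      by (intro CU_equiv_commute U0_mult U0_adj exp_U0 assms)
    also have "adj u * (u * exp h) = exp h"
      using U0_left[OF assms(1)] by (simp flip: mult.assoc)
    finally show ?thesis .
  qed
  ultimately show "exp (u * h * adj u) \<approxeq> exp h" by simp
qed

text \<open>The kernel of the additive map from skew elements to the quotient given by exp. In
  general it is no real subspace: for the complex numbers and block size 1 it is 2 \<pi> \<i> times
  the integers.\<close>

definition Lie_kernel :: "'a set" where "Lie_kernel = {h \<in> skew. exp h \<in> CU_group}"

lemma Lie_kernel_add: "a \<in> Lie_kernel \<Longrightarrow> b \<in> Lie_kernel \<Longrightarrow> a + b \<in> Lie_kernel"
proof -
  assume ab: "a \<in> Lie_kernel" "b \<in> Lie_kernel"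
  then have "exp (a + b) \<approxeq> exp a * exp b" by (auto simp: Lie_kernel_def intro: exp_add_equiv)
  also have "exp a * exp b \<approxeq> 1 * 1"
    using ab by (intro CU_equiv_mult) (auto simp: CU_equiv_one Lie_kernel_def)
  finally show ?thesis using ab by (simp add: Lie_kernel_def CU_equiv_one skew_add)
qed

lemma Lie_kernel_zero: "0 \<in> Lie_kernel"
  by (simp add: Lie_kernel_def skew_zero CU_one)

lemma Lie_kernel_sum: "(\<And>i. i \<in> I \<Longrightarrow> f i \<in> Lie_kernel) \<Longrightarrow> sum f I \<in> Lie_kernel"
  by (induction I rule: infinite_finite_induct) (auto intro: Lie_kernel_add Lie_kernel_zero)

lemma Lie_kernel_limit: "(\<And>n. f n \<in> Lie_kernel) \<Longrightarrow> f \<longlonglongrightarrow> h \<Longrightarrow> h \<in> Lie_kernel"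
  using closed_sequentially[OF closed_skew, of f h] CU_limit[of "\<lambda>n. exp (f n)" "exp h"]
  by (auto simp: Lie_kernel_def intro: tendsto_exp_banach)

lemma exp_equiv_of_diff:
  assumes "a \<in> skew" "b \<in> skew" "a - b \<in> Lie_kernel"
  shows "exp a \<approxeq> exp b"
proof -
  have "exp ((a - b) + b) \<approxeq> exp (a - b) * exp b"
    using assms by (intro exp_add_equiv skew_diff)
  also have "exp (a - b) * exp b \<approxeq> 1 * exp b"
    using assms by (intro CU_equiv_mult CU_equiv_refl exp_U0) (auto simp: CU_equiv_one Lie_kernel_def)
  finally show ?thesis by simp
qed

lemma Lie_kernel_diff:
  assumes "a \<in> skew" "b \<in> skew" "exp a \<approxeq> exp b"
  shows "a - b \<in> Lie_kernel"
proof -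
  have "exp (a + - b) \<approxeq> exp a * exp (- b)"
    using assms by (intro exp_add_equiv skew_neg)
  also have "\<dots> \<approxeq> exp b * exp (- b)"
    by (intro CU_equiv_mult CU_equiv_refl exp_U0 skew_neg assms)
  finally show ?thesis using assms
    by (simp add: Lie_kernel_def CU_equiv_one skew_diff exp_minus_inverse)
qed

text \<open>Conjugation by w = exp (a/n) does not change the class of exp (n b), so n (w b w^(-1) -
  b) lies in the kernel. Its limit is the derivative of conjugation, the commutator.\<close>

lemma Lie_kernel_commutator:
  assumes "a \<in> skew" "b \<in> skew"
  shows "a * b - b * a \<in> Lie_kernel"
proof -
  define w where "w n = exp (a /\<^sub>R real (Suc n))" for n
  define w' where "w' n = exp (- a /\<^sub>R real (Suc n))" for n
  have w: "w n \<in> U0_group" "adj (w n) = w' n" for n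
    using assms(1) by (auto simp: w_def w'_def exp_U0 skew_scale adj_exp_skew simp flip: scaleR_minus_right)
  have mem: "real (Suc n) *\<^sub>R (w n * b * w' n - b) \<in> Lie_kernel" for n
  proof -
    let ?b = "real (Suc n) *\<^sub>R b"
    have "w n * ?b * adj (w n) - ?b \<in> Lie_kernel"
      using exp_equiv_conj[OF w(1) skew_scale[OF assms(2)], of n "real (Suc n)"] assms(2)
      by (intro Lie_kernel_diff skew_scale) auto
    then show ?thesis by (simp add: w(2) scaleR_diff_right)
  qed
  have "(\<lambda>n. (real (Suc n) *\<^sub>R (w n - 1)) * b * w' n - b * (real (Suc n) *\<^sub>R (w n - 1)) * w' n)
      \<longlonglongrightarrow> a * b * exp (- 0) - b * a * exp (- 0)"
    unfolding w_def w'_def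
  proof (intro tendsto_intros tendsto_scaleR_exp tendsto_exp_banach)
    show "(\<lambda>n. - a /\<^sub>R real (Suc n)) \<longlonglongrightarrow> - 0"
      using tendsto_scaleR[OF LIMSEQ_inverse_real_of_nat tendsto_const[of "- a"]] by simp
    then show "(\<lambda>n. - a /\<^sub>R real (Suc n)) \<longlonglongrightarrow> - 0" .
  qed
  moreover have "(real (Suc n) *\<^sub>R (w n - 1)) * b * w' n - b * (real (Suc n) *\<^sub>R (w n - 1)) * w' n
      = real (Suc n) *\<^sub>R (w n * b * w' n - b)" for n
  proof -
    have "w n * w' n = 1" using U0_right[OF w(1)[of n]] by (simp add: w(2))
    then show ?thesis by (simp add: algebra_simps)
  qed
  ultimately have "(\<lambda>n. real (Suc n) *\<^sub>R (w n * b * w' n - b)) \<longlonglongrightarrow> a * b - b * a" by simp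
  then show ?thesis by (rule Lie_kernel_limit[OF mem])
qed

end

section \<open>Reduction to the upper left corner\<close>

interpretation cor: star_subalgebra "corners n :: 'a :: unital_cstar_algebra seq_op set" "corner_star n" for n
  by (intro star_subalgebra.intro closed_subalgebra.intro star_subalgebra_axioms.intro subspace_corners
      closed_corners corners_mult bounded_linear_corner_star corner_star_in_corners corner_star_star
      corner_star_mult)

lemma adj_mono: "m \<le> n \<Longrightarrow> u - 1 \<in> corners m \<Longrightarrow> cor.adj n u = cor.adj m u"
  by (simp add: cor.adj_def corner_star_mono)

lemma skew_mono: "m \<le> n \<Longrightarrow> cor.skew m \<subseteq> cor.skew n"
  using corners_mono by (auto simp: cor.skew_def corner_star_mono)

lemma U0_mono: "m \<le> n \<Longrightarrow> cor.U0_group m \<subseteq> cor.U0_group n"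
  using skew_mono unfolding cor.U0_group_def by fast

lemma DU_mono:
  assumes "m \<le> n" "d \<in> cor.DU_group m"
  shows "d \<in> cor.DU_group n"
  using assms(2)
proof (induction rule: cor.DU_group.induct)
  case (step x y d)
  then have "x \<in> cor.U0_group n" "y \<in> cor.U0_group n" using U0_mono[OF assms(1)] by auto
  moreover have "cor.adj m x = cor.adj n x" "cor.adj m y = cor.adj n y"
    using step adj_mono[OF assms(1)] cor.U0_aff by metis+
  ultimately show ?case using cor.DU_group.step[OF _ _ step(4)] by simp
qed (rule cor.DU_group.one)

lemma CU_mono: "m \<le> n \<Longrightarrow> cor.CU_group m \<subseteq> cor.CU_group n"
  unfolding cor.CU_group_def using DU_mono by (intro closure_mono) blast

section \<open>Matrix units and the trace modulo commutators of skew elements\<close>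

definition mat_unit :: "nat \<Rightarrow> nat \<Rightarrow> nat \<Rightarrow> 'a \<Rightarrow> 'a :: unital_cstar_algebra seq_op" where
  "mat_unit n i j a = corner n (\<lambda>k l. if k = i \<and> l = j then a else 0)"

lemma mat_unit_in_corners [simp]: "mat_unit n i j a \<in> corners n"
  by (simp add: mat_unit_def)

lemma entry_mat_unit: "i < n \<Longrightarrow> j < n \<Longrightarrow> entry k l (mat_unit n i j a) = (if k = i \<and> l = j then a else 0)"
  by (auto simp: mat_unit_def entry_corner)

lemma mat_unit_mult:
  assumes "i < n" "j < n" "k < n" "l < n"
  shows "mat_unit n i j a * mat_unit n k l b = (if j = k then mat_unit n i l (a * b) else 0)"
proof (rule corners_eqI)
  fix p q assume pq: "p < n" "q < n"
  have "(\<Sum>r<n. (if p = i \<and> r = j then a else 0) * (if r = k \<and> q = l then b else 0))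
      = (\<Sum>r<n. if r = j then (if p = i \<and> j = k \<and> q = l then a * b else 0) else 0)"
    by (rule sum.cong) auto
  then show "entry p q (mat_unit n i j a * mat_unit n k l b) = entry p q (if j = k then mat_unit n i l (a * b) else 0)"
    
    using assms pq by (simp add: entry_mult_corners[of _ n] entry_mat_unit)
qed (auto simp: corners_mult cor.K_zero)

lemma mat_unit_add: "mat_unit n i j (a + b) = mat_unit n i j a + mat_unit n i j b"
  unfolding mat_unit_def corner_add by (rule corner_cong) simp

lemma mat_unit_scaleR: "mat_unit n i j (r *\<^sub>R a) = r *\<^sub>R mat_unit n i j a"
  unfolding mat_unit_def corner_scaleR by (rule corner_cong) simp

lemma mat_unit_minus: "mat_unit n i j (- a) = - mat_unit n i j a"
  using mat_unit_scaleR[of n i j "-1" a] by simp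

lemma mat_unit_diff: "mat_unit n i j (a - b) = mat_unit n i j a - mat_unit n i j b"
  using mat_unit_add[of n i j a "- b"] by (simp add: mat_unit_minus)

lemma mat_unit_zero [simp]: "mat_unit n i j 0 = 0"
  using mat_unit_diff[of n i j 0 0] by simp

lemma bounded_linear_mat_unit: "bounded_linear (mat_unit n i j)"
  unfolding mat_unit_def
proof (rule bounded_linear_corner_of)
  show "bounded_linear (\<lambda>a. if k = i \<and> l = j then a else 0)" for k l
    by (cases "k = i"; cases "l = j") (simp_all add: bounded_linear_ident bounded_linear_zero)
qed

lemma corner_star_mat_unit: "corner_star n (mat_unit n i j a) = mat_unit n j i (star a)"
  unfolding mat_unit_def corner_star_corner by (rule corner_cong) auto

lemma corner_eq_sum_mat_unit: "corner n f = (\<Sum>i<n. \<Sum>j<n. mat_unit n i j (f i j))"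
proof (rule corners_eqI)
  fix p q assume pq: "p < n" "q < n"
  have "(\<Sum>i<n. \<Sum>j<n. entry p q (mat_unit n i j (f i j))) = (\<Sum>i<n. \<Sum>j<n. if i = p \<and> j = q then f i j else 0)"
    by (intro sum.cong refl) (auto simp: entry_mat_unit)
  also have "\<dots> = (\<Sum>i<n. if i = p then f i q else 0)"
    using pq by (intro sum.cong refl) (auto simp: if_distrib cong: if_cong)
  also have "\<dots> = f p q" using pq by simp
  finally show "entry p q (corner n f) = entry p q (\<Sum>i<n. \<Sum>j<n. mat_unit n i j (f i j))"
    using pq by (simp add: entry_corner entry_sum)
qed (auto intro!: cor.K_sum)

definition trace :: "nat \<Rightarrow> 'a :: unital_cstar_algebra seq_op \<Rightarrow> 'a" where
  "trace n x = (\<Sum>i<n. entry i i x)"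

lemma bounded_linear_trace: "bounded_linear (trace n)"
  unfolding trace_def by (intro bounded_linear_sum bounded_linear_entry)

text \<open>It is the commutator of \<i> e_ii with y e_ij - \<open>star y\<close> e_ji, where y = -
  \<i> a compensates the factor \<i> that the commutator produces.\<close>

lemma mat_unit_skew_off_diagonal:
  assumes "i < n" "j < n" "i \<noteq> j"
  shows "mat_unit n i j a - mat_unit n j i (star a) \<in> cor.Lie_kernel n"
proof -
  define D where "D = mat_unit n i i (\<i> *\<^sub>C (1 :: 'a))"
  define y where "y = - (\<i> *\<^sub>C a)"
  define Y where "Y = mat_unit n i j y - mat_unit n j i (star y)"
  have "D \<in> cor.skew n"
    by (simp add: cor.skew_def D_def corner_star_mat_unit star_scaleC scaleC_minus_left mat_unit_minus)
  moreover have "Y \<in> cor.skew n"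
    by (simp add: cor.skew_def Y_def cor.K_diff cor.\<sigma>_diff corner_star_mat_unit star_star)
  moreover have "D * Y - Y * D = mat_unit n i j a - mat_unit n j i (star a)"
    using assms
    by (simp add: D_def Y_def y_def left_diff_distrib right_diff_distrib mat_unit_mult mult_scaleC_left
        mult_scaleC_right star_minus star_scaleC scaleC_minus_left scaleC_minus_right mat_unit_minus)
  ultimately show ?thesis using cor.Lie_kernel_commutator by metis
qed

text \<open>It is the commutator of the infinitesimal rotation e_i0 - e_0i with y (e_i0 + e_0i) / 2;
  the latter is skew because y is.\<close>

lemma mat_unit_skew_diagonal:
  assumes "i < n" "star y = - y"
  shows "mat_unit n i i y - mat_unit n 0 0 y \<in> cor.Lie_kernel n"
proof (cases "i = 0")
  case False
  define P where "P = mat_unit n i 0 (1 :: 'a) - mat_unit n 0 i 1"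
  define Q where "Q = (1/2) *\<^sub>R (mat_unit n i 0 y + mat_unit n 0 i y)"
  have n: "0 < n" using assms(1) by simp
  have "P \<in> cor.skew n"
    by (simp add: cor.skew_def P_def cor.K_diff cor.\<sigma>_diff corner_star_mat_unit)
  moreover have "Q \<in> cor.skew n"
    by (simp add: cor.skew_def Q_def cor.K_scale cor.K_add cor.\<sigma>_add cor.\<sigma>_scaleR corner_star_mat_unit
        assms(2) mat_unit_minus scaleR_add_right)
  moreover have "P * Q - Q * P = mat_unit n i i y - mat_unit n 0 0 y"
  proof -
    have "P * (mat_unit n i 0 y + mat_unit n 0 i y) - (mat_unit n i 0 y + mat_unit n 0 i y) * P
      = 2 *\<^sub>R (mat_unit n i i y - mat_unit n 0 0 y)"
      using assms(1) n False
      by (simp add: P_def left_diff_distrib right_diff_distrib distrib_left distrib_right mat_unit_mult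
          scaleR_2)
    then show ?thesis by (simp add: Q_def flip: scaleR_diff_right)
  qed
  ultimately show ?thesis using cor.Lie_kernel_commutator by metis
qed (simp add: cor.Lie_kernel_zero)

text \<open>Off-diagonal entries form commutators in adjoint pairs, and each diagonal entry can be
  moved to position 0 at the cost of a commutator.\<close>

lemma skew_minus_trace_Lie_kernel:
  assumes "h \<in> cor.skew n"
  shows "h - mat_unit n 0 0 (trace n h) \<in> cor.Lie_kernel n"
proof -
  define f where "f i j = entry i j h" for i j
  have h: "h = corner n f" using cor.skew_K[OF assms] by (simp add: corners_iff f_def[abs_def])
  have hs: "corner_star n h = - h" using assms by (simp add: cor.skew_def)
  have ff: "star (f j i) = - f i j" if "i < n" "j < n" for i j
    using arg_cong[OF hs, of "entry i j"] that
    by (simp add: entry_minus corner_star_def entry_corner f_def)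
  \<comment> \<open>Each summand pairs half of the entry at (i, j) with its adjoint at (j, i) and is
    therefore skew by itself.\<close>
  define T where "T i j = mat_unit n i j ((1/2) *\<^sub>R f i j) - mat_unit n j i (star ((1/2) *\<^sub>R f i j))" for i j
  have "h = (1/2) *\<^sub>R (h - corner_star n h)" by (simp add: hs scaleR_2[symmetric])
  also have "\<dots> = (\<Sum>i<n. \<Sum>j<n. mat_unit n i j ((1/2) *\<^sub>R f i j))
      - (\<Sum>i<n. \<Sum>j<n. mat_unit n i j (star ((1/2) *\<^sub>R f j i)))"
    unfolding h corner_star_corner scaleR_diff_right corner_scaleR
    by (simp only: corner_eq_sum_mat_unit star_scaleR)
  also have "(\<Sum>i<n. \<Sum>j<n. mat_unit n i j (star ((1/2) *\<^sub>R f j i)))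
      = (\<Sum>i<n. \<Sum>j<n. mat_unit n j i (star ((1/2) *\<^sub>R f i j)))" by (rule sum.swap)
  finally have hT: "h = (\<Sum>i<n. \<Sum>j<n. T i j)" by (simp add: T_def sum_subtractf)
  have "mat_unit n 0 0 (trace n h) = (\<Sum>i<n. mat_unit n 0 0 (f i i))"
    unfolding trace_def f_def by (rule linear_sum[OF bounded_linear.linear[OF bounded_linear_mat_unit]])
  also have "\<dots> = (\<Sum>i<n. \<Sum>j<n. if i = j then mat_unit n 0 0 (f i i) else 0)"
    by (intro sum.cong refl) simp
  finally have "h - mat_unit n 0 0 (trace n h)
    = (\<Sum>i<n. \<Sum>j<n. T i j - (if i = j then mat_unit n 0 0 (f i i) else 0))"
    by (simp add: hT sum_subtractf)
  also have "\<dots> \<in> cor.Lie_kernel n"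
  proof (intro cor.Lie_kernel_sum)
    fix i j assume ij: "i \<in> {..<n}" "j \<in> {..<n}"
    show "T i j - (if i = j then mat_unit n 0 0 (f i i) else 0) \<in> cor.Lie_kernel n"
    proof (cases "i = j")
      case True
      have "T i i = mat_unit n i i (f i i)"
        using ij ff[of i i] 
        by (simp add: T_def star_scaleR mat_unit_minus mat_unit_scaleR scaleR_2[symmetric])
      then show ?thesis using True ij mat_unit_skew_diagonal[of i n "f i i"] ff[of i i] by simp
    next
      case False
      then show ?thesis using ij mat_unit_skew_off_diagonal[of i n j] by (simp add: T_def)
    qed
  qed
  finally show ?thesis .
qed

lemma mat_unit_0_0: "0 < n \<Longrightarrow> mat_unit n 0 0 a = mat_unit 1 0 0 a"
  unfolding mat_unit_def by (subst corner_mono[of 1 n]) (auto intro!: corner_cong)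

text \<open>Surjectivity on the quotients: every factor exp h may be replaced by the exponential of
  the trace of h placed in the upper left entry.\<close>

lemma U0_eq_CU_mult:
  assumes "u \<in> cor.U0_group n" "0 < n"
  obtains v where "v \<in> cor.U0_group 1" "cor.CU_equiv n u v"
  using assms(1)
proof (induction arbitrary: thesis rule: cor.U0_induct)
  case one
  show ?case by (rule one[OF cor.one_U0 cor.CU_equiv_refl[OF cor.one_U0]])
next
  case (mult h u)
  obtain v where v: "v \<in> cor.U0_group 1" "cor.CU_equiv n u v" using mult(3) by blast
  define k where "k = mat_unit 1 0 0 (trace n h)"
  have tr: "star (trace n h) = - trace n h"
  proof -
    have "star (entry i i h) = - entry i i h" if "i < n" for i
    proof -
      have "corner_star n h = - h" using mult(1) by (simp add: cor.skew_def)
      from arg_cong[OF this, of "entry i i"] show ?thesis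
        using that by (simp add: entry_minus corner_star_def entry_corner)
    qed
    then show ?thesis by (simp add: trace_def star_sum sum_negf)
  qed
  have k: "k \<in> cor.skew 1"
    by (simp add: cor.skew_def k_def corner_star_mat_unit tr mat_unit_minus)
  have "k \<in> cor.skew n" using k skew_mono[of 1 n] assms(2) by auto
  moreover have "h - k \<in> cor.Lie_kernel n"

    using skew_minus_trace_Lie_kernel[OF mult(1)] unfolding k_def mat_unit_0_0[OF assms(2)] .
  ultimately have "cor.CU_equiv n (exp h) (exp k)"
    using mult(1) by (intro cor.exp_equiv_of_diff)
  then have "cor.CU_equiv n (exp h * u) (exp k * v)" using v(2) by (rule cor.CU_equiv_mult)
  moreover have "exp k * v \<in> cor.U0_group 1" by (intro cor.U0_mult cor.exp_U0 k v)
  ultimately show ?case using mult(4) by blast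
qed

section \<open>The determinant of a Lipschitz path\<close>

text \<open>Instead of the integral of the trace of \<open>g' g\<^sup>-\<^sup>1\<close> its Riemann sums are used, taken modulo
  commutators; no limit has to exist.\<close>

definition commutator_span :: "'a :: real_algebra set" where
  "commutator_span = span {x * y - y * x | x y. True}"

lemma commutator_in_span: "x * y - y * x \<in> commutator_span"
  unfolding commutator_span_def by (rule span_base) blast

lemma subspace_commutator_span: "subspace commutator_span"
  unfolding commutator_span_def by (rule subspace_span)

lemmas commutator_span_add = subspace_add[OF subspace_commutator_span]
  and commutator_span_sum = subspace_sum[OF subspace_commutator_span]
  and commutator_span_neg = subspace_neg[OF subspace_commutator_span]
  and commutator_span_diff = subspace_diff[OF subspace_commutator_span]
  and commutator_span_zero = subspace_0[OF subspace_commutator_span]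
  and commutator_span_scale = subspace_scale[OF subspace_commutator_span]

text \<open>The quotient seminorm modulo \<open>commutator_span\<close> tends to 0. Distances to the
  span are used because the span need not be closed.\<close>

definition null_mod :: "(nat \<Rightarrow> 'a :: real_normed_algebra_1) \<Rightarrow> bool" where
  "null_mod s \<longleftrightarrow> (\<forall>e>0. \<forall>\<^sub>F m in sequentially. \<exists>c\<in>commutator_span. norm (s m - c) < e)"

lemma null_modD: "null_mod s \<Longrightarrow> e > 0 \<Longrightarrow> \<forall>\<^sub>F m in sequentially. \<exists>c\<in>commutator_span. norm (s m - c) < e"
  by (simp add: null_mod_def)

lemma null_mod_add:
  assumes "null_mod s" "null_mod t"
  shows "null_mod (\<lambda>m. s m + t m)"
  unfolding null_mod_def
proof (intro allI impI)
  fix e :: real assume "e > 0"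
  then have "e/2 > 0" by simp
  from null_modD[OF assms(1) this] null_modD[OF assms(2) this] show "\<forall>\<^sub>F m in sequentially. \<exists>c\<in>commutator_span. norm (s m + t m - c) < e"
  proof eventually_elim
    case (elim m)
    then obtain c d where "c \<in> commutator_span" "norm (s m - c) < e/2" "d \<in> commutator_span"
      "norm (t m - d) < e/2" by blast
    moreover have "norm (s m + t m - (c + d)) \<le> norm (s m - c) + norm (t m - d)"
      by (rule norm_diff_triangle_ineq)
    ultimately show ?case
      by (intro bexI[of _ "c + d"] commutator_span_add) auto
  qed
qed

lemma null_mod_minus:
  assumes "null_mod s"
  shows "null_mod (\<lambda>m. - s m)"
  unfolding null_mod_def
proof (intro allI impI)
  fix e :: real assume "e > 0"
  with assms have "\<forall>\<^sub>F m in sequentially. \<exists>c\<in>commutator_span. norm (s m - c) < e"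
    by (rule null_modD)
  then show "\<forall>\<^sub>F m in sequentially. \<exists>c\<in>commutator_span. norm (- s m - c) < e"
  proof eventually_elim
    case (elim m)
    then obtain c where c: "c \<in> commutator_span" "norm (s m - c) < e" by blast
    have "norm (- s m - - c) = norm (s m - c)" by (simp add: norm_minus_commute)
    then show ?case using c by (intro bexI[of _ "- c"]) (auto intro: commutator_span_neg)
  qed
qed

lemma null_mod_diff: "null_mod s \<Longrightarrow> null_mod t \<Longrightarrow> null_mod (\<lambda>m. s m - t m)"
  using null_mod_add[OF _ null_mod_minus, of s t] by simp

lemma null_mod_tendsto:
  assumes "s \<longlonglongrightarrow> 0"
  shows "null_mod s"
  unfolding null_mod_def
proof (intro allI impI)
  fix e :: real assume "e > 0"
  with assms have "\<forall>\<^sub>F m in sequentially. dist (s m) 0 < e" by (rule tendstoD)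
  then show "\<forall>\<^sub>F m in sequentially. \<exists>c\<in>commutator_span. norm (s m - c) < e"
    by eventually_elim (auto intro!: bexI[of _ 0] commutator_span_zero simp: dist_norm)
qed

lemma null_mod_zero [simp]: "null_mod (\<lambda>m. 0)"
  by (rule null_mod_tendsto) simp

lemma null_modI:
  assumes "\<And>m. m > 0 \<Longrightarrow> c m \<in> commutator_span" "\<And>m. m > 0 \<Longrightarrow> norm (s m - c m) \<le> B / real m"
  shows "null_mod s"
  unfolding null_mod_def
proof (intro allI impI)
  fix e :: real assume e: "e > 0"
  have "(\<lambda>m. B / real m) \<longlonglongrightarrow> 0" by (rule lim_const_over_n)
  from order_tendstoD(2)[OF this e] eventually_gt_at_top[of 0]
  show "\<forall>\<^sub>F m in sequentially. \<exists>c\<in>commutator_span. norm (s m - c) < e"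
    by eventually_elim (use assms in \<open>blast intro: order_le_less_trans\<close>)
qed

lemma null_mod_cong: "null_mod s \<Longrightarrow> (\<And>m. m > 0 \<Longrightarrow> s m = t m) \<Longrightarrow> null_mod t"
  unfolding null_mod_def
proof (intro allI impI)
  fix e :: real
  assume "\<forall>e>0. \<forall>\<^sub>F m in sequentially. \<exists>c\<in>commutator_span. norm (s m - c) < e" "e > 0"
    and eq: "\<And>m. m > 0 \<Longrightarrow> s m = t m"
  then have "\<forall>\<^sub>F m in sequentially. \<exists>c\<in>commutator_span. norm (s m - c) < e" by blast
  with eventually_gt_at_top[of 0] show "\<forall>\<^sub>F m in sequentially. \<exists>c\<in>commutator_span. norm (t m - c) < e"
    by eventually_elim (simp add: eq)
qed

lemma grid_points:
  assumes "m > 0" "j < m"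
  shows "real j / real m \<in> {0..1}" "(real j + 1) / real m \<in> {0..1}"
    "\<bar>(real j + 1) / real m - real j / real m\<bar> = 1 / real m"
  using assms by (auto simp: divide_simps)

text \<open>An algebra-valued trace, tracial only modulo commutators. Matrices with
  \<open>trace n\<close> and the algebra itself with the identity map are both instances, so
  determinants of loops in the two can be compared.\<close>

locale traced_algebra = closed_subalgebra K for K :: "'b :: {real_normed_algebra_1, banach} set" +
  fixes \<tau> :: "'b \<Rightarrow> 'a :: {real_normed_algebra_1, banach}"
  assumes bl_\<tau>: "bounded_linear \<tau>"
    and \<tau>_commute: "x \<in> K \<Longrightarrow> y \<in> K \<Longrightarrow> \<tau> (x * y) - \<tau> (y * x) \<in> commutator_span"
begin

lemmas \<tau>_add = linear_add[OF bounded_linear.linear[OF bl_\<tau>]]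
  and \<tau>_diff = linear_diff[OF bounded_linear.linear[OF bl_\<tau>]]
  and \<tau>_scaleR = linear_cmul[OF bounded_linear.linear[OF bl_\<tau>]]
  and \<tau>_zero = linear_0[OF bounded_linear.linear[OF bl_\<tau>]]
  and \<tau>_sum = linear_sum[OF bounded_linear.linear[OF bl_\<tau>]]

text \<open>The inverse is a second argument that must be Lipschitz too. This makes the notion
  symmetric and bounds the inverse along the path.\<close>

definition inv_path :: "(real \<Rightarrow> 'b) \<Rightarrow> (real \<Rightarrow> 'b) \<Rightarrow> bool" where
  "inv_path g gi \<longleftrightarrow> lip_path g \<and> lip_path gi \<and>
    (\<forall>t\<in>{0..1}. g t - 1 \<in> K \<and> gi t - 1 \<in> K \<and> g t * gi t = 1 \<and> gi t * g t = 1)"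

definition det_sum :: "(real \<Rightarrow> 'b) \<Rightarrow> (real \<Rightarrow> 'b) \<Rightarrow> nat \<Rightarrow> 'a" where
  "det_sum g gi m = (\<Sum>j<m. \<tau> (g ((real j + 1) / real m) * gi (real j / real m) - 1))"

lemma inv_pathD:
  assumes "inv_path g gi"
  shows "lip_path g" "lip_path gi" "t \<in> {0..1} \<Longrightarrow> g t - 1 \<in> K" "t \<in> {0..1} \<Longrightarrow> gi t - 1 \<in> K"
    "t \<in> {0..1} \<Longrightarrow> g t * gi t = 1" "t \<in> {0..1} \<Longrightarrow> gi t * g t = 1"
  using assms unfolding inv_path_def by blast+

lemma inv_path_swap: "inv_path g gi \<Longrightarrow> inv_path gi g"
  unfolding inv_path_def by blast

lemma inv_path_one: "inv_path (\<lambda>t. 1) (\<lambda>t. 1)"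
  by (simp add: inv_path_def K_zero)

lemma inv_path_mult:
  assumes "inv_path g gi" "inv_path h hi"
  shows "inv_path (\<lambda>t. g t * h t) (\<lambda>t. hi t * gi t)"
  unfolding inv_path_def
proof (intro conjI ballI lip_path_mult)
  note g = inv_pathD[OF assms(1)] and h = inv_pathD[OF assms(2)]
  fix t :: real assume t: "t \<in> {0..1}"
  show "g t * h t - 1 \<in> K" "hi t * gi t - 1 \<in> K" using g(3-4)[OF t] h(3-4)[OF t] by (auto intro: mult_aff)
  have "g t * h t * (hi t * gi t) = g t * (h t * hi t) * gi t" by (simp only: mult.assoc)
  then show "g t * h t * (hi t * gi t) = 1" using g(5)[OF t] h(5)[OF t] by simp
  have "hi t * gi t * (g t * h t) = hi t * (gi t * g t) * h t" by (simp only: mult.assoc)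
  then show "hi t * gi t * (g t * h t) = 1" using g(6)[OF t] h(6)[OF t] by simp
qed (use assms in \<open>auto simp: inv_path_def\<close>)

text \<open>The difference is the commutator of g x with gi; the unit drops out of gi, leaving gi -
  1, so that both factors lie in K.\<close>

lemma \<tau>_conjugate:
  assumes "g - 1 \<in> K" "gi - 1 \<in> K" "gi * g = 1" "x \<in> K"
  shows "\<tau> (g * x * gi) - \<tau> x \<in> commutator_span"
proof -
  define y where "y = gi - 1"
  have gx: "g * x \<in> K" using assms by (intro mult_aff_K)
  have "x = gi * (g * x)" using assms(3) by (simp flip: mult.assoc)
  then have "g * x * gi - x = (g * x) * y - y * (g * x)" by (simp add: y_def algebra_simps)
  then have "\<tau> (g * x * gi) - \<tau> x = \<tau> ((g * x) * y) - \<tau> (y * (g * x))"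
    by (simp only: flip: \<tau>_diff)
  then show ?thesis using \<tau>_commute[OF gx, of y] assms(2) by (simp add: y_def)
qed

lemma inv_path_step:
  assumes "inv_path g gi"
  obtains B where "B > 0"
    "\<And>m j. m > 0 \<Longrightarrow> j < m \<Longrightarrow> norm (g ((real j + 1) / real m) * gi (real j / real m) - 1) \<le> B / real m"
    "\<And>t. t \<in> {0..1} \<Longrightarrow> norm (g t) \<le> B" "\<And>t. t \<in> {0..1} \<Longrightarrow> norm (gi t) \<le> B"
proof -
  note g = inv_pathD[OF assms]
  obtain L where L: "L \<ge> 0" "\<And>s t. s \<in> {0..1} \<Longrightarrow> t \<in> {0..1} \<Longrightarrow> norm (g s - g t) \<le> L * \<bar>s - t\<bar>"
    using lip_pathE[OF g(1)] by blast
  obtain M where M: "M > 0" "\<And>t. t \<in> {0..1} \<Longrightarrow> norm (g t) \<le> M" using lip_path_bounded[OF g(1)] by blast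
  obtain M' where M': "M' > 0" "\<And>t. t \<in> {0..1} \<Longrightarrow> norm (gi t) \<le> M'" using lip_path_bounded[OF g(2)] by blast
  define B where "B = max (L * M') (max M M')"
  show thesis
  proof (rule that[of B])
    show "B > 0" using M by (simp add: B_def)
    show "norm (g t) \<le> B" "norm (gi t) \<le> B" if "t \<in> {0..1}" for t
      using M(2)[OF that] M'(2)[OF that] by (auto simp: B_def)
    fix m j :: nat assume mj: "m > 0" "j < m"
    let ?s = "(real j + 1) / real m" and ?t = "real j / real m"
    have "g ?s * gi ?t - 1 = (g ?s - g ?t) * gi ?t"
      using g(5)[OF grid_points(1)[OF mj]] by (simp add: left_diff_distrib)
    also have "norm \<dots> \<le> (L * (1 / real m)) * M'"
      using L(2)[OF grid_points(2,1)[OF mj]] M'(2)[OF grid_points(1)[OF mj]] grid_points(3)[OF mj] L(1)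
      by (intro order_trans[OF norm_mult_ineq] mult_mono) auto
    also have "\<dots> = L * M' / real m" by simp
    also have "\<dots> \<le> B / real m" by (intro divide_right_mono) (auto simp: B_def)
    finally show "norm (g ?s * gi ?t - 1) \<le> B / real m" .
  qed
qed

text \<open>One step of the product path contributes X + Z + X Z, where X is the step of g and Z is
  the step Y of h conjugated by g. Modulo commutators Z and Y have the same trace, and m terms X Z
  of order 1/m^2 are negligible.\<close>

lemma det_sum_mult:
  assumes "inv_path g gi" "inv_path h hi"
  shows "null_mod (\<lambda>m. det_sum (\<lambda>t. g t * h t) (\<lambda>t. hi t * gi t) m - (det_sum g gi m + det_sum h hi m))"
proof -
  note g = inv_pathD[OF assms(1)] and h = inv_pathD[OF assms(2)]
  obtain B where B: "B > 0"
    "\<And>m j. m > 0 \<Longrightarrow> j < m \<Longrightarrow> norm (g ((real j + 1) / real m) * gi (real j / real m) - 1) \<le> B / real m"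
    "\<And>t. t \<in> {0..1} \<Longrightarrow> norm (g t) \<le> B" "\<And>t. t \<in> {0..1} \<Longrightarrow> norm (gi t) \<le> B"
    using inv_path_step[OF assms(1)] by blast
  obtain C where C: "C > 0"
    "\<And>m j. m > 0 \<Longrightarrow> j < m \<Longrightarrow> norm (h ((real j + 1) / real m) * hi (real j / real m) - 1) \<le> C / real m"
    using inv_path_step[OF assms(2)] by metis
  obtain T where T: "T > 0" "\<And>x. norm (\<tau> x) \<le> norm x * T"
    using bounded_linear.pos_bounded[OF bl_\<tau>] by blast
  define X where "X m j = g ((real j + 1) / real m) * gi (real j / real m) - 1" for m j :: nat
  define Y where "Y m j = h ((real j + 1) / real m) * hi (real j / real m) - 1" for m j :: nat
  define Z where "Z m j = g (real j / real m) * Y m j * gi (real j / real m)" for m j :: nat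
  show ?thesis
  proof (rule null_modI[where c = "\<lambda>m. \<Sum>j<m. \<tau> (Z m j) - \<tau> (Y m j)" and B = "B * (B * C * B) * T"])
    fix m :: nat assume m: "m > 0"
    have YK: "Y m j \<in> K" if "j < m" for j
      unfolding Y_def using h grid_points[OF m that] by (intro mult_aff) auto
    show "(\<Sum>j<m. \<tau> (Z m j) - \<tau> (Y m j)) \<in> commutator_span"
    proof (rule commutator_span_sum)
      fix j assume "j \<in> {..<m}"
      then show "\<tau> (Z m j) - \<tau> (Y m j) \<in> commutator_span"
        unfolding Z_def using g grid_points[OF m, of j] by (intro \<tau>_conjugate YK) auto
    qed
    have key: "g ((real j + 1) / real m) * h ((real j + 1) / real m) * (hi (real j / real m) * gi (real j / real m)) - 1
        = X m j + Z m j + X m j * Z m j" if "j < m" for j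
    proof -
      let ?g = "g ((real j + 1) / real m)" and ?gi = "gi (real j / real m)" and ?g0 = "g (real j / real m)"
      let ?h = "h ((real j + 1) / real m)" and ?hi = "hi (real j / real m)"
      have g1: "?gi * ?g0 = 1" "?g0 * ?gi = 1" using g grid_points[OF m that] by auto
      have "?gi * (?g0 * z) = z" for z using g1 by (simp flip: mult.assoc)
      then show ?thesis by (simp add: X_def Y_def Z_def algebra_simps)
    qed
    have "det_sum (\<lambda>t. g t * h t) (\<lambda>t. hi t * gi t) m - (det_sum g gi m + det_sum h hi m)
        = (\<Sum>j<m. \<tau> (X m j + Z m j + X m j * Z m j) - (\<tau> (X m j) + \<tau> (Y m j)))"
      unfolding det_sum_def sum.distrib[symmetric] sum_subtractf[symmetric]
      by (intro sum.cong refl arg_cong2[where f = minus])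
         (simp_all add: key X_def[symmetric] Y_def[symmetric])
    also have "\<dots> - (\<Sum>j<m. \<tau> (Z m j) - \<tau> (Y m j)) = (\<Sum>j<m. \<tau> (X m j * Z m j))"
      unfolding sum_subtractf[symmetric] by (intro sum.cong refl) (simp add: \<tau>_add)
    also have "norm \<dots> \<le> (\<Sum>j<m. B / real m * (B * (C / real m) * B) * T)"
    proof (rule sum_norm_le)
      fix j assume "j \<in> {..<m}"
      then have j: "j < m" by simp
      have "norm (Z m j) \<le> B * (C / real m) * B"
        unfolding Z_def using B C j m grid_points[OF m j]
        by (intro order_trans[OF norm_mult_ineq] mult_mono) (auto simp: Y_def)
      then have "norm (X m j * Z m j) \<le> B / real m * (B * (C / real m) * B)"
        using B j m by (intro order_trans[OF norm_mult_ineq] mult_mono) (auto simp: X_def)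
      then show "norm (\<tau> (X m j * Z m j)) \<le> B / real m * (B * (C / real m) * B) * T"
        using T by (intro order_trans[OF T(2)] mult_right_mono) auto
    qed
    also have "\<dots> = B * (B * C * B) * T / real m" using m by simp
    finally show "norm (det_sum (\<lambda>t. g t * h t) (\<lambda>t. hi t * gi t) m - (det_sum g gi m + det_sum h hi m)
        - (\<Sum>j<m. \<tau> (Z m j) - \<tau> (Y m j))) \<le> B * (B * C * B) * T / real m" .
  qed
qed

lemma det_sum_const [simp]: "det_sum (\<lambda>t. 1) (\<lambda>t. 1) m = 0"
  by (simp add: det_sum_def \<tau>_zero)

lemma det_sum_cong:
  assumes "\<And>t. t \<in> {0..1} \<Longrightarrow> g t = h t" "\<And>t. t \<in> {0..1} \<Longrightarrow> gi t = hi t" "m > 0"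
  shows "det_sum g gi m = det_sum h hi m"
  unfolding det_sum_def
proof (intro sum.cong refl)
  fix j assume "j \<in> {..<m}"
  then show "\<tau> (g ((real j + 1) / real m) * gi (real j / real m) - 1) = \<tau> (h ((real j + 1) / real m) * hi (real j / real m) - 1)"
    using assms grid_points[OF assms(3), of j] by simp
qed

lemma det_sum_inverse:
  assumes "inv_path g gi"
  shows "null_mod (\<lambda>m. det_sum gi g m + det_sum g gi m)"
proof -
  have "det_sum (\<lambda>t. g t * gi t) (\<lambda>t. g t * gi t) m = 0" if "m > 0" for m
    using det_sum_cong[OF _ _ that, of "\<lambda>t. g t * gi t" "\<lambda>t. 1" "\<lambda>t. g t * gi t" "\<lambda>t. 1"]
      inv_pathD[OF assms] by simp
  then have "null_mod (\<lambda>m. 0 - (det_sum g gi m + det_sum gi g m))"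
    by (intro null_mod_cong[OF det_sum_mult[OF assms inv_path_swap[OF assms]]]) simp
  from null_mod_minus[OF this] show ?thesis by (simp add: add.commute)
qed

lemma inv_path_exp:
  assumes "h \<in> K"
  shows "inv_path (\<lambda>t. exp (t *\<^sub>R h)) (\<lambda>t. exp (- (t *\<^sub>R h)))"
proof -
  have lip: "lip_path (\<lambda>t. exp (t *\<^sub>R k))" for k :: 'b
  proof (rule lip_pathI[of _ "exp (norm k) * norm k"])
    fix s t :: real assume "s \<in> {0..1}" "t \<in> {0..1}"
    then have "norm (exp (s *\<^sub>R k) - exp (t *\<^sub>R k)) \<le> exp (norm k) * norm (s *\<^sub>R k - t *\<^sub>R k)"
      by (intro norm_exp_diff_le) (auto simp: mult_le_cancel_right1 intro: mult_left_le_one_le)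
    then show "norm (exp (s *\<^sub>R k) - exp (t *\<^sub>R k)) \<le> exp (norm k) * norm k * \<bar>s - t\<bar>"
      by (simp flip: scaleR_diff_left add: mult_ac)
  qed
  have "exp (t *\<^sub>R h) - 1 \<in> K" "exp (- (t *\<^sub>R h)) - 1 \<in> K" for t
    using assms by (auto intro!: exp_minus_one_K K_neg K_scale)
  then show ?thesis
    unfolding inv_path_def using lip[of h] lip[of "- h"] exp_minus_inverse[of "_ *\<^sub>R h"]
      exp_minus_inverse[of "- (_ *\<^sub>R h)"] by auto
qed

text \<open>All m steps are equal to exp (h/m), so the sum is the trace of m (exp (h/m) - 1), a
  difference quotient of the exponential.\<close>

lemma det_sum_exp:
  assumes "h \<in> K"
  shows "null_mod (\<lambda>m. det_sum (\<lambda>t. exp (t *\<^sub>R h)) (\<lambda>t. exp (- (t *\<^sub>R h))) m - \<tau> h)"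
proof (rule null_mod_tendsto, rule LIMSEQ_imp_Suc)
  have eq: "det_sum (\<lambda>t. exp (t *\<^sub>R h)) (\<lambda>t. exp (- (t *\<^sub>R h))) (Suc m)
      = \<tau> (real (Suc m) *\<^sub>R (exp (h /\<^sub>R real (Suc m)) - 1))" for m
  proof -
    have "exp (((real j + 1) / real (Suc m)) *\<^sub>R h) * exp (- ((real j / real (Suc m)) *\<^sub>R h))
       = exp (h /\<^sub>R real (Suc m))" for j :: nat
    proof -
      have "h /\<^sub>R real (Suc m) = ((real j + 1) / real (Suc m) - real j / real (Suc m)) *\<^sub>R h"
        by (simp only: diff_divide_distrib[symmetric]) (simp add: divide_inverse)
      also have "\<dots> = ((real j + 1) / real (Suc m)) *\<^sub>R h + - ((real j / real (Suc m)) *\<^sub>R h)"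
        by (simp only: scaleR_diff_left) simp
      also have "exp \<dots> = exp (((real j + 1) / real (Suc m)) *\<^sub>R h) * exp (- ((real j / real (Suc m)) *\<^sub>R h))"
        by (rule exp_add_commuting) simp
      finally show ?thesis by (rule sym)
    qed
    then show ?thesis by (simp only: det_sum_def \<tau>_scaleR sum_constant_scaleR card_lessThan)
  qed
  have "(\<lambda>m. \<tau> (real (Suc m) *\<^sub>R (exp (h /\<^sub>R real (Suc m)) - 1)) - \<tau> h) \<longlonglongrightarrow> \<tau> h - \<tau> h"
    by (intro tendsto_intros bounded_linear.tendsto[OF bl_\<tau>] tendsto_scaleR_exp)
  then show "(\<lambda>m. det_sum (\<lambda>t. exp (t *\<^sub>R h)) (\<lambda>t. exp (- (t *\<^sub>R h))) (Suc m) - \<tau> h) \<longlonglongrightarrow> 0"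
    by (simp only: eq) simp
qed

end

section \<open>Stability of the determinant of a loop under perturbation\<close>

lemma exp_quotient_bound:
  fixes x y :: "'a :: {real_normed_algebra_1, banach}"
  assumes "norm x \<le> r" "norm y \<le> r" "r \<le> 1"
  shows "norm (exp y * exp (- x) - 1 - (y - x)) \<le> 9 * r * norm (y - x)"
proof -
  have r: "r \<ge> 0" using assms(1) norm_ge_zero[of x] by linarith
  have er: "exp r \<le> 3" using assms(3) exp_le by (smt (verit) exp_le_cancel_iff)
  define d where "d = y - x"
  define e where "e = exp y - exp x - d"
  have e: "norm e \<le> 2 * r * norm d"
    using exp_minus_id_lipschitz[OF assms(2,1)] exp_minus_one_le[OF r assms(3)]
    by (simp add: e_def d_def) (meson mult_right_mono norm_ge_zero order_trans)
  have n1: "norm (exp (- x)) \<le> 3"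
    using norm_exp[of "- x"] assms(1) er by (smt (verit) exp_le_cancel_iff norm_minus_cancel)
  have n2: "norm (exp (- x) - 1) \<le> 3 * r"
  proof -
    have "norm (exp (- x) - exp 0) \<le> exp r * norm (- x - 0)"
      using assms(1) r by (intro norm_exp_diff_le) auto
    also have "\<dots> \<le> 3 * r" using assms(1) er by (intro mult_mono) auto
    finally show ?thesis by simp
  qed
  \<comment> \<open>Noncommutativity is hidden in these two terms, of size 3 r and 6 r times the
    norm of d; hence the constant 9.\<close>
  have "exp y * exp (- x) - 1 - d = d * (exp (- x) - 1) + e * exp (- x)"
    using exp_minus_inverse[of x] by (simp add: e_def algebra_simps)
  also have "norm \<dots> \<le> norm d * (3 * r) + (2 * r * norm d) * 3"
    using e n1 n2 r
    by (intro order_trans[OF norm_triangle_ineq] add_mono order_trans[OF norm_mult_ineq] mult_mono) auto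
  also have "\<dots> = 9 * r * norm d" by simp
  finally show ?thesis by (simp add: d_def)
qed

context traced_algebra
begin

lemma inv_path_exp_path:
  assumes "lip_path l" "\<And>t. t \<in> {0..1} \<Longrightarrow> l t \<in> K"
  shows "inv_path (\<lambda>t. exp (l t)) (\<lambda>t. exp (- l t))"
proof -
  have lip: "lip_path (\<lambda>t. exp (k t))" if k: "lip_path k" for k :: "real \<Rightarrow> 'b"
  proof -
    obtain M where M: "M > 0" "\<And>t. t \<in> {0..1} \<Longrightarrow> norm (k t) \<le> M" using lip_path_bounded[OF k] by blast
    have "(exp M)-lipschitz_on {x :: 'b. norm x \<le> M} exp"
      by (rule lipschitz_onI) (auto simp: dist_norm intro: norm_exp_diff_le)
    then show ?thesis using M(2) by (intro lip_path_compose[OF k]) auto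
  qed
  have "exp (l t) - 1 \<in> K" "exp (- l t) - 1 \<in> K" if "t \<in> {0..1}" for t
    using assms(2)[OF that] by (intro exp_minus_one_K K_neg; simp)+
  then show ?thesis unfolding inv_path_def
    using lip[OF assms(1)] lip[OF lip_path_minus[OF assms(1)]] exp_minus_inverse[of "l _"]
      exp_minus_inverse[of "- l _"]
    by simp
qed

text \<open>Additivity of the determinant for exp (N l) = (exp l)^N. It lets a path of logarithms be
  replaced by an arbitrarily small multiple.\<close>

lemma det_sum_exp_power:
  assumes "lip_path l" "\<And>t. t \<in> {0..1} \<Longrightarrow> l t \<in> K"
  shows "null_mod (\<lambda>m. det_sum (\<lambda>t. exp (real N *\<^sub>R l t)) (\<lambda>t. exp (- (real N *\<^sub>R l t))) m
     - real N *\<^sub>R det_sum (\<lambda>t. exp (l t)) (\<lambda>t. exp (- l t)) m)"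
proof (induction N)
  case (Suc N)
  have 1: "inv_path (\<lambda>t. exp (real N *\<^sub>R l t)) (\<lambda>t. exp (- (real N *\<^sub>R l t)))"
    using assms by (intro inv_path_exp_path lip_path_scaleR K_scale) auto
  have 2: "exp (real (Suc N) *\<^sub>R l t) = exp (real N *\<^sub>R l t) * exp (l t)"
    "exp (- (real (Suc N) *\<^sub>R l t)) = exp (- l t) * exp (- (real N *\<^sub>R l t))" for t
    by (subst exp_add_commuting[symmetric], simp, simp add: algebra_simps)+
  from null_mod_add[OF det_sum_mult[OF 1 inv_path_exp_path[OF assms]] Suc]
  show ?case by (simp only: 2) (simp add: algebra_simps)
qed simp

text \<open>The increments of l telescope to l 1 - l 0 = 0. What remains is the error of
  \<open>exp_quotient_bound\<close>, proportional to r and to the total length L, uniformly in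
  m.\<close>

lemma det_sum_exp_small:
  assumes "\<And>s t. s \<in> {0..1} \<Longrightarrow> t \<in> {0..1} \<Longrightarrow> norm (l s - l t) \<le> L * \<bar>s - t\<bar>"
    "\<And>t. t \<in> {0..1} \<Longrightarrow> norm (l t) \<le> r" "r \<le> 1" "l 0 = l 1" "m > 0"
    and T: "T \<ge> 0" "\<And>x. norm (\<tau> x) \<le> norm x * T"
  shows "norm (det_sum (\<lambda>t. exp (l t)) (\<lambda>t. exp (- l t)) m) \<le> 9 * r * L * T"
proof -
  have r: "r \<ge> 0" using order_trans[OF norm_ge_zero assms(2)[of 0]] by simp
  define d where "d j = l ((real j + 1) / real m) - l (real j / real m)" for j :: nat
  define e where "e j = exp (l ((real j + 1) / real m)) * exp (- l (real j / real m)) - 1 - d j" for j :: nat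
  have "(\<Sum>j<m. d j) = (\<Sum>j<m. l (real (Suc j) / real m) - l (real j / real m))"
    by (simp add: d_def add.commute)
  also have "\<dots> = l (real m / real m) - l (real 0 / real m)"
    by (rule sum_lessThan_telescope)
  also have "\<dots> = 0" using assms(4,5) by simp
  finally have d0: "(\<Sum>j<m. d j) = 0" .
  have e: "norm (e j) \<le> 9 * r * (L / real m)" if "j < m" for j
  proof -
    note gp = grid_points[OF assms(5) that]
    have "norm (e j) \<le> 9 * r * norm (d j)"
      unfolding e_def d_def using gp by (intro exp_quotient_bound assms(2,3)) auto
    also have "\<dots> \<le> 9 * r * (L * (1 / real m))"
      unfolding d_def using assms(1)[OF gp(2,1)] gp(3) r by (intro mult_left_mono) auto
    finally show ?thesis by simp
  qed
  have "det_sum (\<lambda>t. exp (l t)) (\<lambda>t. exp (- l t)) m = (\<Sum>j<m. \<tau> (d j + e j))"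
    by (simp add: det_sum_def e_def)
  also have "\<dots> = \<tau> (\<Sum>j<m. d j) + (\<Sum>j<m. \<tau> (e j))"
    by (simp add: \<tau>_add \<tau>_sum sum.distrib)
  also have "\<dots> = (\<Sum>j<m. \<tau> (e j))" by (simp add: d0 \<tau>_zero)
  also have "norm \<dots> \<le> (\<Sum>j<m. 9 * r * (L / real m) * T)"
    using e T(1) by (intro sum_norm_le order_trans[OF T(2)] mult_right_mono) auto
  also have "\<dots> = 9 * r * L * T" using assms(5) by simp
  finally show ?thesis .
qed

text \<open>Dividing l by N divides both its size and its Lipschitz constant by N, so its sum is of
  order 1/N^2, while passing back to l costs only a factor N. Since N is arbitrary, nothing remains
  modulo commutators.\<close>

lemma det_sum_exp_loop:
  assumes l: "lip_path l" "\<And>t. t \<in> {0..1} \<Longrightarrow> l t \<in> K" and "l 0 = l 1"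
  shows "null_mod (det_sum (\<lambda>t. exp (l t)) (\<lambda>t. exp (- l t)))"
  unfolding null_mod_def
proof (intro allI impI)
  fix e :: real assume e: "e > 0"
  obtain L where L: "L \<ge> 0" "\<And>s t. s \<in> {0..1} \<Longrightarrow> t \<in> {0..1} \<Longrightarrow> norm (l s - l t) \<le> L * \<bar>s - t\<bar>"
    using lip_pathE[OF l(1)] by blast
  obtain M where M: "M > 0" "\<And>t. t \<in> {0..1} \<Longrightarrow> norm (l t) \<le> M" using lip_path_bounded[OF l(1)] by blast
  obtain T where T: "T > 0" "\<And>x. norm (\<tau> x) \<le> norm x * T"
    using bounded_linear.pos_bounded[OF bl_\<tau>] by blast
  \<comment> \<open>Exceeding M brings the logarithms below norm 1. The other bound, with 18 = 2 *
    9, keeps N times the small sum below e/2; the second half of e is spent on commutators.\<close>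
  obtain N where "max M (18 * M * L * T / e) < real N" using reals_Archimedean2 by blast
  then have N: "M < real N" "18 * M * L * T / e < real N" by auto
  then have Np: "real N > 0" using M by linarith
  define l' where "l' t = l t /\<^sub>R real N" for t
  have l': "lip_path l'" "\<And>t. t \<in> {0..1} \<Longrightarrow> l' t \<in> K"
    using l by (auto simp: l'_def[abs_def] intro: lip_path_scaleR K_scale)
  have small: "norm (det_sum (\<lambda>t. exp (l' t)) (\<lambda>t. exp (- l' t)) m) \<le> 9 * (M / real N) * (L / real N) * T"
    if "m > 0" for m
  proof (rule det_sum_exp_small[OF _ _ _ _ that])
    show "norm (l' s - l' t) \<le> L / real N * \<bar>s - t\<bar>" if "s \<in> {0..1}" "t \<in> {0..1}" for s t
      using mult_left_mono[OF L(2)[OF that], of "inverse (real N)"] Np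
      by (simp add: l'_def divide_inverse mult_ac flip: scaleR_diff_right)
    show "norm (l' t) \<le> M / real N" if "t \<in> {0..1}" for t
      using M(2)[OF that] Np by (simp add: l'_def divide_inverse mult.commute)
    show "M / real N \<le> 1" using N(1) Np by simp
    show "l' 0 = l' 1" using assms(3) by (simp add: l'_def)
  qed (use T in auto)
  have eq: "real N *\<^sub>R l' t = l t" for t using Np by (simp add: l'_def)
  have "\<forall>\<^sub>F m in sequentially. \<exists>c\<in>commutator_span.
      norm (det_sum (\<lambda>t. exp (l t)) (\<lambda>t. exp (- l t)) m
       - real N *\<^sub>R det_sum (\<lambda>t. exp (l' t)) (\<lambda>t. exp (- l' t)) m - c) < e / 2"
    using null_modD[OF det_sum_exp_power[OF l', of N], of "e / 2"] e by (simp add: eq)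
  with eventually_gt_at_top[of 0]
  show "\<forall>\<^sub>F m in sequentially. \<exists>c\<in>commutator_span. norm (det_sum (\<lambda>t. exp (l t)) (\<lambda>t. exp (- l t)) m - c) < e"
  proof eventually_elim
    case (elim m)
    let ?D = "det_sum (\<lambda>t. exp (l t)) (\<lambda>t. exp (- l t)) m"
    let ?D' = "det_sum (\<lambda>t. exp (l' t)) (\<lambda>t. exp (- l' t)) m"
    from elim(2) obtain c where c: "c \<in> commutator_span" "norm (?D - real N *\<^sub>R ?D' - c) < e / 2" by blast
    have "norm (real N *\<^sub>R ?D') \<le> real N * (9 * (M / real N) * (L / real N) * T)"
      unfolding norm_scaleR using small[OF elim(1)] Np by (simp only: abs_of_pos mult_le_cancel_left_pos)
    also have "\<dots> = (18 * M * L * T / e) * (e / 2) / real N" using Np e by simp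
    also have "\<dots> \<le> real N * (e / 2) / real N"
      using N(2) e Np by (intro divide_right_mono mult_right_mono) auto
    also have "\<dots> = e / 2" using Np by simp
    finally have "norm (real N *\<^sub>R ?D') \<le> e / 2" .
    moreover have "?D - c = (?D - real N *\<^sub>R ?D' - c) + real N *\<^sub>R ?D'" by simp
    ultimately have "norm (?D - c) < e"
      using c(2) norm_triangle_ineq[of "?D - real N *\<^sub>R ?D' - c" "real N *\<^sub>R ?D'"] by simp
    then show ?case using c(1) by blast
  qed
qed

text \<open>The quotient \<rho> of h by g stays within 1/8 of 1 and is the exponential of a loop of
  logarithms, whose determinant vanishes. For open paths the trace of the increment of the logarithm
  would survive.\<close>

theorem det_sum_perturb:
  assumes g: "inv_path g gi" "g 0 = g 1"
    and h: "lip_path h" "h 0 = h 1" "\<And>t. t \<in> {0..1} \<Longrightarrow> h t - 1 \<in> K"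
    and near: "\<And>t. t \<in> {0..1} \<Longrightarrow> norm ((h t - g t) * gi t) \<le> 1/8"
  obtains hi where "inv_path h hi" "null_mod (\<lambda>m. det_sum h hi m - det_sum g gi m)"
proof -
  note gD = inv_pathD[OF g(1)]
  define \<rho> where "\<rho> t = h t * gi t" for t
  have \<rho>: "\<rho> t - 1 \<in> K" "norm (\<rho> t - 1) \<le> 1/8" if "t \<in> {0..1}" for t
  proof -
    show "\<rho> t - 1 \<in> K" unfolding \<rho>_def using that by (intro mult_aff h(3) gD(4))
    have "\<rho> t - 1 = (h t - g t) * gi t" using gD(5)[OF that] by (simp add: \<rho>_def left_diff_distrib)
    then show "norm (\<rho> t - 1) \<le> 1/8" using near[OF that] by simp
  qed
  have lip_\<rho>: "lip_path \<rho>" unfolding \<rho>_def by (intro lip_path_mult h gD)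
  have "\<exists>y. y \<in> K \<and> norm y \<le> 1/4 \<and> exp y = \<rho> t" if t: "t \<in> {0..1}" for t
  proof -
    obtain y where "y \<in> K" "norm y \<le> 2 * norm (\<rho> t - 1)" "exp y = \<rho> t"
      using log_exists[OF \<rho>[OF t]] by blast
    then show ?thesis using \<rho>(2)[OF that] by (intro exI[of _ y]) simp
  qed
  then obtain l where l: "\<And>t. t \<in> {0..1} \<Longrightarrow> l t \<in> K" "\<And>t. t \<in> {0..1} \<Longrightarrow> norm (l t) \<le> 1/4"
    "\<And>t. t \<in> {0..1} \<Longrightarrow> exp (l t) = \<rho> t" by metis
  obtain L where L: "L \<ge> 0" "\<And>s t. s \<in> {0..1} \<Longrightarrow> t \<in> {0..1} \<Longrightarrow> norm (\<rho> s - \<rho> t) \<le> L * \<bar>s - t\<bar>"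
    using lip_pathE[OF lip_\<rho>] by blast
  \<comment> \<open>The logarithms were chosen pointwise. This estimate makes them Lipschitz and
    also gives l 0 = l 1.\<close>
  have ll: "norm (l s - l t) \<le> 2 * norm (\<rho> s - \<rho> t)" if "s \<in> {0..1}" "t \<in> {0..1}" for s t
    using exp_expanding[OF l(2)[OF that(1)] l(2)[OF that(2)]] l(3) that by simp
  have lip_l: "lip_path l"
  proof (rule lip_pathI[of _ "2 * L"])
    fix s t :: real assume "s \<in> {0..1}" "t \<in> {0..1}"
    then show "norm (l s - l t) \<le> 2 * L * \<bar>s - t\<bar>" using ll[of s t] L(2)[of s t] by simp
  qed
  have "gi 0 = gi 1"
  proof -
    have "gi 0 = gi 0 * (g 1 * gi 1)" using gD(5)[of 1] by simp
    also have "\<dots> = (gi 0 * g 0) * gi 1" by (simp only: g(2) mult.assoc)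
    finally show ?thesis using gD(6)[of 0] by simp
  qed
  then have "\<rho> 0 = \<rho> 1" by (simp add: \<rho>_def h(2))
  then have l01: "l 0 = l 1" using ll[of 0 1] by simp
  note pl = inv_path_exp_path[OF lip_l l(1)]
  have "inv_path (\<lambda>t. exp (l t) * g t) (\<lambda>t. gi t * exp (- l t))"
    by (rule inv_path_mult[OF pl g(1)])
  moreover have hg: "exp (l t) * g t = h t" if "t \<in> {0..1}" for t
    using gD(6)[OF that] by (simp add: l(3)[OF that] \<rho>_def mult.assoc)
  ultimately have ph: "inv_path h (\<lambda>t. gi t * exp (- l t))"
    using h(1) unfolding inv_path_def by simp
  have "null_mod (\<lambda>m. (det_sum (\<lambda>t. exp (l t) * g t) (\<lambda>t. gi t * exp (- l t)) m
      - (det_sum (\<lambda>t. exp (l t)) (\<lambda>t. exp (- l t)) m + det_sum g gi m))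
      + det_sum (\<lambda>t. exp (l t)) (\<lambda>t. exp (- l t)) m)"
    by (rule null_mod_add[OF det_sum_mult[OF pl g(1)] det_sum_exp_loop[OF lip_l l(1) l01]])
  then have "null_mod (\<lambda>m. det_sum h (\<lambda>t. gi t * exp (- l t)) m - det_sum g gi m)"
  proof (rule null_mod_cong)
    fix m :: nat assume "m > 0"
    then have "det_sum (\<lambda>t. exp (l t) * g t) (\<lambda>t. gi t * exp (- l t)) m = det_sum h (\<lambda>t. gi t * exp (- l t)) m"
      by (intro det_sum_cong hg) auto
    then show "det_sum (\<lambda>t. exp (l t) * g t) (\<lambda>t. gi t * exp (- l t)) m
      - (det_sum (\<lambda>t. exp (l t)) (\<lambda>t. exp (- l t)) m + det_sum g gi m)
      + det_sum (\<lambda>t. exp (l t)) (\<lambda>t. exp (- l t)) m = det_sum h (\<lambda>t. gi t * exp (- l t)) m - det_sum g gi m"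
      by simp
  qed
  then show thesis by (rule that[OF ph])
qed

end

lemma entry_aff_mult:
  assumes "u - 1 \<in> corners n" "v - 1 \<in> corners n" "i < n" "j < n"
  shows "entry i j (u * v) = (\<Sum>k<n. entry i k u * entry k j v)"
proof -
  have e: "entry a b u = entry a b (u - 1) + (if a = b then 1 else 0)"
    "entry a b v = entry a b (v - 1) + (if a = b then 1 else 0)" for a b
    by (simp_all add: entry_diff entry_one)
  have "u * v = (u - 1) * (v - 1) + (u - 1) + (v - 1) + 1" by (simp add: algebra_simps)
  then have "entry i j (u * v) = entry i j ((u - 1) * (v - 1)) + entry i j (u - 1) + entry i j (v - 1)
      + (if i = j then 1 else 0)"
    by (simp only: entry_add entry_one)
  also have "\<dots> = (\<Sum>k<n. entry i k u * entry k j v)"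
    using assms(3,4)
    by (simp add: e entry_mult_corners[OF assms] distrib_left distrib_right sum.distrib
        if_distrib[of "\<lambda>x. _ * x"] if_distrib[of "\<lambda>x. x * _"] cong: if_cong)
  finally show ?thesis .
qed

lemma trace_commute:
  assumes "x \<in> corners n" "y \<in> corners n"
  shows "trace n (x * y) - trace n (y * x) \<in> commutator_span"
proof -
  have "trace n (x * y) = (\<Sum>i<n. \<Sum>k<n. entry i k x * entry k i y)"
    unfolding trace_def by (intro sum.cong refl entry_mult_corners assms) auto
  moreover have "trace n (y * x) = (\<Sum>k<n. \<Sum>i<n. entry k i y * entry i k x)"
    unfolding trace_def by (intro sum.cong refl entry_mult_corners assms) auto
  moreover have "(\<Sum>k<n. \<Sum>i<n. entry k i y * entry i k x) = (\<Sum>i<n. \<Sum>k<n. entry k i y * entry i k x)"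
    by (rule sum.swap)
  ultimately have "trace n (x * y) - trace n (y * x)
      = (\<Sum>i<n. \<Sum>k<n. entry i k x * entry k i y - entry k i y * entry i k x)"
    by (simp add: sum_subtractf)
  then show ?thesis by (simp add: commutator_span_sum commutator_in_span)
qed

interpretation tr: traced_algebra "corners n :: 'a :: unital_cstar_algebra seq_op set" "trace n" for n
  by (intro traced_algebra.intro traced_algebra_axioms.intro cor.closed_subalgebra_axioms
      bounded_linear_trace trace_commute)

interpretation alg: traced_algebra "UNIV :: 'a :: unital_cstar_algebra set" "\<lambda>x :: 'a. x"
proof (intro traced_algebra.intro traced_algebra_axioms.intro bounded_linear_ident)
  show "closed_subalgebra (UNIV :: 'a set)" by unfold_locales auto
qed (rule commutator_in_span)

section \<open>Laurent polynomial loops\<close>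

text \<open>Powers of the coordinate function on the circle, which is parametrized by the unit
  interval.\<close>

definition zpow :: "int \<Rightarrow> real \<Rightarrow> complex" where
  "zpow k t = cis (2 * pi * (of_int k * t))"

lemma zpow_mult: "zpow k t * zpow l t = zpow (k + l) t"
  by (simp add: zpow_def cis_mult algebra_simps)

lemma norm_zpow [simp]: "cmod (zpow k t) = 1"
  by (simp add: zpow_def)

lemma zpow_zero [simp]: "zpow 0 t = 1"
  by (simp add: zpow_def)

lemma zpow_endpoints: "zpow k 0 = 1" "zpow k 1 = 1"
  by (auto simp: zpow_def intro: cis_multiple_2pi)

lemma lip_path_zpow: "lip_path (zpow k)"
proof (rule lip_pathI[of _ "exp (2 * pi * \<bar>of_int k\<bar>) * (2 * pi * \<bar>of_int k\<bar>)"])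
  fix s t :: real assume st: "s \<in> {0..1}" "t \<in> {0..1}"
  let ?z = "\<lambda>t. \<i> * complex_of_real (2 * pi * (of_int k * t))"
  have n: "norm (?z t) \<le> 2 * pi * \<bar>of_int k\<bar>" if "t \<in> {0..1}" for t
    using that by (simp add: norm_mult abs_mult mult_left_le)
  have "norm (exp (?z s) - exp (?z t)) \<le> exp (2 * pi * \<bar>of_int k\<bar>) * norm (?z s - ?z t)"
    by (intro norm_exp_diff_le n st)
  also have "?z s - ?z t = \<i> * complex_of_real (2 * pi * of_int k * (s - t))"
    by (simp add: algebra_simps)
  also have "norm \<dots> = 2 * pi * \<bar>of_int k\<bar> * \<bar>s - t\<bar>"
    by (simp only: norm_mult norm_of_real abs_mult) simp
  finally show "norm (zpow k s - zpow k t) \<le> exp (2 * pi * \<bar>of_int k\<bar>) * (2 * pi * \<bar>of_int k\<bar>) * \<bar>s - t\<bar>"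
    by (simp add: zpow_def cis_conv_exp mult.assoc)
qed

lemma bounded_linear_scaleC_left: "bounded_linear (\<lambda>c. c *\<^sub>C (a :: 'a :: unital_cstar_algebra))"
  by (rule bounded_linear_intro[where K = "norm a"])
     (simp_all add: scaleC_add_left norm_scaleC scaleC_scaleC flip: scaleC_of_real, simp add: scaleR_conv_of_real)

lemma scaleC_sum_right: "c *\<^sub>C (\<Sum>i\<in>I. f i) = (\<Sum>i\<in>I. c *\<^sub>C (f i :: 'a :: unital_cstar_algebra))"
  by (induction I rule: infinite_finite_induct) (simp_all add: scaleC_add_right)

text \<open>At most l coefficients, for the exponents from -d upwards. The Euclidean algorithm keeps
  d fixed and decreases l, the measure of degree; l = 0 means the zero function on the
  interval.\<close>

definition laurent :: "nat \<Rightarrow> nat \<Rightarrow> (real \<Rightarrow> 'a :: unital_cstar_algebra) \<Rightarrow> bool" where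
  "laurent d l p \<longleftrightarrow> (\<exists>a. \<forall>t\<in>{0..1}. p t = (\<Sum>k<l. zpow (int k - int d) t *\<^sub>C a k))"

lemma laurentI:
  "(\<And>t. t \<in> {0..1} \<Longrightarrow> p t = (\<Sum>k<l. zpow (int k - int d) t *\<^sub>C a k)) \<Longrightarrow> laurent d l p"
  unfolding laurent_def by blast

lemma laurentE:
  assumes "laurent d l p"
  obtains a where "\<And>t. t \<in> {0..1} \<Longrightarrow> p t = (\<Sum>k<l. zpow (int k - int d) t *\<^sub>C a k)"
  using assms unfolding laurent_def by blast

lemma laurent_cong: "laurent d l p \<Longrightarrow> (\<And>t. t \<in> {0..1} \<Longrightarrow> p t = q t) \<Longrightarrow> laurent d l q"
  unfolding laurent_def by simp

lemma laurent_lip_path: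
  assumes "laurent d l p"
  shows "lip_path p"
proof -
  obtain a where a: "\<And>t. t \<in> {0..1} \<Longrightarrow> p t = (\<Sum>k<l. zpow (int k - int d) t *\<^sub>C a k)"
    using laurentE[OF assms] by blast
  have "lip_path (\<lambda>t. \<Sum>k<l. zpow (int k - int d) t *\<^sub>C a k)"
    by (intro lip_path_sum lip_path_bounded_linear[OF bounded_linear_scaleC_left] lip_path_zpow)
  then show ?thesis by (rule lip_path_cong) (simp add: a)
qed

lemma laurent_loop: "laurent d l p \<Longrightarrow> p 0 = p 1"
  by (auto simp: laurent_def zpow_endpoints)

lemma laurent_mono:
  assumes "laurent d l p" "l \<le> l'"
  shows "laurent d l' p"
proof -
  obtain a where a: "\<And>t. t \<in> {0..1} \<Longrightarrow> p t = (\<Sum>k<l. zpow (int k - int d) t *\<^sub>C a k)"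
    using laurentE[OF assms(1)] by blast
  have "(\<Sum>k<l'. zpow (int k - int d) t *\<^sub>C (if k < l then a k else 0))
      = (\<Sum>k<l. zpow (int k - int d) t *\<^sub>C a k)" for t
    using assms(2) by (intro sum.mono_neutral_cong_right) auto
  then show ?thesis using a by (intro laurentI[where a = "\<lambda>k. if k < l then a k else 0"]) simp
qed

lemma sum_lessThan_add_split:
  "(\<Sum>k<l + e. f k) = (\<Sum>k<e. f k) + (\<Sum>k<l. f (k + e))" for f :: "nat \<Rightarrow> 'a :: comm_monoid_add"
proof (induction l)
  case (Suc l)
  then show ?case by (simp add: add.assoc)
qed simp

lemma laurent_shift:
  assumes "laurent d l p"
  shows "laurent (d + e) (l + e) p"
proof -
  obtain a where a: "\<And>t. t \<in> {0..1} \<Longrightarrow> p t = (\<Sum>k<l. zpow (int k - int d) t *\<^sub>C a k)"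
    using laurentE[OF assms] by blast
  show ?thesis
    by (rule laurentI[where a = "\<lambda>k. if k < e then 0 else a (k - e)"])
       (simp add: sum_lessThan_add_split a)
qed

lemma laurent_add:
  assumes "laurent d l p" "laurent d l' q"
  shows "laurent d (max l l') (\<lambda>t. p t + q t)"
proof -
  obtain a where "\<And>t. t \<in> {0..1} \<Longrightarrow> p t = (\<Sum>k<max l l'. zpow (int k - int d) t *\<^sub>C a k)"
    using laurentE[OF laurent_mono[OF assms(1) max.cobounded1]] by blast
  moreover obtain b where "\<And>t. t \<in> {0..1} \<Longrightarrow> q t = (\<Sum>k<max l l'. zpow (int k - int d) t *\<^sub>C b k)"
    using laurentE[OF laurent_mono[OF assms(2) max.cobounded2]] by blast
  ultimately show ?thesis
    by (intro laurentI[where a = "\<lambda>k. a k + b k"]) (simp add: scaleC_add_right sum.distrib)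
qed

lemma laurent_zero: "laurent d l (\<lambda>t. 0)"
  by (rule laurentI[where a = "\<lambda>k. 0"]) simp

lemma laurent_mult:
  assumes "laurent d l p"
  shows "laurent d (l + e) (\<lambda>t. zpow (int e) t *\<^sub>C (b * p t))"
proof -
  obtain a where a: "\<And>t. t \<in> {0..1} \<Longrightarrow> p t = (\<Sum>k<l. zpow (int k - int d) t *\<^sub>C a k)"
    using laurentE[OF assms] by blast
  have shift: "int e + (int k - int d) = int (k + e) - int d" for k by simp
  show ?thesis
    by (intro laurentI[where a = "\<lambda>k. if k < e then 0 else b * a (k - e)"])
       (simp add: sum_lessThan_add_split a sum_distrib_left mult_scaleC_right scaleC_sum_right
         scaleC_scaleC zpow_mult shift del: of_nat_add)
qed

definition laurent_poly :: "(real \<Rightarrow> 'a :: unital_cstar_algebra) \<Rightarrow> bool" where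
  "laurent_poly p \<longleftrightarrow> (\<exists>d l. laurent d l p)"

lemma laurent_poly_add:
  assumes "laurent_poly p" "laurent_poly q"
  shows "laurent_poly (\<lambda>t. p t + q t)"
proof -
  obtain d l e m where "laurent d l p" "laurent e m q" using assms by (auto simp: laurent_poly_def)
  then have "laurent (d + e) (l + e) p" "laurent (d + e) (m + d) q"
    using laurent_shift[of d l p e] laurent_shift[of e m q d] by (auto simp: add.commute)
  then show ?thesis unfolding laurent_poly_def by (blast intro: laurent_add)
qed

lemma laurent_poly_sum: "(\<And>i. i \<in> I \<Longrightarrow> laurent_poly (f i)) \<Longrightarrow> laurent_poly (\<lambda>t. \<Sum>i\<in>I. f i t)"
  by (induction I rule: infinite_finite_induct)
     (auto intro: laurent_poly_add simp: laurent_poly_def[of "\<lambda>t. 0"] laurent_zero)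

lemma laurent_poly_mono: "laurent_poly (\<lambda>t. zpow k t *\<^sub>C a)"
proof -
  define d where "d = nat \<bar>k\<bar>"
  have "int (nat (k + int d)) - int d = k" by (simp add: d_def)
  then have "(\<Sum>j<nat (k + int d) + 1. zpow (int j - int d) t *\<^sub>C (if j = nat (k + int d) then a else 0))
      = zpow k t *\<^sub>C a" for t
    by (simp add: if_distrib[of "\<lambda>x. _ *\<^sub>C x"] cong: if_cong)
  then have "laurent d (nat (k + int d) + 1) (\<lambda>t. zpow k t *\<^sub>C a)"
    by (intro laurentI[where a = "\<lambda>j. if j = nat (k + int d) then a else 0"]) simp
  then show ?thesis by (auto simp: laurent_poly_def)
qed

lemma laurent_poly_common:
  assumes "finite I" "\<And>i. i \<in> I \<Longrightarrow> laurent_poly (p i)"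
  obtains d where "\<And>i. i \<in> I \<Longrightarrow> \<exists>l. laurent d l (p i)"
  using assms
proof (induction I arbitrary: thesis)
  case (insert i I)
  obtain d where d: "\<And>i. i \<in> I \<Longrightarrow> \<exists>l. laurent d l (p i)" using insert by blast
  obtain e l where e: "laurent e l (p i)" using insert(5)[of i] by (auto simp: laurent_poly_def)
  show ?case
  proof (rule insert(4)[of "d + e"])
    fix j assume "j \<in> insert i I"
    then show "\<exists>l. laurent (d + e) l (p j)"
      using laurent_shift[OF e, of d] d laurent_shift[of d _ "p j" e] by (auto simp: add.commute)
  qed
qed blast

section \<open>Approximation of Lipschitz loops by Laurent polynomials\<close>

inductive trig_poly :: "(real \<Rightarrow> complex) \<Rightarrow> bool" where
  mono: "trig_poly (\<lambda>t. c * zpow k t)"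
| add: "trig_poly f \<Longrightarrow> trig_poly g \<Longrightarrow> trig_poly (\<lambda>t. f t + g t)"

lemma trig_poly_mult: "trig_poly f \<Longrightarrow> trig_poly g \<Longrightarrow> trig_poly (\<lambda>t. f t * g t)"
proof (induction f rule: trig_poly.induct)
  case (mono c k)
  from mono show ?case
  proof (induction g rule: trig_poly.induct)
    case (mono c' k')
    have "(\<lambda>t. c * zpow k t * (c' * zpow k' t)) = (\<lambda>t. (c * c') * zpow (k + k') t)"
      by (simp add: zpow_mult[symmetric] mult_ac)
    then show ?case by (simp only: trig_poly.mono)
  next
    case (add f g)
    then show ?case by (simp add: distrib_left trig_poly.add)
  qed
next
  case (add f h)
  then show ?case by (simp add: distrib_right trig_poly.add)
qed

text \<open>On the circle the real and imaginary parts of z are combinations of z and 1/z, so it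
  suffices to treat real-linear functions and products.\<close>

lemma trig_poly_real_polynomial:
  "real_polynomial_function (g :: complex \<Rightarrow> real) \<Longrightarrow> trig_poly (\<lambda>t. of_real (g (zpow 1 t)))"
proof (induction rule: real_polynomial_function.induct)
  case (linear f)
  have f: "f z = f 1 * Re z + f \<i> * Im z" for z
  proof -
    have "z = Re z *\<^sub>R 1 + Im z *\<^sub>R \<i>" by (simp add: complex_eq_iff)
    then have "f z = f (Re z *\<^sub>R 1 + Im z *\<^sub>R \<i>)" by (rule arg_cong)
    also have "\<dots> = Re z * f 1 + Im z * f \<i>"
      using bounded_linear.linear[OF linear] by (simp only: linear_add linear_cmul real_scaleR_def)
    finally show ?thesis by (simp add: mult.commute)
  qed
  have c: "complex_of_real (cos x) = (cis x + cis (- x)) / 2"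
    "complex_of_real (sin x) = \<i> / 2 * (cis (- x) - cis x)" for x
    by (simp_all add: complex_eq_iff)
  have "(\<lambda>t. complex_of_real (f (zpow 1 t)))
    = (\<lambda>t. (of_real (f 1) / 2 - \<i> / 2 * of_real (f \<i>)) * zpow 1 t
        + (of_real (f 1) / 2 + \<i> / 2 * of_real (f \<i>)) * zpow (-1) t)"
    by (subst f) (simp add: zpow_def c algebra_simps add_divide_distrib diff_divide_distrib)
  then show ?case by (simp only: trig_poly.intros)
next
  case (const c)
  then show ?case using trig_poly.mono[of "of_real c" 0] by simp
qed (auto intro: trig_poly.add trig_poly_mult)

lemma trig_poly_laurent: "trig_poly f \<Longrightarrow> laurent_poly (\<lambda>t. f t *\<^sub>C a)"
proof (induction rule: trig_poly.induct)
  case (mono c k)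
  have "(c * zpow k t) *\<^sub>C a = zpow k t *\<^sub>C (c *\<^sub>C a)" for t by (simp add: scaleC_scaleC mult.commute)
  then show ?case by (simp only: laurent_poly_mono)
qed (simp add: scaleC_add_left laurent_poly_add)

text \<open>Up to \<pi>/3 the mean value theorem applies with cos at least 1/2, which exceeds
  1/\<pi>; beyond that the sine is at least 1/2, which exceeds y/\<pi>.\<close>

lemma sin_ge_third:
  assumes "0 \<le> y" "y \<le> pi / 2"
  shows "sin y \<ge> y / pi"
proof (cases "y \<le> pi / 3")
  case True
  show ?thesis
  proof (cases "y = 0")
    case False
    then have y: "0 < y" using assms by simp
    have "\<exists>z>0. z < y \<and> sin y - sin 0 = (y - 0) * cos z"
      by (rule MVT2[OF y]) (auto intro: DERIV_sin)
    then obtain z where z: "0 < z" "z < y" "sin y = y * cos z" by auto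
    have "cos (pi / 3) \<le> cos z" using z True by (intro cos_monotone_0_pi_le) auto
    moreover have "1 / pi \<le> 1 / 2" using pi_ge_two by (intro divide_left_mono) auto
    ultimately have "1 / pi \<le> cos z" unfolding cos_60 by (rule order_trans[rotated])
    then have "y * (1 / pi) \<le> y * cos z" using y by (intro mult_left_mono) auto
    then show ?thesis using z by simp
  qed simp
next
  case False
  have "sin (pi / 6) \<le> sin y" using False assms by (intro sin_monotone_2pi_le) auto
  moreover have "y / pi \<le> 1 / 2" using assms by (simp add: divide_le_eq)
  ultimately show ?thesis unfolding sin_30 by (rule order_trans[rotated])
qed

text \<open>A loop is a function on the circle, and it is Lipschitz for the chordal distance 2 |sin
  (\<pi> x)|. For x > 1/2 the short way between the points leads through the common
  endpoint.\<close>

lemma norm_loop_chord: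
  assumes q: "\<And>s t. s \<in> {0..1} \<Longrightarrow> t \<in> {0..1} \<Longrightarrow> norm (q s - q t) \<le> L * \<bar>s - t\<bar>" "q 0 = q 1" "L \<ge> 0"
    and st: "s \<in> {0..1}" "t \<in> {0..1}"
  shows "norm (q s - q t) \<le> L * cmod (zpow 1 s - zpow 1 t)"
proof -
  define x where "x = \<bar>s - t\<bar>"
  have x: "0 \<le> x" "x \<le> 1" using st by (auto simp: x_def)
  have chord: "cmod (zpow 1 s - zpow 1 t) = 2 * \<bar>sin (pi * x)\<bar>"
  proof -
    have half: "2 * pi * s = (pi * (s + t)) + pi * (s - t)" "2 * pi * t = (pi * (s + t)) - pi * (s - t)"
      by (auto simp: algebra_simps)
    have "zpow 1 s - zpow 1 t = cis (pi * (s + t)) * (cis (pi * (s - t)) - cis (- (pi * (s - t))))"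
      unfolding zpow_def by (simp add: half cis_mult[symmetric] right_diff_distrib cis_divide[symmetric]
          flip: cis_inverse)
    also have "cmod \<dots> = cmod (cis (pi * (s - t)) - cis (- (pi * (s - t))))"
      by (simp only: norm_mult norm_cis mult_1)
    also have "cis (pi * (s - t)) - cis (- (pi * (s - t))) = 2 * \<i> * of_real (sin (pi * (s - t)))"
      by (simp add: complex_eq_iff)
    also have "cmod \<dots> = 2 * \<bar>sin (pi * (s - t))\<bar>" by (simp add: norm_mult)
    also have "\<bar>sin (pi * (s - t))\<bar> = \<bar>sin (pi * x)\<bar>"
    proof -
      have "pi * x = pi * (s - t) \<or> pi * x = - (pi * (s - t))"
        by (auto simp: x_def abs_if algebra_simps)
      then show ?thesis by (elim disjE) (simp_all only: sin_minus abs_minus_cancel)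
    qed
    finally show ?thesis .
  qed
  show ?thesis
  proof (cases "x \<le> 1/2")
    case True
    have "sin (pi * x) \<ge> pi * x / pi" using x True by (intro sin_ge_third) auto
    then have "x \<le> cmod (zpow 1 s - zpow 1 t)" using x chord by simp
    then have "L * x \<le> L * cmod (zpow 1 s - zpow 1 t)" using q(3) by (rule mult_left_mono)
    then show ?thesis using q(1)[OF st] by (simp add: x_def)
  next
    case False
    have "sin (pi * (1 - x)) \<ge> pi * (1 - x) / pi" using x False by (intro sin_ge_third) auto
    moreover have "sin (pi * (1 - x)) = sin (pi * x)" by (simp add: right_diff_distrib' sin_diff)
    ultimately have le: "1 - x \<le> cmod (zpow 1 s - zpow 1 t)" using x chord by simp
    \<comment> \<open>The route through the endpoint, where q 0 = q 1, has length 1 - (b -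
      a).\<close>
    have main: "norm (q a - q b) \<le> L * (1 - (b - a))" if "a \<in> {0..1}" "b \<in> {0..1}" "a \<le> b" for a b
    proof -
      have "q a - q b = (q a - q 0) + (q 1 - q b)" using q(2) by simp
      also have "norm \<dots> \<le> L * \<bar>a - 0\<bar> + L * \<bar>1 - b\<bar>"
        using that by (intro order_trans[OF norm_triangle_ineq] add_mono q(1)) auto
      also have "\<dots> = L * (1 - (b - a))" using that by (simp add: algebra_simps)
      finally show ?thesis .
    qed
    have "norm (q s - q t) \<le> L * (1 - x)"
      using main[of s t] main[of t s] st by (cases "s \<le> t") (auto simp: x_def norm_minus_commute)
    also have "\<dots> \<le> L * cmod (zpow 1 s - zpow 1 t)" using q(3) le by (intro mult_left_mono)
    finally show ?thesis .
  qed
qed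

text \<open>Tent functions around sample points give a partition of unity on the circle, and
  averaging the sample values of q with it approximates q. Only these scalar weights have to be
  approximated by polynomials, through Stone-Weierstrass.\<close>

lemma laurent_approximation:
  fixes q :: "real \<Rightarrow> 'a :: unital_cstar_algebra"
  assumes "lip_path q" "q 0 = q 1" "e > 0"
  obtains p where "laurent_poly p" "\<And>t. t \<in> {0..1} \<Longrightarrow> norm (p t - q t) \<le> e"
proof -
  obtain L where L: "L \<ge> 0" "\<And>s t. s \<in> {0..1} \<Longrightarrow> t \<in> {0..1} \<Longrightarrow> norm (q s - q t) \<le> L * \<bar>s - t\<bar>"
    using lip_pathE[OF assms(1)] by blast
  obtain C where C: "C \<ge> 0" "\<And>s t. s \<in> {0..1} \<Longrightarrow> t \<in> {0..1} \<Longrightarrow> norm (zpow 1 s - zpow 1 t) \<le> C * \<bar>s - t\<bar>"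
    using lip_pathE[OF lip_path_zpow] by blast
  \<comment> \<open>On the support of a weight q varies by at most L \<delta>, hence by at most half
    of e; adding 1 to L keeps the quotient defined for L = 0.\<close>
  define \<delta> where "\<delta> = e / (2 * (L + 1))"
  have \<delta>: "\<delta> > 0" "L * \<delta> \<le> e / 2"
    using assms(3) L(1) by (auto simp: \<delta>_def field_simps)
  obtain N where N: "C / \<delta> < real N" using reals_Archimedean2 by blast
  then have Np: "real N > 0" using C(1) \<delta>(1) by (meson divide_nonneg_pos order_le_less_trans)
  define u where "u j = real j / real N" for j :: nat
  have u: "u j \<in> {0..1}" if "j \<le> N" for j using that Np by (simp add: u_def)
  define \<phi> where "\<phi> j z = max 0 (\<delta> - cmod (z - zpow 1 (u j)))" for j z
  define \<Phi> where "\<Phi> z = (\<Sum>j\<le>N. \<phi> j z)" for z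
  have \<phi>0: "\<phi> j z \<ge> 0" for j z by (simp add: \<phi>_def)
  have \<Phi>: "\<Phi> (zpow 1 t) > 0" if t: "t \<in> {0..1}" for t
  proof -
    define j where "j = nat \<lfloor>real N * t\<rfloor>"
    have jr: "real j \<le> real N * t" "real N * t < real j + 1"
      using t Np by (auto simp: j_def of_nat_nat) 
    have "real N * t \<le> real N" using t Np by (simp add: mult_left_le)
    then have j: "j \<le> N" using jr by linarith
    have "\<bar>t - u j\<bar> \<le> 1 / real N"
      
    proof -
      have "\<bar>real N * t - real j\<bar> \<le> 1" using jr by linarith
      then have "\<bar>real N * (t - u j)\<bar> \<le> 1" using Np by (simp add: u_def right_diff_distrib)
      then have "real N * \<bar>t - u j\<bar> \<le> 1" by (simp only: abs_mult abs_of_nat)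
      then show ?thesis using Np by (simp only: pos_le_divide_eq mult.commute)
    qed
    then have "cmod (zpow 1 t - zpow 1 (u j)) \<le> C * (1 / real N)"
      using C(2)[OF t u[OF j]] C(1) by (meson mult_left_mono order_trans)
    also have "\<dots> < \<delta>" using N Np \<delta>(1) by (simp add: field_simps)
    finally have "\<phi> j (zpow 1 t) > 0" by (simp add: \<phi>_def)
    also have "\<phi> j (zpow 1 t) \<le> \<Phi> (zpow 1 t)"
      unfolding \<Phi>_def using j \<phi>0 by (intro member_le_sum) auto
    finally show ?thesis .
  qed
  have \<Phi>_circle: "\<Phi> z > 0" if "z \<in> sphere 0 1" for z
  proof -
    have "cmod z = 1" using that by simp
    then obtain x where x: "0 \<le> x" "x < 2 * pi" "z = cis x"
    proof -
      have "(Re z)\<^sup>2 + (Im z)\<^sup>2 = 1" using \<open>cmod z = 1\<close> by (simp flip: cmod_power2)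
      then obtain x where "0 \<le> x" "x < 2 * pi" "Re z = cos x" "Im z = sin x"
        using sincos_total_2pi by blast
      then show ?thesis by (intro that[of x]) (auto simp: complex_eq_iff)
    qed
    then have "z = zpow 1 (x / (2 * pi))" by (simp add: zpow_def)
    moreover have "x / (2 * pi) \<in> {0..1}" using x by simp
    ultimately show ?thesis using \<Phi> by simp
  qed
  \<comment> \<open>The total norm of the sample values is M - 1, so errors e / (2 M) in the weights
    cost at most the other half of e. The added 1 makes M positive.\<close>
  define M where "M = 1 + (\<Sum>j\<le>N. norm (q (u j)))"
  have M: "M > 0" unfolding M_def by (intro add_pos_nonneg sum_nonneg) auto
  have "\<exists>g. real_polynomial_function g \<and> (\<forall>z\<in>sphere 0 1. \<bar>\<phi> j z / \<Phi> z - g z\<bar> < e / (2 * M))" for j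
  proof -
    have "continuous_on (sphere 0 1) (\<lambda>z. \<phi> j z / \<Phi> z)"
      unfolding \<Phi>_def \<phi>_def
      by (intro continuous_intros ballI) (use \<Phi>_circle in \<open>fastforce simp: \<Phi>_def \<phi>_def\<close>)
    moreover have "e / (2 * M) > 0" using M assms(3) by simp
    ultimately show ?thesis
      by (rule Stone_Weierstrass_real_polynomial_function[OF compact_sphere]) blast
  qed
  then obtain g where g: "\<And>j. real_polynomial_function (g j)"
    "\<And>j z. z \<in> sphere 0 1 \<Longrightarrow> \<bar>\<phi> j z / \<Phi> z - g j z\<bar> < e / (2 * M)" by metis
  define p where "p t = (\<Sum>j\<le>N. complex_of_real (g j (zpow 1 t)) *\<^sub>C q (u j))" for t
  show thesis
  proof (rule that[of p])
    show "laurent_poly p"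
      unfolding p_def by (intro laurent_poly_sum trig_poly_laurent trig_poly_real_polynomial g)
    fix t :: real assume t: "t \<in> {0..1}"
    define w where "w j = \<phi> j (zpow 1 t) / \<Phi> (zpow 1 t)" for j
    have w0: "w j \<ge> 0" for j unfolding w_def using \<Phi>[OF t] \<phi>0 by (simp add: less_imp_le)
    have w1: "(\<Sum>j\<le>N. w j) = 1"
      using \<Phi>[OF t] unfolding w_def sum_divide_distrib[symmetric] by (simp flip: \<Phi>_def)
    have "p t - q t = (\<Sum>j\<le>N. (g j (zpow 1 t) - w j) *\<^sub>R q (u j)) + (\<Sum>j\<le>N. w j *\<^sub>R (q (u j) - q t))"
      using w1 by (simp add: p_def scaleC_of_real scaleR_diff_left scaleR_diff_right sum_subtractf
          flip: scaleR_sum_left)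
    also have "norm \<dots> \<le> (\<Sum>j\<le>N. e / (2 * M) * norm (q (u j))) + (\<Sum>j\<le>N. w j * (e / 2))"
    proof (intro order_trans[OF norm_triangle_ineq] add_mono sum_norm_le)
      fix j assume j: "j \<in> {..N}"
      have "\<bar>g j (zpow 1 t) - w j\<bar> \<le> e / (2 * M)"
        using g(2)[of "zpow 1 t" j] by (simp add: w_def abs_minus_commute)
      then show "norm ((g j (zpow 1 t) - w j) *\<^sub>R q (u j)) \<le> e / (2 * M) * norm (q (u j))"
        unfolding norm_scaleR by (rule mult_right_mono) simp
      show "norm (w j *\<^sub>R (q (u j) - q t)) \<le> w j * (e / 2)"
      proof (cases "w j = 0")
        case False
        then have "cmod (zpow 1 t - zpow 1 (u j)) < \<delta>"
          by (auto simp: w_def \<phi>_def max_def split: if_splits)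
        then have "norm (q t - q (u j)) \<le> L * \<delta>"
          using norm_loop_chord[OF L(2) assms(2) L(1) t u[of j]] j L(1)
          by (smt (verit, best) atMost_iff mult_left_mono)
        then have "norm (q (u j) - q t) \<le> e / 2" using \<delta>(2) by (simp add: norm_minus_commute)
        then have "w j * norm (q (u j) - q t) \<le> w j * (e / 2)" using w0[of j] by (rule mult_left_mono)
        then show ?thesis using w0[of j] by (simp only: norm_scaleR abs_of_nonneg)
      qed simp
    qed
    also have "(\<Sum>j\<le>N. e / (2 * M) * norm (q (u j))) = e / (2 * M) * (M - 1)"
      by (simp add: M_def sum_distrib_left)
    also have "\<dots> \<le> e / 2" using M assms(3) by (simp add: field_simps)
    also have "(\<Sum>j\<le>N. w j * (e / 2)) = e / 2"
      unfolding sum_distrib_right[symmetric] w1 by simp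
    finally show "norm (p t - q t) \<le> e" by simp
  qed
qed

section \<open>The Euclidean algorithm for loops\<close>

text \<open>The form in which stable rank one enters the Euclidean algorithm: approximation by
  elements with a two-sided inverse, so that leading coefficients can be divided by.\<close>

definition dense_invertibles :: "'a :: unital_cstar_algebra itself \<Rightarrow> bool" where
  "dense_invertibles _ \<longleftrightarrow> (\<forall>(a :: 'a) e. e > 0 \<longrightarrow> (\<exists>b c. norm (a - b) < e \<and> b * c = 1 \<and> c * b = 1))"

lemma near_one_invertible:
  fixes w :: "'a :: unital_cstar_algebra"
  assumes "norm (w - 1) \<le> 1/8"
  obtains v where "w * v = 1" "v * w = 1"
proof -
  obtain y where y: "exp y = w" using alg.log_exists[OF _ assms] by auto
  show thesis
    using that[of "exp (- y)"] exp_minus_inverse[of y] exp_minus_inverse[of "- y"] by (simp add: y)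
qed

text \<open>Direct finiteness. An invertible b near x makes b y invertible, being near 1, with
  inverse v. Then v b is a right inverse of y, and it must be x.\<close>

lemma left_inverse_commutes:
  fixes x y :: "'a :: unital_cstar_algebra"
  assumes "dense_invertibles TYPE('a)" "x * y = 1"
  shows "y * x = 1"
proof -
  have "1 / (8 * (norm y + 1)) > 0" by (simp add: add_nonneg_pos)
  then obtain b c where bc: "norm (x - b) < 1 / (8 * (norm y + 1))" "b * c = 1" "c * b = 1"
    using assms(1) unfolding dense_invertibles_def by blast
  have "norm (b * y - 1) = norm ((x - b) * y)"
    by (simp add: left_diff_distrib assms(2) norm_minus_commute)
  also have "\<dots> \<le> 1 / (8 * (norm y + 1)) * (norm y + 1)"
    using bc(1) by (intro order_trans[OF norm_mult_ineq] mult_mono) auto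
  also have "\<dots> = 1/8" by (simp add: add_nonneg_pos less_imp_neq[symmetric])
  finally obtain v where v: "b * y * v = 1" "v * (b * y) = 1" using near_one_invertible[of "b * y"] by blast
  have "y * v * b = 1"
  proof -
    have "c * (b * y * v) * b = 1" using v bc by simp
    then show ?thesis using bc(3) by (simp flip: mult.assoc)
  qed
  then have "x = v * b" using assms(2) by (metis mult.assoc mult.left_neutral mult.right_neutral)
  then show ?thesis using \<open>y * v * b = 1\<close> by (simp add: mult.assoc)
qed

lemma entry_mat_unit_mult:
  assumes "y - 1 \<in> corners n" "i < n" "j < n" "p < n" "q < n"
  shows "entry p q (mat_unit n i j a * y) = (if p = i then a * entry j q y else 0)"
    "entry p q (y * mat_unit n i j a) = (if q = j then entry p i y * a else 0)"
proof -
  define z where "z = y - 1"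
  have y: "y = z + 1" by (simp add: z_def)
  have zK: "z \<in> corners n" using assms(1) by (simp add: z_def)
  have "entry p q (mat_unit n i j a * z) = (\<Sum>k<n. entry p k (mat_unit n i j a) * entry k q z)"
    by (rule entry_mult_corners) (use assms zK in auto)
  also have "\<dots> = (\<Sum>k<n. if k = j then (if p = i then a * entry j q z else 0) else 0)"
    by (intro sum.cong refl) (auto simp: entry_mat_unit assms)
  finally have "entry p q (mat_unit n i j a * z + mat_unit n i j a)
      = (if p = i then a * entry j q y else 0)"
    using assms by (auto simp: entry_add entry_mat_unit entry_one y distrib_left)
  then show "entry p q (mat_unit n i j a * y) = (if p = i then a * entry j q y else 0)"
    by (simp add: y distrib_left)
  have "entry p q (z * mat_unit n i j a) = (\<Sum>k<n. entry p k z * entry k q (mat_unit n i j a))"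
    by (rule entry_mult_corners) (use assms zK in auto)
  also have "\<dots> = (\<Sum>k<n. if k = i then (if q = j then entry p i z * a else 0) else 0)"
    by (intro sum.cong refl) (auto simp: entry_mat_unit assms)
  finally have "entry p q (z * mat_unit n i j a + mat_unit n i j a)
      = (if q = j then entry p i y * a else 0)"
    using assms by (auto simp: entry_add entry_mat_unit entry_one y distrib_right)
  then show "entry p q (y * mat_unit n i j a) = (if q = j then entry p i y * a else 0)"
    by (simp add: y distrib_right)
qed

text \<open>Modulo commutators the determinant of g is asymptotically that of a loop of invertible
  elements of the algebra. Only this outcome is recorded, so the reduction steps can be
  chained.\<close>

definition reducible :: "nat \<Rightarrow> (real \<Rightarrow> 'a :: unital_cstar_algebra seq_op) \<Rightarrow> (real \<Rightarrow> 'a seq_op) \<Rightarrow> bool" where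
  "reducible n g gi \<longleftrightarrow> (\<exists>k ki. alg.inv_path k ki \<and> k 0 = k 1 \<and>
     null_mod (\<lambda>m. tr.det_sum n g gi m - alg.det_sum k ki m))"

lemma reducible_cong:
  assumes "reducible n h hi" "null_mod (\<lambda>m. tr.det_sum n' g gi m - tr.det_sum n h hi m)"
  shows "reducible n' g gi"
proof -
  obtain k ki where k: "alg.inv_path k ki" "k 0 = k 1"
    "null_mod (\<lambda>m. tr.det_sum n h hi m - alg.det_sum k ki m)"
    using assms(1) by (auto simp: reducible_def)
  from null_mod_add[OF assms(2) k(3)] show ?thesis
    unfolding reducible_def using k(1,2) by (intro exI[of _ k] exI[of _ ki]) simp
qed

lemma elementary_path:
  assumes "lip_path q" "i < n" "j < n" "i \<noteq> j"
  shows "tr.inv_path n (\<lambda>t. 1 + mat_unit n i j (q t)) (\<lambda>t. 1 - mat_unit n i j (q t))"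
    "tr.det_sum n (\<lambda>t. 1 + mat_unit n i j (q t)) (\<lambda>t. 1 - mat_unit n i j (q t)) m = 0"
proof -
  have z: "mat_unit n i j a * mat_unit n i j b = 0" for a b :: 'a
    using assms by (simp add: mat_unit_mult)
  have "lip_path (\<lambda>t. mat_unit n i j (q t))"
    by (rule lip_path_bounded_linear[OF bounded_linear_mat_unit assms(1)])
  then show "tr.inv_path n (\<lambda>t. 1 + mat_unit n i j (q t)) (\<lambda>t. 1 - mat_unit n i j (q t))"
    unfolding tr.inv_path_def
    by (auto intro!: lip_path_add lip_path_diff cor.K_neg simp: algebra_simps z)
  have "trace n ((1 + mat_unit n i j a) * (1 - mat_unit n i j b) - 1) = 0" for a b :: 'a
  proof -
    have "(1 + mat_unit n i j a) * (1 - mat_unit n i j b) - 1 = mat_unit n i j (a - b)"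
      by (simp add: algebra_simps z mat_unit_diff)
    then show ?thesis using assms by (auto simp: trace_def entry_mat_unit intro!: sum.neutral)
  qed
  then show "tr.det_sum n (\<lambda>t. 1 + mat_unit n i j (q t)) (\<lambda>t. 1 - mat_unit n i j (q t)) m = 0"
    by (simp add: tr.det_sum_def)
qed

lemma reducible_row_operation:
  assumes "tr.inv_path n g gi" "lip_path q" "i < n" "j < n" "i \<noteq> j"
    and "reducible n (\<lambda>t. (1 + mat_unit n i j (q t)) * g t) (\<lambda>t. gi t * (1 - mat_unit n i j (q t)))"
  shows "reducible n g gi"
  using assms(6)
proof (rule reducible_cong)
  note e = elementary_path[OF assms(2-5)]
  from null_mod_minus[OF tr.det_sum_mult[OF e(1) assms(1)]]
  show "null_mod (\<lambda>m. tr.det_sum n g gi m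
      - tr.det_sum n (\<lambda>t. (1 + mat_unit n i j (q t)) * g t) (\<lambda>t. gi t * (1 - mat_unit n i j (q t))) m)"
    by (simp add: e(2))
qed

lemma row_operation_path:
  assumes "tr.inv_path n g gi" "lip_path q" "i < n" "j < n" "i \<noteq> j"
  shows "tr.inv_path n (\<lambda>t. (1 + mat_unit n i j (q t)) * g t) (\<lambda>t. gi t * (1 - mat_unit n i j (q t)))"
    "t \<in> {0..1} \<Longrightarrow> a < n \<Longrightarrow> b < n \<Longrightarrow> entry a b ((1 + mat_unit n i j (q t)) * g t)
      = entry a b (g t) + (if a = i then q t * entry j b (g t) else 0)"
proof -
  show "tr.inv_path n (\<lambda>t. (1 + mat_unit n i j (q t)) * g t) (\<lambda>t. gi t * (1 - mat_unit n i j (q t)))"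
    by (rule tr.inv_path_mult[OF elementary_path(1)[OF assms(2-5)] assms(1)])
  assume "t \<in> {0..1}" "a < n" "b < n"
  then show "entry a b ((1 + mat_unit n i j (q t)) * g t)
      = entry a b (g t) + (if a = i then q t * entry j b (g t) else 0)"
    using assms tr.inv_pathD(3)[OF assms(1)]
    by (simp add: distrib_right entry_add entry_mat_unit_mult(1))
qed

lemma corners_sandwich:
  assumes "x \<in> corners n" "y \<in> corners (Suc n)"
  shows "x * y * x \<in> corners n"
proof -
  define P :: "'a seq_op" where "P = corner n (\<lambda>i j. if i = j then 1 else 0)"
  have PK: "P \<in> corners n" by (simp add: P_def)
  have P: "P * z = z" "z * P = z" if "z \<in> corners n" for z
    by (rule corners_eqI[of _ n]; use that PK in \<open>simp add: corners_mult entry_mult_corners[of _ n] P_def entry_corner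
        if_distrib[of "\<lambda>x. x * _"] if_distrib[of "\<lambda>x. _ * x"] cong: if_cong\<close>)+
  have "x * y * x \<in> corners (Suc n)"
    using assms corners_mono[of n "Suc n"] by (auto intro!: corners_mult)
  then obtain f where f: "x * y * x = corner (Suc n) f" by (auto simp: corners_def)
  have P': "P = corner (Suc n) (\<lambda>i j. if i = j \<and> i < n then 1 else 0)"
    unfolding P_def by (subst corner_mono[of n "Suc n"]) (auto intro!: corner_cong)
  have "x * y * x = P * (x * y * x) * P"
    using P[OF assms(1)] by (simp add: mult.assoc) (simp flip: mult.assoc)
  also have "\<dots> = corner (Suc n) (\<lambda>i j. if i < n \<and> j < n then f i j else 0)"
    unfolding f P' corner_mult
    by (rule corner_cong) (auto simp: if_distrib[of "\<lambda>x. x * _"] if_distrib[of "\<lambda>x. _ * x"]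
        sum.If_cases cong: if_cong)
  also have "\<dots> = corner n f" by (rule corner_mono[symmetric]) simp
  finally show ?thesis by simp
qed

text \<open>If 1 + y inverts 1 + x, then y = - x + x^2 + x y x. The last term is sandwiched between
  elements of the smaller block, so the inverse stays in that block.\<close>

lemma inv_path_corner:
  assumes "tr.inv_path (Suc n) g gi" "\<And>t. t \<in> {0..1} \<Longrightarrow> g t - 1 \<in> corners n"
  shows "tr.inv_path n g gi"
proof -
  note g = tr.inv_pathD[OF assms(1)]
  have "gi t - 1 \<in> corners n" if t: "t \<in> {0..1}" for t
  proof -
    define x where "x = g t - 1"
    define y where "y = gi t - 1"
    have "(1 + x) * (1 + y) = 1" "(1 + y) * (1 + x) = 1" using g(5,6)[OF t] by (simp_all add: x_def y_def)
    then have xy: "y = - x - x * y" "y = - x - y * x"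
      by (simp_all add: distrib_left distrib_right add_eq_0_iff algebra_simps)
    have a: "x * y = - (x * x) - x * (y * x)"
      using arg_cong[OF xy(2), of "(*) x"] by (simp add: right_diff_distrib mult.assoc)
    have "- x - x * y = - x - (- (x * x) - x * (y * x))" by (simp only: a)
    also have "\<dots> = - x + x * x + x * y * x" by (simp add: mult.assoc)
    finally have "- x - x * y = - x + x * x + x * y * x" .
    with xy(1) have "y = - x + x * x + x * y * x" by (rule trans)
    moreover have "x \<in> corners n" using assms(2)[OF t] by (simp add: x_def)
    moreover have "y \<in> corners (Suc n)" using g(4)[OF t] by (simp add: y_def)
    ultimately show ?thesis
      unfolding y_def[symmetric]
      using cor.K_add[OF cor.K_add[OF cor.K_neg[of x n] corners_mult[of x n x]] corners_sandwich[of x n y]]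
      by simp
  qed
  then show ?thesis using assms by (simp add: tr.inv_path_def)
qed

lemma trace_Suc_corners: "x \<in> corners n \<Longrightarrow> trace (Suc n) x = trace n x"
  by (simp add: trace_def entry_corners_zero)

lemma det_sum_corner:
  assumes "tr.inv_path n g gi" "m > 0"
  shows "tr.det_sum (Suc n) g gi m = tr.det_sum n g gi m"
  unfolding tr.det_sum_def
proof (intro sum.cong refl trace_Suc_corners)
  fix j assume "j \<in> {..<m}"
  then show "g ((real j + 1) / real m) * gi (real j / real m) - 1 \<in> corners n"
    using grid_points[OF assms(2), of j] tr.inv_pathD[OF assms(1)] by (intro cor.mult_aff) auto
qed

lemma diagonal_path:
  assumes "alg.inv_path k ki" "i < n"
  shows "tr.inv_path n (\<lambda>t. 1 + mat_unit n i i (k t - 1)) (\<lambda>t. 1 + mat_unit n i i (ki t - 1))"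
    "tr.det_sum n (\<lambda>t. 1 + mat_unit n i i (k t - 1)) (\<lambda>t. 1 + mat_unit n i i (ki t - 1)) m = alg.det_sum k ki m"
proof -
  note k = alg.inv_pathD[OF assms(1)]
  have mult: "(1 + mat_unit n i i (a - 1)) * (1 + mat_unit n i i (b - 1)) = 1 + mat_unit n i i (a * b - 1)"
    for a b :: 'a
  proof -
    have "a * b - 1 = (a - 1) + (b - 1) + (a - 1) * (b - 1)" by (simp add: algebra_simps)
    then show ?thesis using assms(2) by (simp only: mat_unit_add) (simp add: distrib_left distrib_right mat_unit_mult)
  qed
  show "tr.inv_path n (\<lambda>t. 1 + mat_unit n i i (k t - 1)) (\<lambda>t. 1 + mat_unit n i i (ki t - 1))"
    unfolding tr.inv_path_def
    using k by (auto intro!: lip_path_add lip_path_bounded_linear[OF bounded_linear_mat_unit] lip_path_diff simp: mult)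
  show "tr.det_sum n (\<lambda>t. 1 + mat_unit n i i (k t - 1)) (\<lambda>t. 1 + mat_unit n i i (ki t - 1)) m = alg.det_sum k ki m"
    unfolding tr.det_sum_def alg.det_sum_def mult
    using assms(2) by (intro sum.cong refl) (simp add: trace_def entry_mat_unit)
qed

text \<open>The last column is (0, ..., 0, k). The inverse matrix gives ki k = 1, and direct
  finiteness makes k invertible. Multiplication by 1 - v clears the rest of the last row, a diagonal
  factor turns k into 1, and the n by n block is left to \<open>IH\<close>. The loop k multiplies
  the one found there.\<close>

lemma reducible_split:
  assumes dense: "dense_invertibles TYPE('a :: unital_cstar_algebra)"
    and g: "tr.inv_path (Suc n) g (gi :: real \<Rightarrow> 'a seq_op)"
    and entries: "\<And>i j. i \<le> n \<Longrightarrow> j \<le> n \<Longrightarrow> \<exists>l. laurent d l (\<lambda>t. entry i j (g t))"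
    and col: "\<And>i t. i < n \<Longrightarrow> t \<in> {0..1} \<Longrightarrow> entry i n (g t) = 0"
    and IH: "\<And>h (hi :: real \<Rightarrow> 'a seq_op). tr.inv_path n h hi \<Longrightarrow>
      (\<And>i j. i < n \<Longrightarrow> j < n \<Longrightarrow> \<exists>l. laurent d l (\<lambda>t. entry i j (h t))) \<Longrightarrow> reducible n h hi"
  shows "reducible (Suc n) g gi"
proof -
  note gD = tr.inv_pathD[OF g]
  let ?N = "Suc n"
  define k where "k t = entry n n (g t)" for t
  define ki where "ki t = entry n n (gi t)" for t
  have kk: "ki t * k t = 1" if t: "t \<in> {0..1}" for t
  proof -
    have "entry n n (gi t * g t) = (\<Sum>j<?N. entry n j (gi t) * entry j n (g t))"
      by (rule entry_aff_mult) (use gD(3,4)[OF t] in auto)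
    then show ?thesis using gD(6)[OF t] col[OF _ t] by (simp add: k_def ki_def entry_one)
  qed
  have lips: "lip_path k" "lip_path ki"
    unfolding k_def ki_def by (intro lip_path_bounded_linear[OF bounded_linear_entry] gD)+
  have pk: "alg.inv_path k ki"
    unfolding alg.inv_path_def using lips kk left_inverse_commutes[OF dense kk] by simp
  have k01: "k 0 = k 1"
  proof -
    obtain l where "laurent d l (\<lambda>t. entry n n (g t))" using entries[of n n] by blast
    from laurent_loop[OF this] show ?thesis by (simp add: k_def)
  qed
  define v where "v t = (\<Sum>j<n. mat_unit ?N n j (ki t * entry n j (g t)))" for t
  have vv: "v s * v t = 0" for s t
    unfolding v_def sum_distrib_left sum_distrib_right
    by (intro sum.neutral ballI) (simp add: mat_unit_mult)
  have vK: "v t \<in> corners ?N" for t unfolding v_def by (intro cor.K_sum) simp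
  have lip_v: "lip_path v" unfolding v_def
    by (intro lip_path_sum lip_path_bounded_linear[OF bounded_linear_mat_unit] lip_path_mult lips
        lip_path_bounded_linear[OF bounded_linear_entry] gD)
  have pv: "tr.inv_path ?N (\<lambda>t. 1 - v t) (\<lambda>t. 1 + v t)"
    unfolding tr.inv_path_def using lip_v vK
    by (auto intro!: lip_path_add lip_path_diff cor.K_neg simp: algebra_simps vv)
  have entry_v: "entry a b (v t) = (if a = n \<and> b < n then ki t * entry n b (g t) else 0)" if "a \<le> n" "b \<le> n" for a b t
  proof -
    have "entry a b (v t) = (\<Sum>j<n. if j = b then (if a = n then ki t * entry n j (g t) else 0) else 0)"
      unfolding v_def entry_sum by (intro sum.cong refl) (auto simp: entry_mat_unit)
    then show ?thesis by auto
  qed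
  have det_v: "tr.det_sum ?N (\<lambda>t. 1 - v t) (\<lambda>t. 1 + v t) m = 0" for m
  proof -
    have "(1 - v s) * (1 + v t) - 1 = v t - v s" for s t by (simp add: algebra_simps vv)
    moreover have "trace ?N (v t - v s) = 0" for s t
      by (simp add: trace_def entry_diff entry_v)
    ultimately show ?thesis by (simp add: tr.det_sum_def)
  qed
  note pD = diagonal_path[OF pk, of n ?N]
  define h where "h t = g t * (1 - v t) * (1 + mat_unit ?N n n (ki t - 1))" for t
  define hi where "hi t = (1 + mat_unit ?N n n (k t - 1)) * ((1 + v t) * gi t)" for t
  have pgv: "tr.inv_path ?N (\<lambda>t. g t * (1 - v t)) (\<lambda>t. (1 + v t) * gi t)"
    by (rule tr.inv_path_mult[OF g pv])
  have ph: "tr.inv_path ?N h hi"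
    unfolding h_def hi_def
    by (rule tr.inv_path_mult[OF pgv tr.inv_path_swap[OF pD(1)]]) simp
  have gv: "entry a b (g t * (1 - v t)) = (if b = n then entry a n (g t) else if a < n then entry a b (g t) else 0)"
    if "a \<le> n" "b \<le> n" and t: "t \<in> {0..1}" for a b t
  proof -
    have "entry a b (g t * (1 - v t)) = (\<Sum>c<?N. entry a c (g t) * entry c b (1 - v t))"
      by (rule entry_aff_mult) (use gD(3)[OF t] vK[of t] that in \<open>auto intro: cor.K_neg\<close>)
    also have "\<dots> = (\<Sum>c<?N. if c = b then entry a b (g t) else 0) - (\<Sum>c<?N. if c = n then entry a n (g t) * entry n b (v t) else 0)"
      unfolding sum_subtractf[symmetric] using that
      by (intro sum.cong refl) (auto simp: entry_diff entry_one entry_v right_diff_distrib)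
    also have "\<dots> = entry a b (g t) - entry a n (g t) * entry n b (v t)"
      using that by simp
    finally show ?thesis
      using that col[of a t] alg.inv_pathD(5)[OF pk t]
      by (auto simp: entry_v k_def le_less simp flip: mult.assoc)
  qed
  have h_entry: "entry a b (h t) = (if a < n \<and> b < n then entry a b (g t) else if a = b then 1 else 0)"
    if "a \<le> n" "b \<le> n" and t: "t \<in> {0..1}" for a b t
  proof -
    have "entry a b (h t) = entry a b (g t * (1 - v t)) + entry a b (g t * (1 - v t) * mat_unit ?N n n (ki t - 1))"
      by (simp add: h_def distrib_left entry_add)
    also have "entry a b (g t * (1 - v t) * mat_unit ?N n n (ki t - 1))
       = (if b = n then entry a n (g t * (1 - v t)) * (ki t - 1) else 0)"
      by (rule entry_mat_unit_mult(2)) (use that tr.inv_pathD(3)[OF pgv t] in auto)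
    finally show ?thesis
      using that gv[OF that] gv[of a n t] col[of a t] alg.inv_pathD(5)[OF pk t]
      by (auto simp: k_def le_less right_diff_distrib)
  qed
  have "h t - 1 \<in> corners n" if t: "t \<in> {0..1}" for t
  proof -
    have "h t - 1 = corner n (\<lambda>a b. entry a b (g t) - (if a = b then 1 else 0))"
    proof (rule corners_eqI[of _ ?N])
      show "h t - 1 \<in> corners ?N" by (rule tr.inv_pathD(3)[OF ph t])
      show "corner n (\<lambda>a b. entry a b (g t) - (if a = b then 1 else 0)) \<in> corners ?N"
        using corners_mono[of n ?N] by auto
      fix a b assume "a < ?N" "b < ?N"
      then have "a \<le> n" "b \<le> n" by auto
      then show "entry a b (h t - 1) = entry a b (corner n (\<lambda>a b. entry a b (g t) - (if a = b then 1 else 0)))"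
        by (simp add: entry_diff entry_one entry_corner h_entry[OF _ _ t])
    qed
    then show ?thesis by simp
  qed
  then have ph': "tr.inv_path n h hi" by (rule inv_path_corner[OF ph])
  have "reducible n h hi"
  proof (rule IH[OF ph'])
    fix i j assume ij: "i < n" "j < n"
    then obtain l where "laurent d l (\<lambda>t. entry i j (g t))" using entries[of i j] by auto
    then have "laurent d l (\<lambda>t. entry i j (h t))"
    proof (rule laurent_cong)
      show "entry i j (g t) = entry i j (h t)" if t: "t \<in> {0..1}" for t
        using h_entry[OF _ _ t, of i j] ij by simp
    qed
    then show "\<exists>l. laurent d l (\<lambda>t. entry i j (h t))" ..
  qed
  then obtain k' ki' where k': "alg.inv_path k' ki'" "k' 0 = k' 1"
    "null_mod (\<lambda>m. tr.det_sum n h hi m - alg.det_sum k' ki' m)"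
    by (auto simp: reducible_def)
  have 1: "null_mod (\<lambda>m. tr.det_sum ?N h hi m - alg.det_sum k' ki' m)"
    by (rule null_mod_cong[OF k'(3)]) (simp add: det_sum_corner[OF ph'])
  have 2: "null_mod (\<lambda>m. tr.det_sum ?N (\<lambda>t. g t * (1 - v t)) (\<lambda>t. (1 + v t) * gi t) m - tr.det_sum ?N g gi m)"
    using tr.det_sum_mult[OF g pv] by (simp add: det_v)
  have 3: "null_mod (\<lambda>m. tr.det_sum ?N h hi m - (tr.det_sum ?N (\<lambda>t. g t * (1 - v t)) (\<lambda>t. (1 + v t) * gi t) m
      + alg.det_sum ki k m))"
    using tr.det_sum_mult[OF pgv tr.inv_path_swap[OF pD(1)]]
      diagonal_path(2)[OF alg.inv_path_swap[OF pk], of n ?N]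
    by (simp add: h_def[abs_def] hi_def[abs_def])
  have 4: "null_mod (\<lambda>m. alg.det_sum ki k m + alg.det_sum k ki m)"
    by (rule alg.det_sum_inverse[OF pk])
  have 5: "null_mod (\<lambda>m. alg.det_sum (\<lambda>t. k t * k' t) (\<lambda>t. ki' t * ki t) m - (alg.det_sum k ki m + alg.det_sum k' ki' m))"
    by (rule alg.det_sum_mult[OF pk k'(1)])
  from null_mod_diff[OF null_mod_diff[OF null_mod_diff[OF null_mod_diff[OF 1 4] 3] 2] 5]
  have "null_mod (\<lambda>m. tr.det_sum ?N g gi m - alg.det_sum (\<lambda>t. k t * k' t) (\<lambda>t. ki' t * ki t) m)"
    by (rule null_mod_cong) (simp add: algebra_simps)
  moreover have "alg.inv_path (\<lambda>t. k t * k' t) (\<lambda>t. ki' t * ki t)"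
    by (rule alg.inv_path_mult[OF pk k'(1)])
  ultimately show ?thesis
    unfolding reducible_def using k01 k'(2)
    by (intro exI[of _ "\<lambda>t. k t * k' t"] exI[of _ "\<lambda>t. ki' t * ki t"]) simp
qed

text \<open>A nearby invertible b replaces the leading coefficient. Any r of at least the same
  length can then be shortened by one: a shifted left multiple of q cancels its leading term. Left
  multiples are what row operations provide.\<close>

lemma laurent_perturb_leading:
  fixes p :: "real \<Rightarrow> 'a :: unital_cstar_algebra"
  assumes "dense_invertibles TYPE('a)" "laurent d (Suc l) p" "e > 0"
  obtains q where "laurent d (Suc l) q" "\<And>t. t \<in> {0..1} \<Longrightarrow> norm (q t - p t) \<le> e"
    "\<And>l' (r :: real \<Rightarrow> 'a). l \<le> l' \<Longrightarrow> laurent d (Suc l') r \<Longrightarrow>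
        \<exists>b. laurent d l' (\<lambda>t. r t + zpow (int (l' - l)) t *\<^sub>C (b * q t))"
proof -
  obtain a where a: "\<And>t. t \<in> {0..1} \<Longrightarrow> p t = (\<Sum>k<Suc l. zpow (int k - int d) t *\<^sub>C a k)"
    using laurentE[OF assms(2)] by blast
  obtain b c where bc: "norm (a l - b) < e" "b * c = 1" "c * b = 1"
    using assms(1,3) unfolding dense_invertibles_def by blast
  define q where "q t = (\<Sum>k<l. zpow (int k - int d) t *\<^sub>C a k) + zpow (int l - int d) t *\<^sub>C b" for t
  show thesis
  proof (rule that[of q])
    show "laurent d (Suc l) q"
      by (rule laurentI[where a = "\<lambda>k. if k < l then a k else b"]) (simp add: q_def)
    show "norm (q t - p t) \<le> e" if "t \<in> {0..1}" for t
    proof -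
      have "q t - p t = zpow (int l - int d) t *\<^sub>C (b - a l)"
        using a[OF that] by (simp add: q_def scaleC_diff_right)
      then show ?thesis using bc(1) by (simp add: norm_scaleC norm_minus_commute)
    qed
    fix l' and r :: "real \<Rightarrow> 'a" assume l': "l \<le> l'" and "laurent d (Suc l') r"
    then obtain f where f: "\<And>t. t \<in> {0..1} \<Longrightarrow> r t = (\<Sum>k<Suc l'. zpow (int k - int d) t *\<^sub>C f k)"
      using laurentE by blast
    define e where "e = l' - l"
    have le: "l' = l + e" using l' by (simp add: e_def)
    define b' where "b' = - (f l' * c)"
    have shift: "int e + (int k - int d) = int (k + e) - int d" for k by simp
    have b'b: "b' * b = - f l'" using bc(3) by (simp add: b'_def mult.assoc)
    show "\<exists>b. laurent d l' (\<lambda>t. r t + zpow (int (l' - l)) t *\<^sub>C (b * q t))"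
    proof (intro exI[of _ b'] laurentI[where a = "\<lambda>k. f k + (if k < e then 0 else b' * a (k - e))"])
      fix t :: real assume t: "t \<in> {0..1}"
      have "zpow (int e) t *\<^sub>C (b' * q t)
          = (\<Sum>k<l. zpow (int (k + e) - int d) t *\<^sub>C (b' * a k)) + zpow (int l' - int d) t *\<^sub>C (b' * b)"
        by (simp add: q_def distrib_left sum_distrib_left mult_scaleC_right scaleC_add_right
            scaleC_sum_right scaleC_scaleC zpow_mult shift le del: of_nat_add)
      also have "(\<Sum>k<l. zpow (int (k + e) - int d) t *\<^sub>C (b' * a k))
          = (\<Sum>k<l'. zpow (int k - int d) t *\<^sub>C (if k < e then 0 else b' * a (k - e)))"
        unfolding le sum_lessThan_add_split by (simp del: of_nat_add)
      finally show "r t + zpow (int (l' - l)) t *\<^sub>C (b' * q t)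
          = (\<Sum>k<l'. zpow (int k - int d) t *\<^sub>C (f k + (if k < e then 0 else b' * a (k - e))))"
        unfolding e_def[symmetric] f[OF t]
        by (simp add: b'b scaleC_add_right sum.distrib scaleC_minus_right)
    qed
  qed
qed

text \<open>The premise \<open>red\<close> ranges over all inverse paths because the inverse of the
  perturbed path is only produced by \<open>det_sum_perturb\<close>.\<close>

lemma reducible_perturb_entry:
  assumes g: "tr.inv_path n g gi" "g 0 = g 1" and ij: "i < n" "j < n"
    and q: "lip_path q" "q 0 = q 1"
    and near: "\<And>t. t \<in> {0..1} \<Longrightarrow> norm (q t - entry i j (g t)) * norm (gi t) \<le> 1/8"
    and red: "\<And>hi. tr.inv_path n (\<lambda>t. g t + mat_unit n i j (q t - entry i j (g t))) hi \<Longrightarrow>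
      reducible n (\<lambda>t. g t + mat_unit n i j (q t - entry i j (g t))) hi"
  shows "reducible n g gi"
proof -
  note gD = tr.inv_pathD[OF g(1)]
  define h where "h t = g t + mat_unit n i j (q t - entry i j (g t))" for t
  have lip: "lip_path h"
    unfolding h_def by (intro lip_path_add lip_path_bounded_linear[OF bounded_linear_mat_unit]
        lip_path_diff lip_path_bounded_linear[OF bounded_linear_entry] gD q)
  have "h t - 1 \<in> corners n" if "t \<in> {0..1}" for t
    using cor.K_add[OF gD(3)[OF that] mat_unit_in_corners] by (simp add: h_def algebra_simps)
  moreover have "h 0 = h 1" by (simp add: h_def g(2) q(2))
  moreover have "norm ((h t - g t) * gi t) \<le> 1/8" if "t \<in> {0..1}" for t
  proof -
    have "norm (mat_unit n i j (q t - entry i j (g t))) \<le> norm (q t - entry i j (g t))"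
    proof -
      have "(\<Sum>k<n. \<Sum>l<n. norm (if k = i \<and> l = j then q t - entry i j (g t) else 0))
          = (\<Sum>k<n. if k = i then norm (q t - entry i j (g t)) else 0)"
        using ij by (intro sum.cong refl) (simp add: if_distrib cong: if_cong)
      also have "\<dots> = norm (q t - entry i j (g t))" using ij by simp
      finally show ?thesis
        unfolding mat_unit_def by (rule order_trans[OF norm_corner_le eq_refl])
    qed
    then have "norm (mat_unit n i j (q t - entry i j (g t)) * gi t) \<le> norm (q t - entry i j (g t)) * norm (gi t)"
      by (intro order_trans[OF norm_mult_ineq] mult_right_mono) auto
    then show ?thesis using near[OF that] by (simp add: h_def)
  qed
  ultimately obtain hi where hi: "tr.inv_path n h hi" "null_mod (\<lambda>m. tr.det_sum n h hi m - tr.det_sum n g gi m)"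
    using tr.det_sum_perturb[OF g lip] by blast
  have "reducible n h hi" using red[of hi] hi(1) by (simp add: h_def[abs_def])
  then show ?thesis
    by (rule reducible_cong) (use null_mod_minus[OF hi(2)] in simp)
qed

lemma laurent_entries_loop:
  assumes "tr.inv_path n g gi" "\<And>i j. i < n \<Longrightarrow> j < n \<Longrightarrow> \<exists>l. laurent d l (\<lambda>t. entry i j (g t))"
  shows "g 0 = g 1"
proof -
  have "g 0 - 1 = g 1 - 1"
  proof (rule corners_eqI)
    show "g 0 - 1 \<in> corners n" "g 1 - 1 \<in> corners n" using tr.inv_pathD(3)[OF assms(1)] by auto
    fix i j assume "i < n" "j < n"
    with assms(2) obtain l where "laurent d l (\<lambda>t. entry i j (g t))" by blast
    from laurent_loop[OF this] show "entry i j (g 0 - 1) = entry i j (g 1 - 1)" by (simp add: entry_diff)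
  qed
  then show ?thesis by simp
qed

lemma laurent_add_mult:
  assumes "\<exists>l. laurent d l p" "\<exists>l. laurent d l q"
  shows "\<exists>l. laurent d l (\<lambda>t. p t + zpow (int e) t *\<^sub>C (b * q t))"
proof -
  obtain l m where "laurent d l p" "laurent d m q" using assms by blast
  from laurent_add[OF this(1) laurent_mult[OF this(2)]] show ?thesis by blast
qed

text \<open>Induction on the total length of the last column: either the leading coefficient of one entry
  is made invertible by a small perturbation and used to cancel the leading term of another entry, or
  only one entry is left and the column splits off.\<close>

lemma reducible_column:
  fixes g gi :: "real \<Rightarrow> 'a :: unital_cstar_algebra seq_op"
  assumes dense: "dense_invertibles TYPE('a)"
    and IH: "\<And>h (hi :: real \<Rightarrow> 'a seq_op). tr.inv_path n h hi \<Longrightarrow>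
      (\<And>i j. i < n \<Longrightarrow> j < n \<Longrightarrow> \<exists>l. laurent d l (\<lambda>t. entry i j (h t))) \<Longrightarrow> reducible n h hi"
    and "tr.inv_path (Suc n) g gi"
    and "\<And>i j. i < Suc n \<Longrightarrow> j < Suc n \<Longrightarrow> \<exists>l. laurent d l (\<lambda>t. entry i j (g t))"
    and "\<And>i. i < Suc n \<Longrightarrow> laurent d (ls i) (\<lambda>t. entry i n (g t))"
  shows "reducible (Suc n) g gi"
  using assms(3-)
proof (induction "\<Sum>i<Suc n. ls i" arbitrary: g gi ls rule: less_induct)
  case less
  let ?N = "Suc n"
  note g = less.prems(1) and entries = less.prems(2) and col = less.prems(3)
  note gD = tr.inv_pathD[OF g]
  show ?case
  proof (cases "\<exists>i j. i < ?N \<and> j < ?N \<and> i \<noteq> j \<and> 0 < ls j \<and> ls j \<le> ls i")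
    case True
    \<comment> \<open>Row j holds the pivot: its entry in the column has positive length and is no
      longer than that of row i, whose length drops by one.\<close>
    then obtain i j where ij: "i < ?N" "j < ?N" "i \<noteq> j" "0 < ls j" "ls j \<le> ls i" by blast
    then obtain l l' where l: "ls j = Suc l" "ls i = Suc l'" "l \<le> l'" by (cases "ls j"; cases "ls i") auto
    obtain M where M: "M > 0" "\<And>t. t \<in> {0..1} \<Longrightarrow> norm (gi t) \<le> M" using lip_path_bounded[OF gD(2)] by blast
    have lj: "laurent d (Suc l) (\<lambda>t. entry j n (g t))" using col[OF ij(2)] l by simp
    have li: "laurent d (Suc l') (\<lambda>t. entry i n (g t))" using col[OF ij(1)] l by simp
    have e: "1 / (8 * M) > 0" using M by simp
    obtain q where q: "laurent d (Suc l) q" "\<And>t. t \<in> {0..1} \<Longrightarrow> norm (q t - entry j n (g t)) \<le> 1 / (8 * M)"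
      "\<And>l' (r :: real \<Rightarrow> 'a). l \<le> l' \<Longrightarrow> laurent d (Suc l') r \<Longrightarrow> \<exists>b. laurent d l' (\<lambda>t. r t + zpow (int (l' - l)) t *\<^sub>C (b * q t))"
      using laurent_perturb_leading[OF dense lj e] by blast
    obtain b where b: "laurent d l' (\<lambda>t. entry i n (g t) + zpow (int (l' - l)) t *\<^sub>C (b * q t))"
      using q(3)[OF l(3) li] by blast
    define h where "h t = g t + mat_unit ?N j n (q t - entry j n (g t))" for t
    have h_entry: "entry p r (h t) = (if p = j \<and> r = n then q t else entry p r (g t))"
      if "p < ?N" "r < ?N" for p r t
      using that ij by (simp add: h_def entry_add entry_mat_unit)
    have lip_q: "lip_path q" by (rule laurent_lip_path[OF q(1)])
    have "reducible ?N h hi" if ph: "tr.inv_path ?N h hi" for hi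
    proof -
      define x where "x t = zpow (int (l' - l)) t *\<^sub>C b" for t
      have lip_x: "lip_path x"
        unfolding x_def by (intro lip_path_bounded_linear[OF bounded_linear_scaleC_left] lip_path_zpow)
      note X = row_operation_path[OF ph lip_x ij(1,2,3)]
      show ?thesis
      proof (rule reducible_row_operation[OF ph lip_x ij(1,2,3)],
          rule less.hyps[OF _ X(1), of "ls(i := l')"])
        have "(\<Sum>p<?N. (ls(i := l')) p) = l' + (\<Sum>p\<in>{..<?N} - {i}. ls p)"
          using ij by (subst sum.remove[of _ i]) auto
        moreover have "(\<Sum>p<?N. ls p) = Suc l' + (\<Sum>p\<in>{..<?N} - {i}. ls p)"
          using ij l by (subst sum.remove[of _ i]) auto
        ultimately show "(\<Sum>p<?N. (ls(i := l')) p) < (\<Sum>p<?N. ls p)" by simp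
      next
        fix p r assume pr: "p < ?N" "r < ?N"
        have lh: "\<exists>l. laurent d l (\<lambda>t. entry p r (h t))" if "p < ?N" "r < ?N" for p r
        proof -
          have "(\<lambda>t. entry p r (h t)) = (if p = j \<and> r = n then q else (\<lambda>t. entry p r (g t)))"
            by (rule ext) (simp add: h_entry that)
          then show ?thesis using entries[OF that] q(1) by (cases "p = j \<and> r = n") auto
        qed
        have "\<exists>l. laurent d l (\<lambda>t. entry p r (h t) + (if p = i then x t * entry j r (h t) else 0))"
          using laurent_add_mult[OF lh[OF pr] lh[OF ij(2) pr(2)], of "l' - l" b] lh[OF pr]
          by (cases "p = i") (simp_all add: x_def mult_scaleC_left)
        then obtain k where "laurent d k (\<lambda>t. entry p r (h t) + (if p = i then x t * entry j r (h t) else 0))" ..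
        then have "laurent d k (\<lambda>t. entry p r ((1 + mat_unit ?N i j (x t)) * h t))"
          by (rule laurent_cong) (simp add: X(2) pr)
        then show "\<exists>l. laurent d l (\<lambda>t. entry p r ((1 + mat_unit ?N i j (x t)) * h t))" ..
      next
        fix p assume p: "p < ?N"
        consider "p = i" | "p = j" | "p \<noteq> i" "p \<noteq> j" by blast
        then show "laurent d ((ls(i := l')) p) (\<lambda>t. entry p n ((1 + mat_unit ?N i j (x t)) * h t))"
        proof cases
          case 1
          show ?thesis
            unfolding 1 fun_upd_same
          proof (rule laurent_cong[OF b])
            fix t :: real assume t: "t \<in> {0..1}"
            show "entry i n (g t) + zpow (int (l' - l)) t *\<^sub>C (b * q t) = entry i n ((1 + mat_unit ?N i j (x t)) * h t)"
              using ij by (simp add: X(2)[OF t] h_entry) (simp add: x_def mult_scaleC_left)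
          qed
        next
          case 2
          have "laurent d (ls j) (\<lambda>t. entry j n ((1 + mat_unit ?N i j (x t)) * h t))"
            unfolding l(1) by (rule laurent_cong[OF q(1)]) (use ij in \<open>simp add: X(2) h_entry\<close>)
          then show ?thesis using 2 ij by simp
        next
          case 3
          have "laurent d (ls p) (\<lambda>t. entry p n ((1 + mat_unit ?N i j (x t)) * h t))"
            by (rule laurent_cong[OF col[OF p]]) (use p 3 in \<open>simp add: X(2) h_entry\<close>)
          then show ?thesis using 3 by simp
        qed
      qed
    qed
    moreover have "norm (q t - entry j n (g t)) * norm (gi t) \<le> 1/8" if "t \<in> {0..1}" for t
    proof -
      have "norm (q t - entry j n (g t)) * norm (gi t) \<le> 1 / (8 * M) * M"
        using q(2)[OF that] M(2)[OF that] M(1) by (intro mult_mono) auto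
      then show ?thesis using M(1) by simp
    qed
    ultimately show ?thesis
      using ij(2) lip_q laurent_loop[OF q(1)] laurent_entries_loop[OF g entries]
      by (intro reducible_perturb_entry[OF g, of j n q]) (auto simp: h_def[abs_def])
  next
    case False
    \<comment> \<open>Two positive lengths would always be comparable and yield a pivot, so at most
      one entry of the column is left.\<close>
    obtain i where i: "i < ?N" "\<And>p. p < ?N \<Longrightarrow> p \<noteq> i \<Longrightarrow> ls p = 0"
    proof (cases "\<exists>i<?N. ls i > 0")
      case True
      then obtain i where i: "i < ?N" "ls i > 0" by blast
      have "ls p = 0" if "p < ?N" "p \<noteq> i" for p
        using False i that by (metis nat_le_linear not_gr_zero)
      then show thesis using that i by blast
    next
      case none: False
      show thesis by (rule that[of n]) (use none in auto)
    qed
    have zero: "entry p n (g t) = 0" if "p < ?N" "p \<noteq> i" "t \<in> {0..1}" for p t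
      using col[OF that(1)] i(2)[OF that(1,2)] that(3) by (auto simp: laurent_def)
    have split: "reducible ?N h hi" if ph: "tr.inv_path ?N h hi"
      and le: "\<And>p r. p < ?N \<Longrightarrow> r < ?N \<Longrightarrow> \<exists>l. laurent d l (\<lambda>t. entry p r (h t))"
      and z: "\<And>p t. p < n \<Longrightarrow> t \<in> {0..1} \<Longrightarrow> entry p n (h t) = 0" for h hi :: "real \<Rightarrow> 'a seq_op"
    proof (rule reducible_split[OF dense ph, of d])
      show "\<exists>l. laurent d l (\<lambda>t. entry p r (h t))" if "p \<le> n" "r \<le> n" for p r
        using le that by simp
    qed (use z in auto, rule IH)
    show ?thesis
    proof (cases "i = n")
      case True
      then show ?thesis using zero by (intro split[OF g entries]) auto
    next
      case False
      then have inN: "i < ?N" "n < ?N" "i \<noteq> n" "n \<noteq> i" using i by auto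
      have lexp: "\<exists>l. laurent d l (\<lambda>t. p t + c * q t)" if "\<exists>l. laurent d l p" "\<exists>l. laurent d l q" for p q and c :: 'a
        using laurent_add_mult[OF that, of 0 c] by simp
      \<comment> \<open>Adding row i to the last row and then subtracting the last row from row i
        moves the remaining entry of the column to the last place.\<close>
      note X = row_operation_path[OF g lip_path_const[of 1] inN(2,1,4)]
      define h where "h t = (1 + mat_unit ?N n i 1) * g t" for t
      define hi where "hi t = gi t * (1 - mat_unit ?N n i 1)" for t
      have ph: "tr.inv_path ?N h hi" using X(1) by (simp add: h_def[abs_def] hi_def[abs_def])
      have eh: "entry p r (h t) = entry p r (g t) + (if p = n then entry i r (g t) else 0)"
        if "t \<in> {0..1}" "p < ?N" "r < ?N" for p r t
        using X(2)[OF that] by (simp add: h_def)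
      have lh: "\<exists>l. laurent d l (\<lambda>t. entry p r (h t))" if pr: "p < ?N" "r < ?N" for p r
      proof -
        obtain l where "laurent d l (\<lambda>t. entry p r (g t) + (if p = n then 1 else 0) * entry i r (g t))"
          using lexp[OF entries[OF pr] entries[OF inN(1) pr(2)]] by blast
        then have "laurent d l (\<lambda>t. entry p r (h t))" by (rule laurent_cong) (simp add: eh pr)
        then show ?thesis ..
      qed
      note Y = row_operation_path[OF ph lip_path_const[of "-1"] inN(1,2,3)]
      show ?thesis
      proof (rule reducible_row_operation[OF g lip_path_const[of 1] inN(2,1,4)],
          fold h_def hi_def, rule reducible_row_operation[OF ph lip_path_const[of "-1"] inN(1,2,3)],
          rule split[OF Y(1)])
        fix p r assume pr: "p < ?N" "r < ?N"
        obtain l where "laurent d l (\<lambda>t. entry p r (h t) + (if p = i then -1 else 0) * entry n r (h t))"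
          using lexp[OF lh[OF pr] lh[OF inN(2) pr(2)]] by blast
        then have "laurent d l (\<lambda>t. entry p r ((1 + mat_unit ?N i n (- 1)) * h t))"
          by (rule laurent_cong) (simp add: Y(2) pr)
        then show "\<exists>l. laurent d l (\<lambda>t. entry p r ((1 + mat_unit ?N i n (- 1)) * h t))" ..
      next
        fix p t assume p: "p < n" and t: "t \<in> {0..1::real}"
        then show "entry p n ((1 + mat_unit ?N i n (- 1)) * h t) = 0"
          using inN zero[OF _ _ t, of p] zero[OF _ _ t, of n] by (simp add: Y(2) eh)
      qed
    qed
  qed
qed

lemma reducible_laurent:
  fixes g gi :: "real \<Rightarrow> 'a :: unital_cstar_algebra seq_op"
  assumes "dense_invertibles TYPE('a)" "tr.inv_path n g gi"
    and "\<And>i j. i < n \<Longrightarrow> j < n \<Longrightarrow> \<exists>l. laurent d l (\<lambda>t. entry i j (g t))"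
  shows "reducible n g gi"
  using assms(2-)
proof (induction n arbitrary: g gi)
  case 0
  have "tr.det_sum 0 g gi m = 0" for m by (simp add: tr.det_sum_def trace_def)
  then show ?case
    unfolding reducible_def using alg.inv_path_one
    by (intro exI[of _ "\<lambda>t. 1"]) auto
next
  case (Suc n)
  obtain ls where "\<And>i. i < Suc n \<Longrightarrow> laurent d (ls i) (\<lambda>t. entry i n (g t))"
    using Suc.prems(2)[of _ n] by (metis lessI)
  then show ?case using Suc by (intro reducible_column[OF assms(1), of n d]) auto
qed

text \<open>Approximating all entries by Laurent polynomials yields a perturbation small against the
  inverse, to which the determinant is insensitive.\<close>

theorem loop_reducible:
  fixes g gi :: "real \<Rightarrow> 'a :: unital_cstar_algebra seq_op"
  assumes dense: "dense_invertibles TYPE('a)" and g: "tr.inv_path n g gi" "g 0 = g 1"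
  shows "reducible n g gi"
proof -
  note gD = tr.inv_pathD[OF g(1)]
  obtain M where M: "M > 0" "\<And>t. t \<in> {0..1} \<Longrightarrow> norm (gi t) \<le> M" using lip_path_bounded[OF gD(2)] by blast
  \<comment> \<open>The n^2 entry errors add up to at most 1/(8 M), with M a bound for the inverse;
    the added 1 covers n = 0.\<close>
  define e where "e = 1 / (8 * M * (real n * real n + 1))"
  have e: "e > 0" using M by (simp add: e_def add_nonneg_pos)
  have "\<exists>p. laurent_poly p \<and> (\<forall>t\<in>{0..1}. norm (p t - entry i j (g t)) \<le> e)" for i j
  proof -
    have "lip_path (\<lambda>t. entry i j (g t))" by (rule lip_path_bounded_linear[OF bounded_linear_entry gD(1)])
    moreover have "entry i j (g 0) = entry i j (g 1)" by (simp add: g(2))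
    ultimately show ?thesis using laurent_approximation[OF _ _ e, of "\<lambda>t. entry i j (g t)"] by metis
  qed
  then obtain p where p: "\<And>i j. laurent_poly (p i j)"
    "\<And>i j t. t \<in> {0..1} \<Longrightarrow> norm (p i j t - entry i j (g t)) \<le> e" by metis
  have "finite ({..<n} \<times> {..<n})" by simp
  then obtain d where "\<And>ij. ij \<in> {..<n} \<times> {..<n} \<Longrightarrow> \<exists>l. laurent d l (case_prod p ij)"
    by (rule laurent_poly_common[of _ "case_prod p"]) (use p(1) in auto)
  then have d: "\<exists>l. laurent d l (p i j)" if "i < n" "j < n" for i j
    using that by force
  define h where "h t = 1 + corner n (\<lambda>i j. p i j t - (if i = j then 1 else 0))" for t
  have h_entry: "entry i j (h t) = p i j t" if "i < n" "j < n" for i j t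
    using that by (simp add: h_def entry_add entry_one entry_corner)
  have h_eq: "h t = 1 + (\<Sum>i<n. \<Sum>j<n. mat_unit n i j (p i j t - (if i = j then 1 else 0)))" for t
    by (simp add: h_def corner_eq_sum_mat_unit)
  have lip: "lip_path h"
    unfolding h_eq
  proof (intro lip_path_add lip_path_sum lip_path_const lip_path_bounded_linear[OF bounded_linear_mat_unit] lip_path_diff)
    fix i j assume "i \<in> {..<n}" "j \<in> {..<n}"
    then show "lip_path (p i j)" using d laurent_lip_path by blast
  qed
  have h01: "h 0 = h 1"
  proof -
    have "p i j 0 = p i j 1" if "i < n" "j < n" for i j
      using d[OF that] laurent_loop by blast
    then show ?thesis unfolding h_def by (intro arg_cong2[where f = plus] refl corner_cong) simp
  qed
  have hK: "h t - 1 \<in> corners n" for t by (simp add: h_def)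
  have near: "norm ((h t - g t) * gi t) \<le> 1/8" if t: "t \<in> {0..1}" for t
  proof -
    have "h t - g t = corner n (\<lambda>i j. p i j t - entry i j (g t))"
    proof (rule corners_eqI[of _ n])
      show "h t - g t \<in> corners n" using cor.K_diff[OF hK[of t] gD(3)[OF t]] by simp
    qed (simp_all add: entry_diff h_entry entry_corner)
    then have "norm (h t - g t) \<le> (\<Sum>i<n. \<Sum>j<n. norm (p i j t - entry i j (g t)))"
      by (simp only: norm_corner_le)
    also have "\<dots> \<le> (\<Sum>i<n. \<Sum>j<n. e)" by (intro sum_mono p(2) t)
    also have "\<dots> = (real n * real n) * e" by simp
    also have "\<dots> \<le> (real n * real n + 1) * e" using e by (intro mult_right_mono) auto
    also have "\<dots> = 1 / (8 * M)"
      using M(1) by (simp add: e_def add_nonneg_pos less_imp_neq[symmetric] add_nonneg_eq_0_iff)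
    finally have "norm ((h t - g t) * gi t) \<le> 1 / (8 * M) * M"
      using M by (intro order_trans[OF norm_mult_ineq] mult_mono M(2) t) auto
    then show ?thesis using M(1) by simp
  qed
  obtain hi where hi: "tr.inv_path n h hi" "null_mod (\<lambda>m. tr.det_sum n h hi m - tr.det_sum n g gi m)"
    using tr.det_sum_perturb[OF g lip h01 hK near] by blast
  have "reducible n h hi"
    using d by (intro reducible_laurent[OF dense hi(1), of d]) (simp add: h_entry)
  then show ?thesis by (rule reducible_cong) (use null_mod_minus[OF hi(2)] in simp)
qed

section \<open>Loops of invertible elements\<close>

declare One_nat_def [simp del]

definition skew_part :: "'a :: unital_cstar_algebra \<Rightarrow> 'a" where
  "skew_part x = (1/2) *\<^sub>R (x - star x)"

lemma bounded_linear_skew_part: "bounded_linear skew_part"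
  unfolding skew_part_def
  by (intro bounded_linear_compose[OF bounded_linear_scaleR_right] bounded_linear_sub
      bounded_linear_ident bounded_linear_star)

lemmas skew_part_add = linear_add[OF bounded_linear.linear[OF bounded_linear_skew_part]]
  and skew_part_diff = linear_diff[OF bounded_linear.linear[OF bounded_linear_skew_part]]
  and skew_part_minus = linear_neg[OF bounded_linear.linear[OF bounded_linear_skew_part]]
  and skew_part_sum = linear_sum[OF bounded_linear.linear[OF bounded_linear_skew_part]]

lemma norm_skew_part_le: "norm (skew_part x) \<le> norm x"
  using norm_triangle_ineq4[of x "star x"] by (simp add: skew_part_def)

lemma skew_part_idem: "star x = - x \<Longrightarrow> skew_part x = x"
  by (simp add: skew_part_def scaleR_2[symmetric])

section \<open>The algebra as the upper left block of size 1\<close>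

abbreviation emb :: "'a \<Rightarrow> 'a :: unital_cstar_algebra seq_op" where "emb \<equiv> mat_unit 1 0 0"

lemma emb_mult: "emb a * emb b = emb (a * b)"
  by (simp add: mat_unit_mult)

lemma norm_emb: "norm (emb a) = norm a"
proof (rule antisym)
  show "norm (emb a) \<le> norm a"
    unfolding mat_unit_def by (rule order_trans[OF norm_corner_le]) simp
  show "norm a \<le> norm (emb a)" using norm_entry_le[of 0 0 "emb a"] by (simp add: entry_mat_unit)
qed

lemma emb_eq_iff: "emb a = emb b \<longleftrightarrow> a = b"
  using norm_emb[of "a - b"] mat_unit_diff[of 1 0 0 a b] by auto

lemma corners_1E:
  assumes "x \<in> corners 1"
  obtains a where "x = emb a"
proof
  show "x = emb (entry 0 0 x)"
    by (rule corners_eqI[OF assms]) (simp_all add: entry_mat_unit)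
qed

lemma skew_1: "emb a \<in> cor.skew 1 \<longleftrightarrow> star a = - a"
  by (simp add: cor.skew_def corner_star_mat_unit emb_eq_iff flip: mat_unit_minus)

lemma emb_skew_part: "emb (skew_part a) \<in> cor.skew 1"
  by (subst skew_1) (simp add: skew_part_def star_scaleR star_diff star_star flip: scaleR_minus_right)

text \<open>The matrix diag(a, 1, 1, ...). Unlike \<open>emb\<close> it preserves the unit, so it
  embeds groups.\<close>

definition unit_emb :: "'a \<Rightarrow> 'a :: unital_cstar_algebra seq_op" where
  "unit_emb a = 1 + emb (a - 1)"

lemma unit_emb_mult: "unit_emb a * unit_emb b = unit_emb (a * b)"
proof -
  have "a * b - 1 = (a - 1) + (b - 1) + (a - 1) * (b - 1)" by (simp add: algebra_simps)
  then show ?thesis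
    unfolding unit_emb_def
    by (simp only: mat_unit_add emb_mult[symmetric]) (simp add: distrib_left distrib_right)
qed

lemma unit_emb_one [simp]: "unit_emb 1 = 1"
  by (simp add: unit_emb_def)

lemma norm_unit_emb_diff: "norm (unit_emb a - unit_emb b) = norm (a - b)"
  unfolding unit_emb_def using norm_emb[of "a - b"] mat_unit_diff[of 1 0 0 "a - 1" "b - 1"] by simp

lemma norm_unit_emb: "norm (unit_emb a) \<le> max 1 (norm a)"
  unfolding norm_seq_op.rep_eq
proof (rule norm_blinfun_bound)
  fix v :: "nat \<Rightarrow>\<^sub>C 'a"
  show "norm (blinfun_apply (blinfun_of (unit_emb a)) v) \<le> max 1 (norm a) * norm v"
  proof (rule norm_bound)
    fix i
    have "apply_bcontfun (blinfun_apply (blinfun_of (unit_emb a)) v) i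
        = (if i = 0 then a * apply_bcontfun v 0 else apply_bcontfun v i)"
      by (simp add: unit_emb_def mat_unit_def plus_seq_op.rep_eq one_seq_op.rep_eq
          blinfun.bilinear_simps corner_apply corner_fun_apply left_diff_distrib One_nat_def)
    also have "norm \<dots> \<le> max 1 (norm a) * norm v"
    proof (cases "i = 0")
      case True
      then show ?thesis
        using norm_bounded[of v 0] by (auto intro!: order_trans[OF norm_mult_ineq] mult_mono)
    next
      case False
      have "1 * norm (apply_bcontfun v i) \<le> max 1 (norm a) * norm v"
        by (intro mult_mono norm_bounded) auto
      then show ?thesis using False by simp
    qed
    finally show "norm (apply_bcontfun (blinfun_apply (blinfun_of (unit_emb a)) v) i) \<le> max 1 (norm a) * norm v" .
  qed
qed simp

lemma adj_unit_emb: "cor.adj 1 (unit_emb a) = unit_emb (star a)"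
  by (simp add: cor.adj_def unit_emb_def corner_star_mat_unit star_diff)

lemma unit_emb_eq_iff: "unit_emb a = unit_emb b \<longleftrightarrow> a = b"
  using norm_unit_emb_diff[of a b] by auto

lemma unit_emb_eq_one: "unit_emb a = 1 \<longleftrightarrow> a = 1"
  using unit_emb_eq_iff[of a 1] by simp

lemma unitary_1:
  "unit_emb a \<in> cor.unitary_group 1 \<longleftrightarrow> a * star a = 1 \<and> star a * a = 1"
proof -
  have "unit_emb a - 1 \<in> corners 1" by (simp add: unit_emb_def)
  then show ?thesis
    by (simp add: cor.unitary_group_def adj_unit_emb unit_emb_mult unit_emb_eq_one)
qed

text \<open>On blocks of size 1 the ambient norm agrees with the C*-norm. The operator norm on
  bounded sequences is not the C*-norm of larger blocks, so estimates with unitaries are made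
  here.\<close>

lemma norm_unitary_1:
  assumes "u \<in> cor.unitary_group 1"
  shows "norm u \<le> 1"
proof -
  obtain b where "u - 1 = emb b" using corners_1E[OF cor.unitaryD(1)[OF assms]] .
  then have u: "u = unit_emb (1 + b)" by (simp add: unit_emb_def algebra_simps)
  then have "star (1 + b) * (1 + b) = 1" using assms by (simp add: unitary_1)
  then have "(norm (1 + b))\<^sup>2 = 1" using cstar_identity[of "1 + b"] by simp
  then have "norm (1 + b) = 1" by (simp add: power2_eq_1_iff) (metis norm_ge_zero neg_0_le_iff_le not_one_le_zero)
  then show ?thesis using norm_unit_emb[of "1 + b"] by (simp add: u)
qed

lemma emb_commutator_Lie_kernel:
  assumes "star a = - a" "star b = - b"
  shows "emb (a * b - b * a) \<in> cor.Lie_kernel 1"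
  using cor.Lie_kernel_commutator[of "emb a" 1 "emb b"] assms
  by (simp add: skew_1 emb_mult flip: mat_unit_diff)

text \<open>Split a and b into skew and self-adjoint parts: the mixed commutators are self-adjoint,
  and the other two are skew. Multiplying self-adjoint parts by \<i> makes them skew and reverses
  the sign, which explains \<open>b2 * a2 - a2 * b2\<close>. The scalar r is absorbed into a, as
  \<open>Lie_kernel\<close> is only additive.\<close>

lemma skew_part_commutator_span:
  assumes "x \<in> commutator_span"
  shows "emb (skew_part x) \<in> cor.Lie_kernel 1"
  using assms unfolding commutator_span_def
proof (induction rule: span_induct_alt)
  case base
  show ?case by (simp add: linear_0[OF bounded_linear.linear[OF bounded_linear_skew_part]] cor.Lie_kernel_zero)
next
  case (step r z y)
  then obtain a b where z: "z = a * b - b * a" by auto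
  define a1 where "a1 = r *\<^sub>R skew_part a"
  define b1 where "b1 = skew_part b"
  define a2 where "a2 = \<i> *\<^sub>C (r *\<^sub>R ((1/2) *\<^sub>R (a + star a)))"
  define b2 where "b2 = \<i> *\<^sub>C ((1/2) *\<^sub>R (b + star b))"
  have "star a1 = - a1" "star b1 = - b1"
    by (simp_all add: a1_def b1_def skew_part_def star_scaleR star_diff star_star flip: scaleR_minus_right)
  then have 1: "emb (a1 * b1 - b1 * a1) \<in> cor.Lie_kernel 1" by (rule emb_commutator_Lie_kernel)
  have "star a2 = - a2" "star b2 = - b2"
    by (simp_all add: a2_def b2_def star_scaleC star_scaleR star_add star_star scaleC_minus_left add.commute)
  then have 2: "emb (b2 * a2 - a2 * b2) \<in> cor.Lie_kernel 1" by (intro emb_commutator_Lie_kernel)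
  have "a1 * b1 = (r/4) *\<^sub>R ((a - star a) * (b - star b))" "b1 * a1 = (r/4) *\<^sub>R ((b - star b) * (a - star a))"
    by (simp_all add: a1_def b1_def skew_part_def)
  then have e1: "4 *\<^sub>R (a1 * b1 - b1 * a1) = r *\<^sub>R ((a - star a) * (b - star b) - (b - star b) * (a - star a))"
    by (simp add: scaleR_diff_right)
  have "b2 * a2 = - ((r/4) *\<^sub>R ((b + star b) * (a + star a)))" "a2 * b2 = - ((r/4) *\<^sub>R ((a + star a) * (b + star b)))"
    by (simp_all add: a2_def b2_def mult_scaleC_left mult_scaleC_right scaleC_scaleR)
  then have e2: "4 *\<^sub>R (b2 * a2 - a2 * b2) = r *\<^sub>R ((a + star a) * (b + star b) - (b + star b) * (a + star a))"
    by (simp add: scaleR_diff_right)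
  have e3: "4 *\<^sub>R skew_part (r *\<^sub>R z) = r *\<^sub>R (2 *\<^sub>R (a * b - b * a + (star a * star b - star b * star a)))"
    by (simp add: skew_part_def z star_scaleR star_diff star_mult scaleR_diff_right scaleR_add_right algebra_simps)
  have e4: "(a - star a) * (b - star b) - (b - star b) * (a - star a)
      + ((a + star a) * (b + star b) - (b + star b) * (a + star a))
      = 2 *\<^sub>R (a * b - b * a + (star a * star b - star b * star a))"
    by (simp add: scaleR_2 algebra_simps)
  have "4 *\<^sub>R skew_part (r *\<^sub>R z) = 4 *\<^sub>R ((a1 * b1 - b1 * a1) + (b2 * a2 - a2 * b2))"
    unfolding scaleR_add_right[of 4] e1 e2 e3 e4[symmetric] by (rule scaleR_add_right)
  then have "skew_part (r *\<^sub>R z) = (a1 * b1 - b1 * a1) + (b2 * a2 - a2 * b2)" by simp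
  then have "emb (skew_part (r *\<^sub>R z)) \<in> cor.Lie_kernel 1"
    using cor.Lie_kernel_add[OF 1 2] by (simp add: mat_unit_add)
  then show ?case using step(2) by (simp add: skew_part_add mat_unit_add cor.Lie_kernel_add)
qed

text \<open>Unitarity of 1 + x says x + \<open>star x\<close> = - x \<open>star x\<close>, so x
  equals its skew part to second order. The three errors contribute 1/2, 4 and 1, below 6.\<close>

lemma unitary_exp_skew_part:
  assumes "unit_emb (1 + x) \<in> cor.unitary_group 1" "norm x \<le> 1"
  shows "norm (unit_emb (1 + x) * exp (- emb (skew_part x)) - 1) \<le> 6 * (norm x)\<^sup>2"
proof -
  define s where "s = emb (skew_part x)"
  define e where "e = exp (- s) - 1 - (- s)"
  define X where "X = emb x"
  have ns: "norm s \<le> norm x" by (simp add: s_def norm_emb norm_skew_part_le)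
  have nX: "norm X = norm x" by (simp add: X_def norm_emb)
  have u: "unit_emb (1 + x) = 1 + X" by (simp add: unit_emb_def X_def)
  have "(1 + x) * star (1 + x) = 1" using assms(1) unitary_1 by blast
  then have "x + star x + x * star x = 0" by (simp add: star_add algebra_simps)
  then have sum: "x + star x = - (x * star x)" by (simp add: eq_neg_iff_add_eq_0)
  have "2 *\<^sub>R (x - skew_part x) = x + star x"
    by (simp add: skew_part_def scaleR_diff_right scaleR_2)
  then have "(1/2) *\<^sub>R 2 *\<^sub>R (x - skew_part x) = (1/2) *\<^sub>R (- (x * star x))" by (simp only: sum)
  then have "x - skew_part x = - ((1/2) *\<^sub>R (x * star x))" by simp
  then have "X - s = emb (- ((1/2) *\<^sub>R (x * star x)))" unfolding X_def s_def by (simp flip: mat_unit_diff)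
  then have n1: "norm (X - s) \<le> (1/2) * (norm x)\<^sup>2"
    using norm_mult_ineq[of x "star x"] by (simp only: norm_emb) (simp add: power2_eq_square)
  have n2: "norm e \<le> 2 * (norm x)\<^sup>2"
  proof -
    have "norm e \<le> 2 * (norm (- s))\<^sup>2" unfolding e_def
      using ns assms(2) by (intro norm_exp_minus_one_minus_id) simp
    also have "\<dots> \<le> 2 * (norm x)\<^sup>2" using ns by (simp add: power_mono)
    finally show ?thesis .
  qed
  have n3: "norm (1 + X) \<le> 2" using norm_triangle_ineq[of 1 X] nX assms(2) by simp
  have "(1 + X) * exp (- s) - 1 = (X - s) + (1 + X) * e - X * s"
    by (simp add: e_def algebra_simps)
  also have "norm \<dots> \<le> norm (X - s) + norm ((1 + X) * e) + norm (X * s)"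
    using norm_triangle_ineq4[of "X - s + (1 + X) * e" "X * s"] norm_triangle_ineq[of "X - s" "(1 + X) * e"]
    by linarith
  also have "\<dots> \<le> (1/2) * (norm x)\<^sup>2 + 2 * (2 * (norm x)\<^sup>2) + norm x * norm x"
    using n1 n2 n3 ns nX by (intro add_mono order_trans[OF norm_mult_ineq] mult_mono) auto
  also have "\<dots> \<le> 6 * (norm x)\<^sup>2" by (simp add: power2_eq_square)
  finally show ?thesis by (simp add: u s_def)
qed

section \<open>Products of unitaries close to the closed commutator subgroup\<close>

definition near_CU :: "real \<Rightarrow> 'a :: unital_cstar_algebra seq_op \<Rightarrow> bool" where
  "near_CU e x \<longleftrightarrow> (\<exists>c\<in>cor.CU_group 1. norm (x - c) \<le> e)"

lemma near_CU_equiv: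
  assumes "near_CU e x" "cor.CU_equiv 1 y x"
  shows "near_CU e y"
proof -
  obtain c where c: "c \<in> cor.CU_group 1" "norm (x - c) \<le> e" using assms(1) by (auto simp: near_CU_def)
  define d where "d = y * cor.adj 1 x"
  have d: "d \<in> cor.CU_group 1" and x: "x \<in> cor.U0_group 1"
    using assms(2) by (auto simp: cor.CU_equiv_def d_def)
  have "y = d * x" using cor.U0_left[OF x] by (simp add: d_def mult.assoc)
  then have "norm (y - d * c) = norm (d * (x - c))" by (simp add: right_diff_distrib)
  also have "\<dots> \<le> 1 * norm (x - c)"
    using norm_unitary_1[OF cor.U0_unitary[OF cor.CU_U0[OF d]]]
    by (intro order_trans[OF norm_mult_ineq] mult_right_mono) auto
  finally have "norm (y - d * c) \<le> e" using c(2) by simp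
  then show ?thesis unfolding near_CU_def using cor.CU_mult[OF d c(1)] by blast
qed

lemma near_CU_mult:
  assumes "near_CU e x" "norm (w - 1) \<le> e'" "x \<in> cor.U0_group 1"
  shows "near_CU (e' + e) (w * x)"
proof -
  obtain c where c: "c \<in> cor.CU_group 1" "norm (x - c) \<le> e" using assms(1) by (auto simp: near_CU_def)
  have "w * x - c = (w - 1) * x + (x - c)" by (simp add: algebra_simps)
  also have "norm \<dots> \<le> e' * 1 + e"
    using assms(2) c(2) norm_unitary_1[OF cor.U0_unitary[OF assms(3)]] order_trans[OF norm_ge_zero assms(2)]
    by (intro order_trans[OF norm_triangle_ineq] add_mono order_trans[OF norm_mult_ineq] mult_mono) auto
  finally show ?thesis using c(1) by (auto simp: near_CU_def)
qed

text \<open>Modulo the closed commutator subgroup the exponentials can be moved next to their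
  factors, and each pair is within 6 b^2 of 1. With m factors and b of order 1/m the total error is
  of order 1/m.\<close>

lemma near_CU_product:
  fixes v :: "nat \<Rightarrow> 'a :: unital_cstar_algebra"
  assumes v: "\<And>j. j < r \<Longrightarrow> unit_emb (1 + x j) \<in> cor.U0_group 1" "\<And>j. j < r \<Longrightarrow> norm (x j) \<le> b" "b \<le> 1"
    and V: "V 0 = 1" "\<And>j. j < r \<Longrightarrow> V (Suc j) = unit_emb (1 + x j) * V j"
  shows "V r \<in> cor.U0_group 1 \<and> near_CU (real r * (6 * b\<^sup>2)) (V r * exp (- emb (\<Sum>j<r. skew_part (x j))))"
  using assms
proof (induction r)
  case 0
  then show ?case using cor.CU_one by (auto simp: cor.one_U0 near_CU_def)
next
  case (Suc r)
  let ?S = "emb (\<Sum>j<r. skew_part (x j))" and ?s = "emb (skew_part (x r))" and ?W = "unit_emb (1 + x r)"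
  have IH: "V r \<in> cor.U0_group 1" "near_CU (real r * (6 * b\<^sup>2)) (V r * exp (- ?S))"
    using Suc.IH Suc.prems by auto
  have W: "?W \<in> cor.U0_group 1" "norm (x r) \<le> b" using Suc.prems by auto
  have S: "?S \<in> cor.skew 1" "?s \<in> cor.skew 1"
    by (simp_all only: emb_skew_part flip: skew_part_sum)
  then have E: "exp (- ?S) \<in> cor.U0_group 1" "exp (- ?s) \<in> cor.U0_group 1"
    by (auto intro!: cor.exp_U0 cor.skew_neg)
  have U: "?W * V r \<in> cor.U0_group 1" by (intro cor.U0_mult W IH)
  have "emb (\<Sum>j<Suc r. skew_part (x j)) = ?s + ?S" by (simp add: mat_unit_add add.commute)
  then have "cor.CU_equiv 1 (V (Suc r) * exp (- emb (\<Sum>j<Suc r. skew_part (x j))))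
      (?W * V r * (exp (- ?s) * exp (- ?S)))"
    using cor.CU_equiv_mult[OF cor.CU_equiv_refl[OF U]
        cor.exp_add_equiv[OF cor.skew_neg[OF S(2)] cor.skew_neg[OF S(1)]]] Suc.prems(5)[of r]
    by simp
  also have "?W * V r * (exp (- ?s) * exp (- ?S)) = ?W * (V r * exp (- ?s)) * exp (- ?S)" by (simp only: mult.assoc)
  also have "cor.CU_equiv 1 (?W * (V r * exp (- ?s)) * exp (- ?S)) (?W * (exp (- ?s) * V r) * exp (- ?S))"
    by (intro cor.CU_equiv_mult cor.CU_equiv_refl cor.CU_equiv_commute W E IH)
  also have "?W * (exp (- ?s) * V r) * exp (- ?S) = (?W * exp (- ?s)) * (V r * exp (- ?S))" by (simp only: mult.assoc)
  finally have eq: "cor.CU_equiv 1 (V (Suc r) * exp (- emb (\<Sum>j<Suc r. skew_part (x j))))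
      ((?W * exp (- ?s)) * (V r * exp (- ?S)))" .
  have "norm (?W * exp (- ?s) - 1) \<le> 6 * (norm (x r))\<^sup>2"
    using W Suc.prems(3) by (intro unitary_exp_skew_part cor.U0_unitary) auto
  also have "\<dots> \<le> 6 * b\<^sup>2" using W(2) by (simp add: power_mono)
  finally have "near_CU (6 * b\<^sup>2 + real r * (6 * b\<^sup>2)) ((?W * exp (- ?s)) * (V r * exp (- ?S)))"
    by (intro near_CU_mult IH cor.U0_mult E)
  then have "near_CU (6 * b\<^sup>2 + real r * (6 * b\<^sup>2)) (V (Suc r) * exp (- emb (\<Sum>j<Suc r. skew_part (x j))))"
    by (rule near_CU_equiv[OF _ eq])
  then show ?case using U Suc.prems(5)[of r] by (simp add: distrib_right)
qed

text \<open>Conjugation by w is invisible modulo commutators, and the skew part of a product of two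
  self-adjoint elements is half their commutator. Positive parts of polar decompositions thus do not
  affect the skew part of the determinant.\<close>

lemma skew_part_polar_step:
  fixes w :: "'a :: unital_cstar_algebra"
  assumes "w * star w = 1" "star w * w = 1" "star dp = dp" "star pinv = pinv"
  obtains c where "c \<in> commutator_span" "skew_part (w * (dp * pinv) * star w) = skew_part c"
proof
  define z where "z = dp * pinv"
  let ?c = "((w * z) * star w - star w * (w * z)) + (1/2) *\<^sub>R (dp * pinv - pinv * dp)"
  show "?c \<in> commutator_span"
    by (intro commutator_span_add commutator_in_span commutator_span_scale)
  have "star w * (w * z) = z" using assms(2) by (simp flip: mult.assoc)
  moreover have "skew_part ((1/2) *\<^sub>R (dp * pinv - pinv * dp)) = skew_part z"
    by (subst skew_part_idem) (simp_all add: star_scaleR star_diff star_mult assms skew_part_def z_def flip: scaleR_minus_right)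
  ultimately show "skew_part (w * (dp * pinv) * star w) = skew_part ?c"
    by (simp add: skew_part_add skew_part_diff flip: z_def)
qed

text \<open>With k = w p, a step of k is x + y + x y, where x is the step of w and y a conjugated
  step of p. The y have skew parts of commutators, the x y are of second order, and the unitaries 1
  + x multiply to 1 around the loop. Hence the exponential of minus the sum of the skew parts of the
  x lies near the closed commutator subgroup.\<close>

theorem loop_Lie_kernel:
  fixes k ki :: "real \<Rightarrow> 'a :: unital_cstar_algebra"
  assumes k: "alg.inv_path k ki" "k 0 = k 1" and q: "null_mod (\<lambda>m. alg.det_sum k ki m - q)"
  shows "emb (skew_part q) \<in> cor.Lie_kernel 1"
proof -
  note kD = alg.inv_pathD[OF k(1)]
  obtain w p pinv where lip: "lip_path w" "lip_path p" "lip_path pinv"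
    and kwp: "\<And>t. t \<in> {0..1} \<Longrightarrow> k t = w t * p t"
    and w: "\<And>t. t \<in> {0..1} \<Longrightarrow> star (w t) * w t = 1" "\<And>t. t \<in> {0..1} \<Longrightarrow> w t * star (w t) = 1"
    and p: "\<And>t. t \<in> {0..1} \<Longrightarrow> p t * pinv t = 1" "\<And>t. t \<in> {0..1} \<Longrightarrow> pinv t * p t = 1"
      "\<And>t. t \<in> {0..1} \<Longrightarrow> star (p t) = p t" "\<And>t. t \<in> {0..1} \<Longrightarrow> star (pinv t) = pinv t"
    and w01: "k 0 = k 1 \<Longrightarrow> w 0 = w 1"
  proof (rule lip_path_polar[OF kD(1,2)])
    show "k t * ki t = 1" "ki t * k t = 1" if "t \<in> {0..1}" for t
      using kD(5,6)[OF that] .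
    fix w p pinv :: "real \<Rightarrow> 'a"
    assume *: "lip_path w" "lip_path p" "lip_path pinv"
      "\<And>t. t \<in> {0..1} \<Longrightarrow> k t = w t * p t"
      "\<And>t. t \<in> {0..1} \<Longrightarrow> star (w t) * w t = 1" "\<And>t. t \<in> {0..1} \<Longrightarrow> w t * star (w t) = 1"
      "\<And>t. t \<in> {0..1} \<Longrightarrow> p t * pinv t = 1" "\<And>t. t \<in> {0..1} \<Longrightarrow> pinv t * p t = 1"
      "\<And>t. t \<in> {0..1} \<Longrightarrow> star (p t) = p t" "\<And>t. t \<in> {0..1} \<Longrightarrow> star (pinv t) = pinv t"
      "k 0 = k 1 \<Longrightarrow> w 0 = w 1"
    show thesis by (rule that[OF *])
  qed
  obtain L where L: "L \<ge> 0" "\<And>s t. s \<in> {0..1} \<Longrightarrow> t \<in> {0..1} \<Longrightarrow> norm (w s - w t) \<le> L * \<bar>s - t\<bar>"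
    using lip_pathE[OF lip(1)] by blast
  obtain P where P: "P \<ge> 0" "\<And>s t. s \<in> {0..1} \<Longrightarrow> t \<in> {0..1} \<Longrightarrow> norm (p s - p t) \<le> P * \<bar>s - t\<bar>"
    using lip_pathE[OF lip(2)] by blast
  obtain M where M: "M > 0" "\<And>t. t \<in> {0..1} \<Longrightarrow> norm (pinv t) \<le> M" using lip_path_bounded[OF lip(3)] by blast
  have nw: "norm (w t) = 1" if "t \<in> {0..1}" for t
  proof -
    have "(norm (w t))\<^sup>2 = 1" using cstar_identity[of "w t"] w(1)[OF that] by simp
    then show ?thesis using norm_ge_zero[of "w t"] by (auto simp: power2_eq_1_iff)
  qed
  have ki: "ki t = pinv t * star (w t)" if t: "t \<in> {0..1}" for t
  proof -
    have "k t * (pinv t * star (w t)) = w t * (p t * pinv t) * star (w t)" by (simp only: kwp[OF t] mult.assoc)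
    then have "k t * (pinv t * star (w t)) = 1" using p(1)[OF t] w(2)[OF t] by simp
    then have "ki t * (k t * (pinv t * star (w t))) = ki t" by simp
    then show ?thesis using kD(6)[OF t] by (simp flip: mult.assoc)
  qed
  obtain \<delta> where \<delta>: "\<delta> > 0" "\<And>u. u \<in> cor.unitary_group 1 \<Longrightarrow> norm (u - 1) < \<delta> \<Longrightarrow> u \<in> (cor.U0_group 1 :: 'a seq_op set)"
    using cor.U0_near_one[of 1] by blast
  have main: "\<exists>y c. norm (y - emb (skew_part q)) \<le> e \<and> c \<in> cor.CU_group 1 \<and> norm (exp (- y) - c) \<le> e"
    if e: "e > 0" for e
  proof -
    have e2: "e / 2 > 0" using e by simp
    have ev: "\<forall>\<^sub>F m in sequentially. B / real m < d" if "d > 0" for B d :: real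
      using order_tendstoD(2)[OF lim_const_over_n[of B] that] .
    have ev1: "\<forall>\<^sub>F m in sequentially. L / real m < 1" by (rule ev) simp
    have "\<forall>\<^sub>F m in sequentially. \<exists>y c. norm (y - emb (skew_part q)) \<le> e \<and> c \<in> cor.CU_group 1 \<and> norm (exp (- y) - c) \<le> e"
      using null_modD[OF q e2] ev[OF \<delta>(1), of L] ev1 ev[OF e, of "6 * L\<^sup>2"]
        ev[OF e2, of "L * (P * M)"] eventually_gt_at_top[of 0]
    proof eventually_elim
      case (elim m)
      have m: "m > 0" using elim by simp
      define a where "a j = real j / real m" for j :: nat
      have aS: "(real j + 1) / real m = a (Suc j)" for j by (simp add: a_def add.commute)
      have aI: "a j \<in> {0..1}" if "j \<le> m" for j using that m by (simp add: a_def)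
      have ad: "\<bar>a (Suc j) - a j\<bar> = 1 / real m" for j by (simp add: a_def diff_divide_distrib[symmetric])
      define x where "x j = w (a (Suc j)) * star (w (a j)) - 1" for j
      define y where "y j = w (a j) * ((p (a (Suc j)) - p (a j)) * pinv (a j)) * star (w (a j))" for j
      have nx: "norm (x j) \<le> L / real m" if j: "j < m" for j
      proof -
        have "x j = (w (a (Suc j)) - w (a j)) * star (w (a j))"
          using w(2)[OF aI[of j]] j by (simp add: x_def left_diff_distrib)
        also have "norm \<dots> \<le> (L * (1 / real m)) * 1"
          using L(2)[OF aI[of "Suc j"] aI[of j]] j nw[OF aI[of j]] L(1)
          by (intro order_trans[OF norm_mult_ineq] mult_mono) (auto simp: ad)
        finally show ?thesis by simp
      qed
      have ny: "norm (y j) \<le> P * M / real m" if j: "j < m" for j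
      proof -
        have "norm (y j) \<le> 1 * ((P * (1 / real m)) * M) * 1"
          unfolding y_def using P(2)[OF aI[of "Suc j"] aI[of j]] j nw[OF aI[of j]] P(1) M(1) M(2)[OF aI[of j]]
          by (intro order_trans[OF norm_mult_ineq] mult_mono) (auto simp: ad)
        then show ?thesis by simp
      qed
      have kk: "k (a (Suc j)) * ki (a j) - 1 = x j + y j + x j * y j" if j: "j < m" for j
      proof -
        have I: "a j \<in> {0..1}" "a (Suc j) \<in> {0..1}" using aI j by auto
        have "1 + y j = w (a j) * (1 + (p (a (Suc j)) - p (a j)) * pinv (a j)) * star (w (a j))"
          using w(2)[OF I(1)] by (simp add: y_def distrib_left distrib_right)
        also have "1 + (p (a (Suc j)) - p (a j)) * pinv (a j) = p (a (Suc j)) * pinv (a j)"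
          using p(1)[OF I(1)] by (simp add: left_diff_distrib)
        finally have "(1 + x j) * (1 + y j)
            = w (a (Suc j)) * (star (w (a j)) * w (a j)) * (p (a (Suc j)) * pinv (a j)) * star (w (a j))"
          by (simp add: x_def mult.assoc)
        also have "\<dots> = k (a (Suc j)) * ki (a j)"
          using w(1)[OF I(1)] by (simp add: kwp[OF I(2)] ki[OF I(1)] mult.assoc)
        finally show ?thesis by (simp add: algebra_simps)
      qed
      have unit: "unit_emb (1 + x j) \<in> cor.U0_group 1" if j: "j < m" for j
      proof (rule \<delta>(2))
        have I: "a j \<in> {0..1}" "a (Suc j) \<in> {0..1}" using aI j by auto
        have "w (a (Suc j)) * star (w (a j)) * (w (a j) * star (w (a (Suc j))))
            = w (a (Suc j)) * (star (w (a j)) * w (a j)) * star (w (a (Suc j)))"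
          "w (a j) * star (w (a (Suc j))) * (w (a (Suc j)) * star (w (a j)))
            = w (a j) * (star (w (a (Suc j))) * w (a (Suc j))) * star (w (a j))" by (simp_all only: mult.assoc)
        then show "unit_emb (1 + x j) \<in> cor.unitary_group 1"
          using w[OF I(1)] w[OF I(2)] by (simp add: unitary_1 x_def star_mult star_star)
        have "norm (unit_emb (1 + x j) - 1) = norm (x j)" using norm_unit_emb_diff[of "1 + x j" 1] by simp
        then show "norm (unit_emb (1 + x j) - 1) < \<delta>" using nx[OF j] elim by simp
      qed
      \<comment> \<open>The partial products of the factors 1 + x telescope to this, and they return
        to 1 because w is a loop.\<close>
      define V where "V j = unit_emb (w (a j) * star (w 0))" for j
      have V0: "V 0 = 1" using w(2)[of 0] by (simp add: V_def a_def)
      have VS: "V (Suc j) = unit_emb (1 + x j) * V j" if j: "j < m" for j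
      proof -
        have "w (a (Suc j)) * star (w (a j)) * (w (a j) * star (w 0))
            = w (a (Suc j)) * (star (w (a j)) * w (a j)) * star (w 0)" by (simp only: mult.assoc)
        then show ?thesis using w(1)[OF aI[of j]] j by (simp add: V_def unit_emb_mult x_def)
      qed
      have Vm: "V m = 1" using w(2)[of 1] w01[OF k(2)] m by (simp add: V_def a_def)
      define S where "S = (\<Sum>j<m. skew_part (x j))"
      have "near_CU (real m * (6 * (L / real m)\<^sup>2)) (V m * exp (- emb S))"
        unfolding S_def using near_CU_product[of m x "L / real m" V] unit nx V0 VS elim by auto
      moreover have "real m * (6 * (L / real m)\<^sup>2) \<le> e"
        using elim m by (simp add: power2_eq_square)
      ultimately have nS: "near_CU e (exp (- emb S))"
        unfolding near_CU_def Vm by (auto intro: order_trans)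
      have "\<exists>c. c \<in> commutator_span \<and> skew_part (y j) = skew_part c" if j: "j < m" for j
      proof -
        have I: "a j \<in> {0..1}" "a (Suc j) \<in> {0..1}" using aI j by auto
        have "star (p (a (Suc j)) - p (a j)) = p (a (Suc j)) - p (a j)" 
          by (simp add: star_diff p(3)[OF I(1)] p(3)[OF I(2)])
        from skew_part_polar_step[OF w(2)[OF I(1)] w(1)[OF I(1)] this p(4)[OF I(1)]]
        show ?thesis unfolding y_def by blast
      qed
      then obtain cy where cy: "\<And>j. j < m \<Longrightarrow> cy j \<in> commutator_span" "\<And>j. j < m \<Longrightarrow> skew_part (y j) = skew_part (cy j)"
        by metis
      from elim(1) obtain c0 where c0: "c0 \<in> commutator_span" "norm (alg.det_sum k ki m - q - c0) < e / 2" by blast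
      have det: "alg.det_sum k ki m = (\<Sum>j<m. x j) + (\<Sum>j<m. y j) + (\<Sum>j<m. x j * y j)"
        unfolding alg.det_sum_def aS by (simp add: kk a_def[symmetric] sum.distrib)
      \<comment> \<open>All small errors are collected in z. Up to them the sum S of the skew parts
        of the x is the skew part of q plus skew parts of commutators.\<close>
      define z where "z = alg.det_sum k ki m - q - c0 - (\<Sum>j<m. x j * y j)"
      define Y where "Y = emb (skew_part q + skew_part z)"
      have "skew_part (\<Sum>j<m. y j) = skew_part (\<Sum>j<m. cy j)"
        unfolding skew_part_sum by (intro sum.cong refl) (simp add: cy)
      moreover have "(\<Sum>j<m. x j) = q + z + c0 - (\<Sum>j<m. y j)" by (simp add: z_def det)
      ultimately have "S = skew_part q + skew_part z + skew_part (c0 - (\<Sum>j<m. cy j))"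
        unfolding S_def skew_part_sum[symmetric] by (simp add: skew_part_add skew_part_diff)
      then have SY: "emb S - Y = emb (skew_part (c0 - (\<Sum>j<m. cy j)))"
        by (simp add: Y_def flip: mat_unit_diff)
      have "emb S - Y \<in> cor.Lie_kernel 1"
        unfolding SY by (intro skew_part_commutator_span commutator_span_diff commutator_span_sum c0 cy) simp
      then have diff: "(- Y) - (- emb S) \<in> cor.Lie_kernel 1" by simp
      have skY: "Y \<in> cor.skew 1" unfolding Y_def by (simp only: emb_skew_part flip: skew_part_add)
      have skS: "emb S \<in> cor.skew 1" unfolding S_def by (simp only: emb_skew_part flip: skew_part_sum)
      have "cor.CU_equiv 1 (exp (- Y)) (exp (- emb S))"
        by (intro cor.exp_equiv_of_diff cor.skew_neg skY skS diff)
      from near_CU_equiv[OF nS this] obtain c where "c \<in> cor.CU_group 1" "norm (exp (- Y) - c) \<le> e"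
        by (auto simp: near_CU_def)
      moreover have "norm (Y - emb (skew_part q)) \<le> e"
      proof -
        have "Y - emb (skew_part q) = emb (skew_part z)" by (simp add: Y_def mat_unit_add)
        then have "norm (Y - emb (skew_part q)) \<le> norm z" using norm_skew_part_le[of z] by (simp add: norm_emb)
        also have "norm z \<le> e / 2 + norm (\<Sum>j<m. x j * y j)"
          unfolding z_def
          using c0(2) norm_triangle_ineq4[of "alg.det_sum k ki m - q - c0" "\<Sum>j<m. x j * y j"] by linarith
        also have "norm (\<Sum>j<m. x j * y j) \<le> (\<Sum>j<m. (L / real m) * (P * M / real m))"
          using nx ny L(1) by (intro sum_norm_le order_trans[OF norm_mult_ineq] mult_mono) auto
        also have "\<dots> = L * (P * M) / real m" using m by simp
        also have "\<dots> \<le> e / 2" using elim by simp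
        finally show ?thesis by simp
      qed
      ultimately show ?case by blast
    qed
    then show ?thesis using eventually_happens'[OF sequentially_bot] by blast
  qed
  have "\<forall>n. \<exists>y c. norm (y - emb (skew_part q)) \<le> inverse (real (Suc n)) \<and> c \<in> cor.CU_group 1
      \<and> norm (exp (- y) - c) \<le> inverse (real (Suc n))"
    by (intro allI main) simp
  then obtain y c where yc: "\<And>n. norm (y n - emb (skew_part q)) \<le> inverse (real (Suc n))"
    "\<And>n. c n \<in> cor.CU_group 1" "\<And>n. norm (exp (- y n) - c n) \<le> inverse (real (Suc n))" by metis
  have "y \<longlonglongrightarrow> emb (skew_part q)"
    by (rule LIM_zero_cancel, rule Lim_null_comparison[OF _ LIMSEQ_inverse_real_of_nat])
       (intro always_eventually allI yc)
  then have "(\<lambda>n. exp (- y n)) \<longlonglongrightarrow> exp (- emb (skew_part q))"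
    by (intro tendsto_exp_banach tendsto_minus)
  moreover have "(\<lambda>n. exp (- y n) - c n) \<longlonglongrightarrow> 0"
    by (rule Lim_null_comparison[OF _ LIMSEQ_inverse_real_of_nat]) (intro always_eventually allI yc)
  ultimately have "(\<lambda>n. exp (- y n) - (exp (- y n) - c n)) \<longlonglongrightarrow> exp (- emb (skew_part q)) - 0"
    by (rule tendsto_diff)
  then have "c \<longlonglongrightarrow> exp (- emb (skew_part q))" by simp
  then have "exp (- emb (skew_part q)) \<in> cor.CU_group 1" by (rule cor.CU_limit[OF yc(2)])
  from cor.CU_adj[OF this] have "exp (emb (skew_part q)) \<in> cor.CU_group 1"
    using cor.adj_exp_skew[OF cor.skew_neg[OF emb_skew_part[of q]]] by simp
  then show ?thesis by (simp add: cor.Lie_kernel_def emb_skew_part)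
qed

section \<open>Injectivity of the corner inclusion\<close>

lemma trace_mono: "m \<le> n \<Longrightarrow> x \<in> corners m \<Longrightarrow> trace n x = trace m x"
  unfolding trace_def by (rule sum.mono_neutral_right) (auto simp: entry_corners_zero)

lemma inv_path_mono: "m \<le> n \<Longrightarrow> tr.inv_path m g gi \<Longrightarrow> tr.inv_path n g gi"
  using corners_mono[of m n] unfolding tr.inv_path_def by blast

lemma det_sum_mono:
  assumes "m \<le> n" "tr.inv_path m g gi" "k > 0"
  shows "tr.det_sum n g gi k = tr.det_sum m g gi k"
  unfolding tr.det_sum_def
proof (intro sum.cong refl trace_mono assms(1))
  fix j assume "j \<in> {..<k}"
  then show "g ((real j + 1) / real k) * gi (real j / real k) - 1 \<in> corners m"
    using grid_points[OF assms(3), of j] tr.inv_pathD[OF assms(2)] by (intro cor.mult_aff) auto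
qed

text \<open>Each factor exp k is run through by exp (t k). The logarithms are added up to h, which
  represents u in the quotient and whose trace is the determinant of the path.\<close>

lemma U0_path:
  assumes "u \<in> cor.U0_group n"
  obtains g gi h where "tr.inv_path n g gi" "g 0 = 1" "g 1 = u" "h \<in> cor.skew n"
    "cor.CU_equiv n (exp h) u" "null_mod (\<lambda>m. tr.det_sum n g gi m - trace n h)"
  using assms
proof (induction arbitrary: thesis rule: cor.U0_induct)
  case one
  show ?case
    by (rule one[of "\<lambda>t. 1" "\<lambda>t. 1" 0])
       (auto simp: tr.inv_path_one cor.skew_zero cor.CU_equiv_refl cor.one_U0 tr.\<tau>_zero)
next
  case (mult k u)
  obtain g gi h where g: "tr.inv_path n g gi" "g 0 = 1" "g 1 = u" "h \<in> cor.skew n"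
    "cor.CU_equiv n (exp h) u" "null_mod (\<lambda>m. tr.det_sum n g gi m - trace n h)"
    using mult(3) by blast
  let ?e = "\<lambda>t. exp (t *\<^sub>R k)" and ?ei = "\<lambda>t. exp (- (t *\<^sub>R k))"
  have kK: "k \<in> corners n" by (rule cor.skew_K[OF mult(1)])
  note e = tr.inv_path_exp[OF kK]
  show ?case
  proof (rule mult(4)[of "\<lambda>t. ?e t * g t" "\<lambda>t. gi t * ?ei t" "k + h"])
    show "tr.inv_path n (\<lambda>t. ?e t * g t) (\<lambda>t. gi t * ?ei t)" by (rule tr.inv_path_mult[OF e g(1)])
    show "k + h \<in> cor.skew n" by (intro cor.skew_add mult(1) g(4))
    have "cor.CU_equiv n (exp (k + h)) (exp k * exp h)" by (intro cor.exp_add_equiv mult(1) g(4))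
    also have "cor.CU_equiv n (exp k * exp h) (exp k * u)"
      by (intro cor.CU_equiv_mult cor.CU_equiv_refl cor.exp_U0 mult(1) g(5))
    finally show "cor.CU_equiv n (exp (k + h)) (exp k * u)" .
    from null_mod_add[OF null_mod_add[OF tr.det_sum_mult[OF e g(1)] tr.det_sum_exp[OF kK]] g(6)]
    show "null_mod (\<lambda>m. tr.det_sum n (\<lambda>t. ?e t * g t) (\<lambda>t. gi t * ?ei t) m - trace n (k + h))"
      by (rule null_mod_cong) (simp add: tr.\<tau>_add)
  qed (simp_all add: g)
qed

text \<open>Running each commutator along paths of its two entries and their inverses makes the
  determinants cancel.\<close>

lemma DU_path:
  assumes "d \<in> cor.DU_group n"
  obtains g gi where "tr.inv_path n g gi" "g 0 = 1" "g 1 = d" "null_mod (tr.det_sum n g gi)"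
  using assms
proof (induction arbitrary: thesis rule: cor.DU_group.induct)
  case one
  show ?case by (rule one[of "\<lambda>t. 1" "\<lambda>t. 1"]) (auto simp: tr.inv_path_one)
next
  case (step x y d)
  obtain g gi where g: "tr.inv_path n g gi" "g 0 = 1" "g 1 = d" "null_mod (tr.det_sum n g gi)"
    using step(4) by blast
  obtain a ai where a: "tr.inv_path n a ai" "a 0 = 1" "a 1 = x" using U0_path[OF step(1)] by blast
  obtain b bi where b: "tr.inv_path n b bi" "b 0 = 1" "b 1 = y" using U0_path[OF step(2)] by blast
  have inv: "pi 0 = 1" "pi 1 = cor.adj n u"
    if p: "tr.inv_path n p pi" "p 0 = 1" "p 1 = u" and u: "u \<in> cor.U0_group n" for p pi u
  proof -
    show "pi 0 = 1" using tr.inv_pathD(5)[OF p(1), of 0] p(2) by simp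
    have "pi 1 = pi 1 * (u * cor.adj n u)" using cor.U0_right[OF u] by simp
    also have "\<dots> = (pi 1 * p 1) * cor.adj n u" by (simp add: p(3) mult.assoc)
    finally show "pi 1 = cor.adj n u" using tr.inv_pathD(6)[OF p(1), of 1] by simp
  qed
  note ai = tr.inv_path_swap[OF a(1)] and bi = tr.inv_path_swap[OF b(1)]
  note p1 = tr.inv_path_mult[OF a(1) b(1)]
  note p2 = tr.inv_path_mult[OF p1 ai]
  note p3 = tr.inv_path_mult[OF p2 bi]
  note p4 = tr.inv_path_mult[OF p3 g(1)]
  have "null_mod (tr.det_sum n (\<lambda>t. a t * b t * ai t * bi t * g t) (\<lambda>t. gi t * (b t * (a t * (bi t * ai t)))))"
    using null_mod_add[OF null_mod_add[OF null_mod_add[OF null_mod_add[OF null_mod_add[OF null_mod_add[OF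
        tr.det_sum_mult[OF p3 g(1)] tr.det_sum_mult[OF p2 bi]] tr.det_sum_mult[OF p1 ai]]
        tr.det_sum_mult[OF a(1) b(1)]] tr.det_sum_inverse[OF a(1)]] tr.det_sum_inverse[OF b(1)]] g(4)]
    by (rule null_mod_cong) (simp add: algebra_simps)
  moreover have "a 1 * b 1 * ai 1 * bi 1 * g 1 = x * y * cor.adj n x * cor.adj n y * d"
    using inv(2)[OF a step(1)] inv(2)[OF b step(2)] a b g by simp
  ultimately show ?case
    using p4 inv(1)[OF a step(1)] inv(1)[OF b step(2)] a(2) b(2) g(2) by (intro step(5)) auto
qed

text \<open>The pointwise product of a path to a nearby word in commutators, of a correction exp (-
  t c) and of the inverse of a path from 1 to u in the small block is a loop. Its determinant is
  minus the trace of c minus h0, so the skew part of this element lies in the kernel. As c tends to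
  0, so does h, and exp h represents u.\<close>

theorem CU_corner:
  fixes u :: "'a :: unital_cstar_algebra seq_op"
  assumes dense: "dense_invertibles TYPE('a)" and n: "1 \<le> n"
    and u: "u \<in> cor.U0_group 1" "u \<in> cor.CU_group n"
  shows "u \<in> cor.CU_group 1"
proof -
  obtain g gi h where g: "tr.inv_path 1 g gi" "g 0 = 1" "g 1 = u" "h \<in> cor.skew 1"
    "cor.CU_equiv 1 (exp h) u" "null_mod (\<lambda>m. tr.det_sum 1 g gi m - trace 1 h)"
    using U0_path[OF u(1)] by blast
  obtain h0 where h0: "h = emb h0" using corners_1E[OF cor.skew_K[OF g(4)]] .
  have tr_h: "trace 1 h = h0" by (simp add: h0 trace_def entry_mat_unit One_nat_def)
  have sk_h: "skew_part h0 = h0" using g(4) skew_1[of h0] by (simp add: h0 skew_part_idem)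
  have gn: "tr.inv_path n g gi" by (rule inv_path_mono[OF n g(1)])
  have det_g: "null_mod (\<lambda>m. tr.det_sum n g gi m - h0)"
    by (rule null_mod_cong[OF g(6)]) (simp add: det_sum_mono[OF n g(1)] tr_h)
  obtain f where f: "\<And>l. f l \<in> cor.DU_group n" "f \<longlonglongrightarrow> u" using u(2) unfolding cor.CU_seq by blast
  have un: "u \<in> cor.U0_group n" using u(1) U0_mono[OF n] by blast
  \<comment> \<open>The quotient of the approximating commutator word by u; it tends to 1, so its
    logarithms c tend to 0.\<close>
  define w where "w l = cor.adj n u * f l" for l
  have wK: "w l - 1 \<in> corners n" for l
    unfolding w_def by (intro cor.mult_aff cor.adj_aff cor.U0_aff un cor.DU_U0 f)
  have "w \<longlonglongrightarrow> cor.adj n u * u" unfolding w_def by (intro tendsto_intros f)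
  then have w1: "w \<longlonglongrightarrow> 1" using cor.U0_left[OF un] by simp
  have "\<exists>c. c \<in> corners n \<and> norm c \<le> 2 * norm (w l - 1) \<and> exp c = w l" if "norm (w l - 1) \<le> 1/8" for l
    using cor.log_exists[OF wK that] by metis
  then obtain c where c: "\<And>l. norm (w l - 1) \<le> 1/8 \<Longrightarrow> c l \<in> corners n"
    "\<And>l. norm (w l - 1) \<le> 1/8 \<Longrightarrow> norm (c l) \<le> 2 * norm (w l - 1)"
    "\<And>l. norm (w l - 1) \<le> 1/8 \<Longrightarrow> exp (c l) = w l" by metis
  have small: "\<forall>\<^sub>F l in sequentially. norm (w l - 1) \<le> 1/8"
    using tendstoD[OF w1, of "1/8"] by (auto simp: dist_norm elim: eventually_mono)
  have c0: "c \<longlonglongrightarrow> 0"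
  proof (rule Lim_null_comparison)
    show "\<forall>\<^sub>F l in sequentially. norm (c l) \<le> 2 * norm (w l - 1)"
      using small by eventually_elim (rule c(2))
    show "(\<lambda>l. 2 * norm (w l - 1)) \<longlonglongrightarrow> 0"
      using tendsto_mult_right_zero[OF tendsto_norm_zero[OF LIM_zero[OF w1]]] .
  qed
  have main: "emb (skew_part (- trace n (c l) - h0)) \<in> cor.Lie_kernel 1" if l: "norm (w l - 1) \<le> 1/8" for l
  proof -
    note cl = c(1)[OF l]
    obtain d di where d: "tr.inv_path n d di" "d 0 = 1" "d 1 = f l" "null_mod (tr.det_sum n d di)"
      using DU_path[OF f(1)] by blast
    note e = tr.inv_path_exp[OF cl]
    let ?e = "\<lambda>t. exp (t *\<^sub>R c l)" and ?ei = "\<lambda>t. exp (- (t *\<^sub>R c l))"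
    note p1 = tr.inv_path_mult[OF d(1) tr.inv_path_swap[OF e]]
    note p2 = tr.inv_path_mult[OF p1 tr.inv_path_swap[OF gn]]
    let ?g = "\<lambda>t. d t * ?ei t * gi t" and ?gi = "\<lambda>t. g t * (?e t * di t)"
    have gi0: "gi 0 = 1" using tr.inv_pathD(5)[OF gn, of 0] g(2) by simp
    have "?g 1 = 1"
    proof -
      have "f l = u * exp (c l)"
        using cor.U0_right[OF un] by (simp add: c(3)[OF l] w_def flip: mult.assoc)
      then have "f l * exp (- c l) = u * (exp (c l) * exp (- c l))" by (simp add: mult.assoc)
      then have "f l * exp (- c l) = u" by (simp add: exp_minus_inverse)
      then show ?thesis using tr.inv_pathD(5)[OF gn, of 1] by (simp add: d g)
    qed
    then have "?g 0 = ?g 1" by (simp add: d gi0)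
    from loop_reducible[OF dense p2 this] obtain k ki where k: "alg.inv_path k ki" "k 0 = k 1"
      "null_mod (\<lambda>m. tr.det_sum n ?g ?gi m - alg.det_sum k ki m)"
      by (auto simp: reducible_def)
    have "null_mod (\<lambda>m. tr.det_sum n ?g ?gi m - (- trace n (c l) - h0))"
      using null_mod_diff[OF null_mod_diff[OF null_mod_add[OF null_mod_add[OF null_mod_add[OF null_mod_add[OF
        tr.det_sum_mult[OF p1 tr.inv_path_swap[OF gn]] tr.det_sum_mult[OF d(1) tr.inv_path_swap[OF e]]]
        d(4)] tr.det_sum_inverse[OF e]] tr.det_sum_inverse[OF gn]] tr.det_sum_exp[OF cl]] det_g]
      by (rule null_mod_cong) simp
    from null_mod_diff[OF this k(3)] have "null_mod (\<lambda>m. alg.det_sum k ki m - (- trace n (c l) - h0))"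
      by (rule null_mod_cong) simp
    from loop_Lie_kernel[OF k(1,2) this] show ?thesis .
  qed
  obtain N where N: "\<And>l. l \<ge> N \<Longrightarrow> norm (w l - 1) \<le> 1/8"
    using small unfolding eventually_sequentially by blast
  have "(\<lambda>l. emb (skew_part (- trace n (c (l + N)) - h0))) \<longlonglongrightarrow> emb (skew_part (- trace n 0 - h0))"
    by (intro bounded_linear.tendsto[OF bounded_linear_mat_unit] bounded_linear.tendsto[OF bounded_linear_skew_part]
        bounded_linear.tendsto[OF bounded_linear_trace] tendsto_intros LIMSEQ_ignore_initial_segment c0)
  then have "emb (skew_part (- trace n 0 - h0)) \<in> cor.Lie_kernel 1"
    by (rule cor.Lie_kernel_limit[rotated]) (intro main N, simp)
  then have "- h \<in> cor.Lie_kernel 1"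
    by (simp add: tr.\<tau>_zero skew_part_minus sk_h mat_unit_minus h0)
  then have "exp (- h) \<in> cor.CU_group 1" by (simp add: cor.Lie_kernel_def)
  from cor.CU_adj[OF this] have "exp h \<in> cor.CU_group 1"
    using cor.adj_exp_skew[OF cor.skew_neg[OF g(4)]] by simp
  then have "cor.CU_equiv 1 (exp h) 1" by (simp add: cor.CU_equiv_one)
  from cor.CU_equiv_trans[OF cor.CU_equiv_sym[OF g(5)] this] show ?thesis by (simp add: cor.CU_equiv_one)
qed

section \<open>Stable rank one\<close>

text \<open>The infimum 1 in the extended naturals is attained because it is finite. This leaves the
  density condition for tuples of length 1, that is, for single elements with a left
  inverse.\<close>

lemma left_invertible_dense:
  assumes "tsr TYPE('a :: unital_cstar_algebra) = 1" "e > 0"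
  obtains b c :: "'a :: unital_cstar_algebra" where "norm (a - b) < e" "c * b = 1"
proof -
  let ?S = "{n. \<forall>m\<ge>n. tuple_topology m closure_of (left_unimodular m :: (nat \<Rightarrow> 'a) set)
                          = topspace (tuple_topology m)}"
  have "?S \<noteq> {}"
  proof
    assume "?S = {}"
    then have "tsr TYPE('a) = \<infinity>" unfolding tsr_def by (simp only: image_empty Inf_empty top_enat_def)
    then show False using assms(1) by simp
  qed
  then have "Inf (enat ` ?S) \<in> enat ` ?S"
    by (metis (no_types, lifting) Inf_enat_def LeastI_ex empty_is_image ex_in_conv)
  then have "1 \<in> ?S"
    using assms(1) unfolding tsr_def by (metis (no_types, lifting) enat.inject image_iff one_enat_def)
  then have cl: "tuple_topology 1 closure_of (left_unimodular 1 :: (nat \<Rightarrow> 'a) set)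
      = topspace (tuple_topology 1)" by blast
  let ?a = "\<lambda>i. if i < 1 then a else undefined" and ?T = "{x \<in> topspace (tuple_topology 1). x (0::nat) \<in> ball a e}"
  have "continuous_map (tuple_topology 1) euclidean (\<lambda>x. x (0::nat) :: 'a)"
    unfolding tuple_topology_def by (rule continuous_map_product_projection) simp
  then have "openin (tuple_topology 1) ?T"
    by (rule openin_continuous_map_preimage) (simp flip: open_openin)
  moreover have "?a \<in> ?T" using assms(2) by (auto simp: tuple_topology_def PiE_iff extensional_def)
  ultimately obtain y where "y \<in> left_unimodular 1" "y \<in> ?T"
    using cl by (metis (no_types, lifting) in_closure_of mem_Collect_eq)
  then obtain b where "b 0 * y 0 = 1" "dist a (y 0) < e"
    by (auto simp: left_unimodular_def One_nat_def)
  then show thesis using that by (metis dist_norm)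
qed

text \<open>The left inverse c of b is in turn approximated by some c' with a left inverse d. As c'
  b is near 1, c' also has a right inverse, so c' is invertible, and b with it.\<close>

lemma tsr_dense_invertibles:
  assumes "tsr TYPE('a :: unital_cstar_algebra) = 1"
  shows "dense_invertibles TYPE('a)"
  unfolding dense_invertibles_def
proof (intro allI impI)
  fix a :: 'a and e :: real assume "e > 0"
  obtain b c where b: "norm (a - b) < e" and cb: "c * b = 1"
    by (rule left_invertible_dense[OF assms \<open>e > 0\<close>])
  let ?d = "1 / (8 * (norm b + 1))"
  have "?d > 0" by (simp add: add_nonneg_pos)
  obtain c' d where c': "norm (c - c') < ?d" and dc: "d * c' = 1"
    by (rule left_invertible_dense[OF assms \<open>?d > 0\<close>])
  have "norm (c' * b - 1) = norm ((c - c') * b)"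
    by (simp add: cb left_diff_distrib norm_minus_commute)
  also have "\<dots> \<le> ?d * (norm b + 1)"
    by (rule order_trans[OF norm_mult_ineq]) (use c' in \<open>intro mult_mono, auto\<close>)
  also have "\<dots> = 1 / 8" using norm_ge_zero[of b] by (simp add: divide_simps del: norm_ge_zero)
  finally obtain v where v: "c' * b * v = 1" "v * (c' * b) = 1" by (metis near_one_invertible)
  have "b * v = d * c' * (b * v)" by (simp add: dc)
  also have "\<dots> = d" using v(1) by (simp add: mult.assoc)
  finally have "b * (v * c') = 1" using v dc
    by (simp add: mult.assoc[symmetric])
  moreover have "v * c' * b = 1" using v by (simp add: mult.assoc)
  ultimately show "\<exists>b c. norm (a - b) < e \<and> b * c = 1 \<and> c * b = 1" using b by blast
qed

section \<open>Matrices as operators\<close>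

declare minus_carrier_mat [simp]

lemma norm_le_module_norm: "x \<in> carrier_vec n \<Longrightarrow> i < n \<Longrightarrow> norm (x $ i) \<le> module_norm x"
  unfolding module_norm_def by (rule norm_le_module) auto

lemma module_norm_le_sum:
  assumes "x \<in> carrier_vec n"
  shows "module_norm x \<le> (\<Sum>i<n. norm (x $ i))"
proof -
  have "norm (\<Sum>i<n. star (x $ i) * x $ i) \<le> (\<Sum>i<n. (norm (x $ i))\<^sup>2)"
    by (rule sum_norm_le) (simp add: cstar_identity)
  then have "module_norm x \<le> L2_set (\<lambda>i. norm (x $ i)) {..<n}"
    using assms unfolding module_norm_def L2_set_def by simp
  also have "\<dots> \<le> (\<Sum>i<n. norm (x $ i))" by (rule L2_set_le_sum) simp
  finally show ?thesis .
qed

lemma module_norm_add: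
  "x \<in> carrier_vec n \<Longrightarrow> y \<in> carrier_vec n \<Longrightarrow> module_norm (x + y) \<le> module_norm x + module_norm y"
  using module_norm_triangle[of "{..<n}" "($) x" "($) y"] by (simp add: module_norm_def)

lemma module_norm_uminus: "module_norm (- x) = module_norm x"
  by (simp add: module_norm_def star_minus)

lemma module_norm_mult_le:
  assumes "a \<in> carrier_mat n n" "x \<in> carrier_vec n" "module_norm x \<le> 1"
  shows "module_norm (a *\<^sub>v x) \<le> (\<Sum>i<n. \<Sum>j<n. norm (a $$ (i, j)))"
proof -
  have "norm ((a *\<^sub>v x) $ i) \<le> (\<Sum>j<n. norm (a $$ (i, j)))" if "i < n" for i
  proof -
    have "(a *\<^sub>v x) $ i = (\<Sum>j<n. a $$ (i, j) * x $ j)"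
      using assms(1,2) that by (auto simp: scalar_prod_def atLeast0LessThan)
    also have "norm \<dots> \<le> (\<Sum>j<n. norm (a $$ (i, j)))"
    proof (rule sum_norm_le)
      fix j assume "j \<in> {..<n}"
      then have "norm (x $ j) \<le> 1" using norm_le_module_norm[OF assms(2), of j] assms(3) by simp
      then show "norm (a $$ (i, j) * x $ j) \<le> norm (a $$ (i, j))"
        by (intro order_trans[OF norm_mult_ineq] mult_left_le) simp_all
    qed
    finally show ?thesis .
  qed
  then have "(\<Sum>i<n. norm ((a *\<^sub>v x) $ i)) \<le> (\<Sum>i<n. \<Sum>j<n. norm (a $$ (i, j)))"
    by (intro sum_mono) simp
  then show ?thesis using module_norm_le_sum[of "a *\<^sub>v x" n] assms by fastforce
qed

lemma module_norm_mult_le_mat_norm: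
  assumes "a \<in> carrier_mat n n" "x \<in> carrier_vec n" "module_norm x \<le> 1"
  shows "module_norm (a *\<^sub>v x) \<le> mat_norm a"
  unfolding mat_norm_def
proof (rule cSup_upper)
  show "bdd_above {module_norm (a *\<^sub>v x) |x. x \<in> carrier_vec (dim_col a) \<and> module_norm x \<le> 1}"
    using assms(1) by (auto intro!: bdd_aboveI module_norm_mult_le)
qed (use assms in auto)

lemma mat_norm_le:
  assumes "a \<in> carrier_mat n n"
    and "\<And>x. x \<in> carrier_vec n \<Longrightarrow> module_norm x \<le> 1 \<Longrightarrow> module_norm (a *\<^sub>v x) \<le> B"
  shows "mat_norm a \<le> B"
  unfolding mat_norm_def
proof (rule cSup_least)
  have "module_norm (0\<^sub>v n) \<le> 1" by (simp add: module_norm_def)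
  then show "{module_norm (a *\<^sub>v x) |x. x \<in> carrier_vec (dim_col a) \<and> module_norm x \<le> 1} \<noteq> {}"
    using assms(1) zero_carrier_vec by blast
qed (use assms in auto)

lemma mat_norm_le_sum:
  "a \<in> carrier_mat n n \<Longrightarrow> mat_norm a \<le> (\<Sum>i<n. \<Sum>j<n. norm (a $$ (i, j)))"
  by (rule mat_norm_le) (auto intro: module_norm_mult_le)

lemma norm_entry_le_mat_norm:
  assumes "a \<in> carrier_mat n n" "i < n" "j < n"
  shows "norm (a $$ (i, j)) \<le> mat_norm a"
proof -
  have "a *\<^sub>v unit_vec n j = col a j" using assms by (intro eq_vecI) auto
  then have "(a *\<^sub>v unit_vec n j) $ i = a $$ (i, j)" using assms by simp
  moreover have "(\<Sum>k<n. star (unit_vec n j $ k) * unit_vec n j $ k :: 'a) = (\<Sum>k<n. if k = j then 1 else 0)"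
    using assms(3) by (intro sum.cong) (auto simp: star_one star_zero)
  then have "module_norm (unit_vec n j :: 'a vec) \<le> 1"
    using assms(3) by (simp add: module_norm_def)
  ultimately show ?thesis
    using norm_le_module_norm[of "a *\<^sub>v unit_vec n j" n i] module_norm_mult_le_mat_norm[of a n "unit_vec n j"] assms
    by fastforce
qed

lemma Metric_space_mat: "Metric_space (carrier_mat n n) (mat_dist n :: 'a :: unital_cstar_algebra mat \<Rightarrow> _)"
proof
  fix a b c :: "'a mat"
  have nonneg: "0 \<le> mat_norm d" if "d \<in> carrier_mat n n" for d :: "'a mat"
    using module_norm_mult_le_mat_norm[OF that, of "0\<^sub>v n"]
    by (rule order_trans[rotated]) (simp_all add: module_norm_def)
  show "0 \<le> mat_dist n a b" unfolding mat_dist_def using nonneg[of "a - b"] by auto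
  have "mat_norm (a - b) \<le> mat_norm (b - a)" if "a \<in> carrier_mat n n" "b \<in> carrier_mat n n" for a b :: "'a mat"
  proof (rule mat_norm_le)
    fix x :: "'a vec" assume x: "x \<in> carrier_vec n" "module_norm x \<le> 1"
    have "(a - b) *\<^sub>v x = - ((b - a) *\<^sub>v x)"
      using that x by (intro eq_vecI) (auto simp: scalar_prod_def sum_negf[symmetric] algebra_simps)
    then show "module_norm ((a - b) *\<^sub>v x) \<le> mat_norm (b - a)"
      using that x by (simp add: module_norm_uminus module_norm_mult_le_mat_norm[of _ n])
  qed (use that in simp)
  then show "mat_dist n a b = mat_dist n b a" by (auto simp: mat_dist_def intro: antisym)
  assume a: "a \<in> carrier_mat n n" and b: "b \<in> carrier_mat n n"
  show "mat_dist n a b = 0 \<longleftrightarrow> a = b"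
  proof
    assume "mat_dist n a b = 0"
    then have "norm ((a - b) $$ (i, j)) \<le> 0" if "i < n" "j < n" for i j
      using norm_entry_le_mat_norm[of "a - b" n i j] a b that by (simp add: mat_dist_def)
    then show "a = b" using a b by (intro eq_matI) auto
  next
    assume "a = b"
    then have "mat_norm (a - b) \<le> 0" using mat_norm_le_sum[of "a - b" n] b by simp
    then show "mat_dist n a b = 0" using a b nonneg[of "a - b"] by (simp add: mat_dist_def)
  qed
  assume c: "c \<in> carrier_mat n n"
  have "mat_norm (a - c) \<le> mat_norm (a - b) + mat_norm (b - c)"
  proof (rule mat_norm_le)
    fix x :: "'a vec" assume x: "x \<in> carrier_vec n" "module_norm x \<le> 1"
    have "(a - c) *\<^sub>v x = (a - b) *\<^sub>v x + (b - c) *\<^sub>v x"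
      using a b c x by (intro eq_vecI) (auto simp: scalar_prod_def sum.distrib[symmetric] algebra_simps)
    then have "module_norm ((a - c) *\<^sub>v x) \<le> module_norm ((a - b) *\<^sub>v x) + module_norm ((b - c) *\<^sub>v x)"
      using module_norm_add[OF mult_mat_vec_carrier[OF _ x(1)] mult_mat_vec_carrier[OF _ x(1)], of "a - b" n "b - c"] b c
      by simp
    also have "\<dots> \<le> mat_norm (a - b) + mat_norm (b - c)"
      using a b c x by (intro add_mono module_norm_mult_le_mat_norm) auto
    finally show "module_norm ((a - c) *\<^sub>v x) \<le> mat_norm (a - b) + mat_norm (b - c)" .
  qed (use a c in simp)
  then show "mat_dist n a c \<le> mat_dist n a b + mat_dist n b c" using a b c by (simp add: mat_dist_def)
qed

text \<open>Rescaling radii by C turns balls on one side into neighbourhoods on the other. Only the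
  topology of the matrix norm has to be transported, so an equivalent norm is good enough.\<close>

lemma (in Metric_space) homeomorphic_map_bilipschitz:
  fixes f :: "'a \<Rightarrow> 'b :: metric_space"
  assumes S: "f ` M = S" and C: "C > 0"
    and le: "\<And>x y. x \<in> M \<Longrightarrow> y \<in> M \<Longrightarrow> d x y \<le> C * dist (f x) (f y)"
    and ge: "\<And>x y. x \<in> M \<Longrightarrow> y \<in> M \<Longrightarrow> dist (f x) (f y) \<le> C * d x y"
  shows "homeomorphic_map mtopology (top_of_set S) f"
  unfolding homeomorphic_map_def quotient_map_def
proof (intro conjI allI impI)
  show "inj_on f (topspace mtopology)"
    using le by (auto intro!: inj_onI) (metis dist_self mult_zero_right nonneg order_antisym zero)
  fix U assume U: "U \<subseteq> topspace (top_of_set S)"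
  have "(\<exists>r>0. mball x r \<subseteq> {x \<in> M. f x \<in> U}) \<longleftrightarrow> (\<exists>e>0. \<forall>y\<in>S. dist y (f x) < e \<longrightarrow> y \<in> U)"
    if x: "x \<in> M" for x
  proof
    assume "\<exists>r>0. mball x r \<subseteq> {x \<in> M. f x \<in> U}"
    then obtain r where r: "r > 0" "\<And>y. y \<in> M \<Longrightarrow> d x y < r \<Longrightarrow> f y \<in> U" using x by (auto simp: subset_iff)
    have "y \<in> U" if y: "y \<in> S" "dist y (f x) < r / C" for y
    proof -
      obtain z where z: "z \<in> M" "y = f z" using y S by auto
      have "d x z \<le> C * dist (f x) (f z)" by (rule le[OF x z(1)])
      also have "\<dots> < r" using y C by (simp add: z dist_commute field_simps)
      finally show ?thesis using r z by blast
    qed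
    then show "\<exists>e>0. \<forall>y\<in>S. dist y (f x) < e \<longrightarrow> y \<in> U" using r C by (intro exI[of _ "r / C"]) auto
  next
    assume "\<exists>e>0. \<forall>y\<in>S. dist y (f x) < e \<longrightarrow> y \<in> U"
    then obtain e where e: "e > 0" "\<And>y. y \<in> S \<Longrightarrow> dist y (f x) < e \<Longrightarrow> y \<in> U" by blast
    have "f y \<in> U" if y: "y \<in> M" "d x y < e / C" for y
    proof -
      have "dist (f y) (f x) \<le> C * d x y" using ge[OF x y(1)] by (simp add: dist_commute)
      also have "\<dots> < e" using y C by (simp add: field_simps)
      finally show ?thesis using e y S by blast
    qed
    then show "\<exists>r>0. mball x r \<subseteq> {x \<in> M. f x \<in> U}" using e C by (intro exI[of _ "e / C"]) auto
  qed
  then show "openin mtopology {x \<in> topspace mtopology. f x \<in> U} = openin (top_of_set S) U"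
    using U S by (auto simp: openin_mtopology openin_euclidean_subtopology_iff subset_iff image_iff)
qed (use S in simp)

definition op_of_mat :: "nat \<Rightarrow> 'a :: unital_cstar_algebra mat \<Rightarrow> 'a seq_op" where
  "op_of_mat n u = 1 + corner n (\<lambda>i j. u $$ (i, j) - (if i = j then 1 else 0))"

lemma op_of_mat_aff: "op_of_mat n u - 1 \<in> corners n"
  by (simp add: op_of_mat_def)

lemma entry_op_of_mat: "i < n \<Longrightarrow> j < n \<Longrightarrow> entry i j (op_of_mat n u) = u $$ (i, j)"
  by (simp add: op_of_mat_def entry_add entry_one entry_corner)

lemma aff_eqI:
  assumes "x - 1 \<in> corners n" "y - 1 \<in> corners n" "\<And>i j. i < n \<Longrightarrow> j < n \<Longrightarrow> entry i j x = entry i j y"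
  shows "x = y"
  using corners_eqI[OF assms(1,2)] assms(3) by (simp add: entry_diff)

lemma op_of_mat_inj:
  assumes "u \<in> carrier_mat n n" "v \<in> carrier_mat n n" "op_of_mat n u = op_of_mat n v"
  shows "u = v"
  using assms by (intro eq_matI) (auto simp flip: entry_op_of_mat[of _ n])

lemma op_of_mat_eq_iff:
  "u \<in> carrier_mat n n \<Longrightarrow> v \<in> carrier_mat n n \<Longrightarrow> op_of_mat n u = op_of_mat n v \<longleftrightarrow> u = v"
  using op_of_mat_inj by blast

lemma op_of_mat_image: "op_of_mat n ` carrier_mat n n = {x. x - 1 \<in> corners n}"
proof (intro equalityI subsetI)
  fix x :: "'a seq_op" assume "x \<in> {x. x - 1 \<in> corners n}"
  then have "x = op_of_mat n (mat n n (\<lambda>(i, j). entry i j x))"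
    by (intro aff_eqI) (auto simp: op_of_mat_aff entry_op_of_mat)
  then show "x \<in> op_of_mat n ` carrier_mat n n" by (metis imageI mat_carrier)
qed (auto simp: op_of_mat_aff)

lemma op_of_mat_one: "op_of_mat n (1\<^sub>m n) = 1"
proof (rule aff_eqI)
  show "1 - 1 \<in> corners n" by (metis corner_in_corners corner_zero diff_self)
qed (auto simp: op_of_mat_aff entry_op_of_mat entry_one)

lemma op_of_mat_mult:
  assumes "u \<in> carrier_mat n n" "v \<in> carrier_mat n n"
  shows "op_of_mat n (u * v) = op_of_mat n u * op_of_mat n v"
proof (rule aff_eqI)
  fix i j assume "i < n" "j < n"
  then show "entry i j (op_of_mat n (u * v)) = entry i j (op_of_mat n u * op_of_mat n v)"
    using assms by (auto simp: entry_aff_mult[OF op_of_mat_aff op_of_mat_aff] entry_op_of_mat scalar_prod_def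
        atLeast0LessThan)
qed (auto intro: cor.mult_aff op_of_mat_aff)

lemma mat_star_carrier: "u \<in> carrier_mat n n \<Longrightarrow> mat_star u \<in> carrier_mat n n"
  by (simp add: mat_star_def)

lemma op_of_mat_star:
  assumes "u \<in> carrier_mat n n"
  shows "op_of_mat n (mat_star u) = cor.adj n (op_of_mat n u)"
  using assms unfolding cor.adj_def op_of_mat_def
  by (auto simp: corner_star_corner mat_star_def star_diff intro!: corner_cong)

lemma op_of_mat_unitary:
  assumes "u \<in> carrier_mat n n"
  shows "op_of_mat n u \<in> cor.unitary_group n \<longleftrightarrow> u \<in> unitaries n"
proof -
  note [simp] = mat_star_carrier[OF assms] assms
  have "op_of_mat n u * cor.adj n (op_of_mat n u) = 1 \<longleftrightarrow> u * mat_star u = 1\<^sub>m n"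
    "cor.adj n (op_of_mat n u) * op_of_mat n u = 1 \<longleftrightarrow> mat_star u * u = 1\<^sub>m n"
    unfolding op_of_mat_star[OF assms, symmetric]
    using op_of_mat_eq_iff[OF mult_carrier_mat one_carrier_mat, of u n n "mat_star u"]
      op_of_mat_eq_iff[OF mult_carrier_mat one_carrier_mat, of "mat_star u" n n u]
    by (simp_all add: op_of_mat_one flip: op_of_mat_mult)
  then show ?thesis by (auto simp: unitaries_def cor.unitary_group_def op_of_mat_aff)
qed

lemma op_of_mat_unitaries: "op_of_mat n ` unitaries n = cor.unitary_group n"
proof -
  have "cor.unitary_group n \<subseteq> op_of_mat n ` carrier_mat n n"
    unfolding op_of_mat_image by (auto simp: cor.unitary_group_def)
  moreover have "unitaries n \<subseteq> carrier_mat n n" by (auto simp: unitaries_def)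
  ultimately show ?thesis using op_of_mat_unitary by blast
qed

lemma op_of_mat_diag_one:
  assumes "u \<in> carrier_mat m m" "m \<le> n"
  shows "op_of_mat n (diag_one m n u) = op_of_mat m u"
  unfolding op_of_mat_def corner_mono[OF assms(2)]
  using assms by (auto simp: diag_one_def intro!: corner_cong)

text \<open>Either norm bounds every entry and is bounded by the sum of the n^2 entry norms. The
  added 1 keeps the constant positive for n = 0.\<close>

lemma mat_dist_bilipschitz:
  assumes "a \<in> carrier_mat n n" "b \<in> carrier_mat n n"
  shows "mat_dist n a b \<le> (real n * real n + 1) * dist (op_of_mat n a) (op_of_mat n b)"
    and "dist (op_of_mat n a) (op_of_mat n b) \<le> (real n * real n + 1) * mat_dist n a b"
proof -
  have ij: "norm ((a - b) $$ (i, j)) \<le> norm (op_of_mat n a - op_of_mat n b)" if "i < n" "j < n" for i j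
    using norm_entry_le[of i j "op_of_mat n a - op_of_mat n b"] assms that
    by (simp add: entry_diff entry_op_of_mat)
  have "(\<Sum>i<n. \<Sum>j<n. norm ((a - b) $$ (i, j))) \<le> (\<Sum>i<n. \<Sum>j<n. norm (op_of_mat n a - op_of_mat n b))"
    by (intro sum_mono ij) auto
  then have "mat_norm (a - b) \<le> (real n * real n) * norm (op_of_mat n a - op_of_mat n b)"
    using mat_norm_le_sum[OF minus_carrier_mat[OF assms(2)], of a] by (simp add: mult.assoc)
  then show "mat_dist n a b \<le> (real n * real n + 1) * dist (op_of_mat n a) (op_of_mat n b)"
    using assms by (simp add: mat_dist_def dist_norm distrib_right add_increasing2)
  have "op_of_mat n a - op_of_mat n b = corner n (\<lambda>i j. (a - b) $$ (i, j))"
    using assms by (auto simp: op_of_mat_def corner_diff intro!: corner_cong)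
  then have "norm (op_of_mat n a - op_of_mat n b) \<le> (\<Sum>i<n. \<Sum>j<n. norm ((a - b) $$ (i, j)))"
    by (simp only: norm_corner_le)
  also have "\<dots> \<le> (\<Sum>i<n. \<Sum>j<n. mat_dist n a b)"
    using assms by (intro sum_mono) (use norm_entry_le_mat_norm[of "a - b" n] in \<open>simp add: mat_dist_def\<close>)
  finally show "dist (op_of_mat n a) (op_of_mat n b) \<le> (real n * real n + 1) * mat_dist n a b"
    using Metric_space.nonneg[OF Metric_space_mat, of n a b]
    by (simp add: dist_norm distrib_right mult.assoc)
qed

lemma homeomorphic_map_op_of_mat:
  "homeomorphic_map (mat_topology n) (top_of_set {x. x - 1 \<in> corners n}) (op_of_mat n)"
  unfolding mat_topology_def
  by (rule Metric_space.homeomorphic_map_bilipschitz[OF Metric_space_mat op_of_mat_image _ mat_dist_bilipschitz])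
     (simp_all add: add_nonneg_pos)

lemma topspace_mat_topology: "topspace (mat_topology n) = carrier_mat n n"
  unfolding mat_topology_def by (rule Metric_space.topspace_mtopology[OF Metric_space_mat])

text \<open>The image of the matrices is a closed affine subspace, so the closure taken inside it is
  the closure in the ambient algebra.\<close>

lemma op_of_mat_closure_of:
  assumes "S \<subseteq> carrier_mat n n"
  shows "op_of_mat n ` (mat_topology n closure_of S) = closure (op_of_mat n ` S)"
proof -
  have "closed {x. x - 1 \<in> (corners n :: 'a seq_op set)}"
    using continuous_closed_vimage[OF closed_corners[of n], of "\<lambda>x. x - 1"] by (simp add: vimage_def)
  moreover have sub: "op_of_mat n ` S \<subseteq> {x. x - 1 \<in> corners n}" by (auto simp: op_of_mat_aff)
  ultimately have cl: "closure (op_of_mat n ` S) \<subseteq> {x. x - 1 \<in> corners n}" by (rule closure_minimal[rotated])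
  have "op_of_mat n ` (mat_topology n closure_of S)
      = top_of_set {x. x - 1 \<in> corners n} closure_of (op_of_mat n ` S)"
    by (rule homeomorphic_map_closure_of[OF homeomorphic_map_op_of_mat, symmetric])
       (simp add: topspace_mat_topology assms)
  also have "\<dots> = closure (op_of_mat n ` S)"
    using cl sub by (simp add: closure_of_subtopology Int_absorb1)
  finally show ?thesis .
qed

lemma connected_component_of_set_top_of_set:
  "connected_component_of_set (top_of_set S) x = connected_component_set S x"
  by (auto simp: connected_component_of_def connected_component_def connectedin_subtopology)

lemma op_of_mat_U0:
  "op_of_mat n ` carrier (U0 n :: 'a :: unital_cstar_algebra mat monoid) = cor.U0_group n"
proof -
  have un: "unitaries n \<subseteq> (carrier_mat n n :: 'a mat set)" "(1\<^sub>m n :: 'a mat) \<in> unitaries n"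
    using op_of_mat_unitary[of "1\<^sub>m n" n] cor.unitary_one[of n]
    by (auto simp: unitaries_def op_of_mat_one)
  let ?S = "{x. x - 1 \<in> corners n} :: 'a seq_op set"
  have sub: "cor.unitary_group n \<subseteq> ?S" by (auto simp: cor.unitary_group_def)
  have "homeomorphic_map (subtopology (mat_topology n) (unitaries n))
      (subtopology (top_of_set ?S) (cor.unitary_group n)) (op_of_mat n)"
  proof (rule homeomorphic_map_subtopologies[OF homeomorphic_map_op_of_mat])
    show "op_of_mat n ` (topspace (mat_topology n) \<inter> unitaries n) = topspace (top_of_set ?S) \<inter> cor.unitary_group n"
      using un(1) sub by (simp add: topspace_mat_topology Int_absorb1 op_of_mat_unitaries)
  qed
  also have "subtopology (top_of_set ?S) (cor.unitary_group n) = top_of_set (cor.unitary_group n)"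
    using sub by (simp add: subtopology_subtopology Int_absorb1)
  finally have hom: "homeomorphic_map (subtopology (mat_topology n) (unitaries n :: 'a mat set))
      (top_of_set (cor.unitary_group n)) (op_of_mat n)" .
  have "(1\<^sub>m n :: 'a mat) \<in> topspace (subtopology (mat_topology n) (unitaries n))"
    using un by (auto simp: topspace_mat_topology topspace_subtopology)
  from homeomorphic_map_connected_component_of[OF hom this]
  have "connected_component_of_set (top_of_set (cor.unitary_group n)) 1 = op_of_mat n ` carrier (U0 n :: 'a mat monoid)"
    by (simp add: U0_def op_of_mat_one)
  then show ?thesis unfolding connected_component_of_set_top_of_set cor.U0_component by simp
qed

section \<open>The quotient groups\<close>

lemma mult_carrier_mat_square [simp]:
  "u \<in> carrier_mat n n \<Longrightarrow> v \<in> carrier_mat n n \<Longrightarrow> u * v \<in> carrier_mat n n"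
  by (rule mult_carrier_mat)

lemma U0_simps [simp]: "x \<otimes>\<^bsub>U0 n\<^esub> y = x * y" "\<one>\<^bsub>U0 n\<^esub> = 1\<^sub>m n"
  by (simp_all add: U0_def)

lemma U0_subset: "carrier (U0 n) \<subseteq> carrier_mat n n"
  using connected_component_of_subset_topspace[of "subtopology (mat_topology n) (unitaries n)" "1\<^sub>m n"]
  by (auto simp: U0_def unitaries_def)

lemma U0_iff: "u \<in> carrier (U0 n) \<longleftrightarrow> u \<in> carrier_mat n n \<and> op_of_mat n u \<in> cor.U0_group n"
proof (intro iffI conjI; (elim conjE)?)
  assume "u \<in> carrier_mat n n" "op_of_mat n u \<in> cor.U0_group n"
  then obtain v where "v \<in> carrier (U0 n)" "op_of_mat n v = op_of_mat n u"
    unfolding op_of_mat_U0[symmetric] by auto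
  then show "u \<in> carrier (U0 n)"
    using op_of_mat_inj[OF _ \<open>u \<in> carrier_mat n n\<close>] U0_subset by blast
next
  assume "u \<in> carrier (U0 n)"
  then show "u \<in> carrier_mat n n" "op_of_mat n u \<in> cor.U0_group n"
    using U0_subset op_of_mat_U0 by blast+
qed

lemma group_U0: "group (U0 n)"
proof (rule groupI)
  fix u assume u: "u \<in> carrier (U0 n)"
  then have "op_of_mat n (mat_star u * u) = op_of_mat n (1\<^sub>m n)"
    by (simp add: U0_iff op_of_mat_mult mat_star_carrier op_of_mat_star op_of_mat_one cor.U0_left)
  then have "mat_star u * u = 1\<^sub>m n"
    using u by (intro op_of_mat_inj[of _ n]) (auto simp: U0_iff mat_star_carrier)
  then show "\<exists>v\<in>carrier (U0 n). v \<otimes>\<^bsub>U0 n\<^esub> u = \<one>\<^bsub>U0 n\<^esub>"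
    using u by (intro bexI[of _ "mat_star u"]) (auto simp: U0_iff mat_star_carrier op_of_mat_star cor.U0_adj)
qed (auto simp: U0_iff op_of_mat_mult cor.U0_mult op_of_mat_one cor.one_U0 assoc_mult_mat)

lemma inv_U0:
  assumes "u \<in> carrier (U0 n)"
  shows "inv\<^bsub>U0 n\<^esub> u = mat_star u"
proof (rule group.inv_equality[OF group_U0])
  have "op_of_mat n (mat_star u * u) = op_of_mat n (1\<^sub>m n)"
    using assms by (simp add: U0_iff op_of_mat_mult mat_star_carrier op_of_mat_star op_of_mat_one cor.U0_left)
  then show "mat_star u \<otimes>\<^bsub>U0 n\<^esub> u = \<one>\<^bsub>U0 n\<^esub>"
    using assms op_of_mat_inj[of "mat_star u * u" n "1\<^sub>m n"] by (simp add: U0_iff mat_star_carrier)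
qed (use assms in \<open>auto simp: U0_iff mat_star_carrier op_of_mat_star cor.U0_adj\<close>)

text \<open>The generated subgroup admits inverses of generators and arbitrary products, whereas
  \<open>DU_group\<close> only prepends commutators; \<open>DU_adj\<close> and
  \<open>DU_mult\<close> bridge the difference.\<close>

lemma op_of_mat_derived:
  "op_of_mat n ` derived (U0 n) (carrier (U0 n)) = cor.DU_group n"
proof (intro equalityI subsetI; (elim imageE)?)
  interpret group "U0 n" by (rule group_U0)
  let ?C = "carrier (U0 n)"
  have comm: "op_of_mat n (x \<otimes>\<^bsub>U0 n\<^esub> y \<otimes>\<^bsub>U0 n\<^esub> inv\<^bsub>U0 n\<^esub> x \<otimes>\<^bsub>U0 n\<^esub> inv\<^bsub>U0 n\<^esub> y)
      = op_of_mat n x * op_of_mat n y * cor.adj n (op_of_mat n x) * cor.adj n (op_of_mat n y)"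
    if "x \<in> ?C" "y \<in> ?C" for x y
    using that by (simp add: inv_U0 op_of_mat_mult[of _ n] U0_iff mat_star_carrier op_of_mat_star)
  fix d
  assume "d \<in> derived (U0 n) ?C"
  then have "op_of_mat n d \<in> cor.DU_group n" unfolding derived_def
  proof (induction rule: generate.induct)
    case one
    then show ?case by (simp add: op_of_mat_one cor.DU_group.one)
  next
    case (incl h)
    then show ?case by (auto simp: comm U0_iff simp del: U0_simps intro!: cor.DU_commutator)
  next
    case (inv h)
    then have "h \<in> ?C" using derived_set_in_carrier[OF order_refl] by blast
    moreover have "op_of_mat n h \<in> cor.DU_group n"
      using inv by (auto simp: comm U0_iff simp del: U0_simps intro!: cor.DU_commutator)
    ultimately show ?case by (simp add: inv_U0 op_of_mat_star U0_iff cor.DU_adj)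
  next
    case (eng h1 h2)
    then have "h1 \<in> carrier_mat n n" "h2 \<in> carrier_mat n n"
      using generate_in_carrier[OF derived_set_in_carrier[OF order_refl]] U0_subset by blast+
    then show ?case using eng by (simp add: op_of_mat_mult cor.DU_mult)
  qed
  then show "\<And>x. x = op_of_mat n d \<Longrightarrow> x \<in> cor.DU_group n" by simp
next
  interpret group "U0 n" by (rule group_U0)
  let ?C = "carrier (U0 n)"
  fix d assume "d \<in> cor.DU_group n"
  then show "d \<in> op_of_mat n ` derived (U0 n) ?C"
  proof induction
    case one
    have "1\<^sub>m n \<in> derived (U0 n) ?C" using generate.one[of "U0 n"] unfolding derived_def by simp
    then show ?case by (rule rev_image_eqI) (simp add: op_of_mat_one)
  next
    case (step x y d)
    then obtain u v e where uv: "u \<in> ?C" "x = op_of_mat n u" "v \<in> ?C" "y = op_of_mat n v"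
      and e: "e \<in> derived (U0 n) ?C" "d = op_of_mat n e"
      unfolding op_of_mat_U0[symmetric] by blast
    let ?c = "u \<otimes>\<^bsub>U0 n\<^esub> v \<otimes>\<^bsub>U0 n\<^esub> inv\<^bsub>U0 n\<^esub> u \<otimes>\<^bsub>U0 n\<^esub> inv\<^bsub>U0 n\<^esub> v"
    have "?c \<otimes>\<^bsub>U0 n\<^esub> e \<in> derived (U0 n) ?C"
      unfolding derived_def 
    proof (rule generate.eng[OF generate.incl])
      show "e \<in> generate (U0 n) (derived_set (U0 n) ?C)" using e(1) unfolding derived_def .
    qed (use uv in blast)
    moreover have "e \<in> carrier_mat n n" using e derived_in_carrier[OF order_refl] U0_subset by blast
    then have "op_of_mat n (?c \<otimes>\<^bsub>U0 n\<^esub> e) = x * y * cor.adj n x * cor.adj n y * d"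
      using uv e by (simp add: inv_U0 op_of_mat_mult[of _ n] U0_iff mat_star_carrier op_of_mat_star)
    ultimately show ?case by (rule rev_image_eqI[OF _ sym])
  qed
qed

lemma op_of_mat_CU: "op_of_mat n ` (CU n :: 'a :: unital_cstar_algebra mat set) = cor.CU_group n"
proof -
  have "derived (U0 n) (carrier (U0 n)) \<subseteq> (carrier_mat n n :: 'a mat set)"
    using group.derived_in_carrier[OF group_U0 order_refl] U0_subset by blast
  then show ?thesis by (simp add: CU_def op_of_mat_closure_of op_of_mat_derived cor.CU_group_def)
qed

lemma CU_iff: "c \<in> CU n \<longleftrightarrow> c \<in> carrier_mat n n \<and> op_of_mat n c \<in> cor.CU_group n"
proof (intro iffI conjI; (elim conjE)?)
  have sub: "CU n \<subseteq> carrier_mat n n"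
    unfolding CU_def using closure_of_subset_topspace[of "mat_topology n"] by (auto simp: topspace_mat_topology)
  {
    assume "c \<in> carrier_mat n n" "op_of_mat n c \<in> cor.CU_group n"
    then obtain v where "v \<in> CU n" "op_of_mat n v = op_of_mat n c"
      unfolding op_of_mat_CU[symmetric] by auto
    then show "c \<in> CU n" using op_of_mat_inj[OF _ \<open>c \<in> carrier_mat n n\<close>] sub by blast
  next
    assume "c \<in> CU n"
    then show "c \<in> carrier_mat n n" "op_of_mat n c \<in> cor.CU_group n"
      using sub op_of_mat_CU by blast+
  }
qed

lemma normal_CU: "CU n \<lhd> U0 n"
  unfolding group.normal_inv_iff[OF group_U0]
proof
  interpret group "U0 n" by (rule group_U0)
  show "subgroup (CU n) (U0 n)"
    by unfold_locales (auto simp: CU_iff inv_U0 U0_iff cor.CU_U0 mat_star_carrier op_of_mat_star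
        op_of_mat_mult cor.CU_mult cor.CU_adj op_of_mat_one cor.CU_one)
qed (auto simp: CU_iff inv_U0 U0_iff mat_star_carrier op_of_mat_star op_of_mat_mult[of _ n] cor.CU_conj)

lemma diag_one_carrier: "u \<in> carrier_mat m m \<Longrightarrow> m \<le> n \<Longrightarrow> diag_one m n u \<in> carrier_mat n n"
  using four_block_carrier_mat[of u m m "1\<^sub>m (n - m)" "n - m" "n - m"] by (simp add: diag_one_def)

lemma diag_one_U0: "u \<in> carrier (U0 m) \<Longrightarrow> m \<le> n \<Longrightarrow> diag_one m n u \<in> carrier (U0 n)"
  using U0_mono[of m n] by (auto simp: U0_iff op_of_mat_diag_one diag_one_carrier)

lemma diag_one_mult:
  assumes "u \<in> carrier (U0 m)" "v \<in> carrier (U0 m)" "m \<le> n"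
  shows "diag_one m n (u * v) = diag_one m n u * diag_one m n v"
proof (rule op_of_mat_inj)
  have c: "u * v \<in> carrier (U0 m)"
    using group.is_monoid[OF group_U0] monoid.m_closed assms(1,2) by fastforce
  show "diag_one m n (u * v) \<in> carrier_mat n n" "diag_one m n u * diag_one m n v \<in> carrier_mat n n"
    using diag_one_U0[OF c assms(3)] diag_one_U0[OF assms(1,3)] diag_one_U0[OF assms(2,3)] by (auto simp: U0_iff)
  show "op_of_mat n (diag_one m n (u * v)) = op_of_mat n (diag_one m n u * diag_one m n v)"
    using diag_one_U0[OF assms(1,3)] diag_one_U0[OF assms(2,3)] c assms
    by (simp add: op_of_mat_diag_one op_of_mat_mult U0_iff)
qed

lemma rcoset_CU_eq:
  assumes "u \<in> carrier (U0 n)" "v \<in> carrier (U0 n)" "cor.CU_equiv n (op_of_mat n u) (op_of_mat n v)"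
  shows "CU n #>\<^bsub>U0 n\<^esub> u = CU n #>\<^bsub>U0 n\<^esub> v"
proof -
  interpret normal "CU n" "U0 n" by (rule normal_CU)
  have "u \<otimes>\<^bsub>U0 n\<^esub> inv\<^bsub>U0 n\<^esub> v \<in> CU n"
    using assms by (simp add: CU_iff U0_iff inv_U0 op_of_mat_mult mat_star_carrier op_of_mat_star cor.CU_equiv_def)
  then have "u \<in> CU n #>\<^bsub>U0 n\<^esub> v" using assms by (intro rcos_module_rev group_U0)
  then show ?thesis using repr_independence[OF _ assms(2) subgroup_axioms] by simp
qed

text \<open>The first isomorphism theorem for h, the corner inclusion followed by the quotient map.
  Its kernel is found by \<open>CU_corner\<close>, and \<open>U0_eq_CU_mult\<close> makes it
  surjective.\<close>

lemma induced_map_iso: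
  assumes "dense_invertibles TYPE('a :: unital_cstar_algebra)" "1 < n"
  shows "(induced_map 1 n :: 'a mat set \<Rightarrow> _) \<in> iso (U0 1 Mod CU 1) (U0 n Mod CU n)"
proof -
  let ?G = "U0 1 :: 'a mat monoid" and ?H = "U0 n Mod CU n :: 'a mat set monoid"
  define h :: "'a mat \<Rightarrow> 'a mat set" where "h u = CU n #>\<^bsub>U0 n\<^esub> diag_one 1 n u" for u
  interpret N: normal "CU n" "U0 n :: 'a mat monoid" by (rule normal_CU)
  interpret group_hom ?G ?H h
  proof (rule group_hom.intro[OF group_U0 N.factorgroup_is_group], unfold_locales, rule homI)
    show "h u \<in> carrier ?H" if "u \<in> carrier ?G" for u
      using diag_one_U0[OF that, of n] assms(2) by (auto simp: h_def FactGroup_def RCOSETS_def)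
    show "h (u \<otimes>\<^bsub>?G\<^esub> v) = h u \<otimes>\<^bsub>?H\<^esub> h v" if "u \<in> carrier ?G" "v \<in> carrier ?G" for u v
      using N.rcos_sum[of "diag_one 1 n u" "diag_one 1 n v"] that assms(2)
      by (simp add: h_def FactGroup_def diag_one_U0 diag_one_mult)
  qed
  have "h u = CU n \<longleftrightarrow> u \<in> CU 1" if u: "u \<in> carrier ?G" for u
  proof -
    have "h u = CU n \<longleftrightarrow> diag_one 1 n u \<in> CU n"
      using diag_one_U0[OF u, of n] assms(2) N.coset_join1[of "CU n"] N.coset_join2[of _ "CU n"] N.subset N.subgroup_axioms
      unfolding h_def by (metis less_imp_le)
    also have "\<dots> \<longleftrightarrow> op_of_mat 1 u \<in> cor.CU_group n"
      using diag_one_U0[OF u, of n] u assms(2) by (simp add: CU_iff U0_iff op_of_mat_diag_one)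
    also have "\<dots> \<longleftrightarrow> u \<in> CU 1"
      using u CU_corner[OF assms(1), of n "op_of_mat 1 u"] CU_mono[of 1 n] assms(2) by (auto simp: CU_iff U0_iff)
    finally show ?thesis .
  qed
  moreover have "CU 1 \<subseteq> carrier ?G" by (auto simp: CU_iff U0_iff cor.CU_U0)
  ultimately have ker: "kernel ?G ?H h = CU 1"
    by (auto simp: kernel_def FactGroup_def)
  have "h ` carrier ?G = carrier ?H"
  proof (intro equalityI subsetI)
    fix X assume "X \<in> carrier ?H"
    then obtain u where u: "u \<in> carrier (U0 n)" "X = CU n #>\<^bsub>U0 n\<^esub> u"
      by (auto simp: FactGroup_def RCOSETS_def)
    then obtain x where x: "x \<in> cor.U0_group 1" "cor.CU_equiv n (op_of_mat n u) x"
      using U0_eq_CU_mult[of "op_of_mat n u" n] assms(2) by (auto simp: U0_iff)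
    then obtain v where v: "v \<in> carrier ?G" "x = op_of_mat 1 v" by (auto simp flip: op_of_mat_U0)
    have "X = h v" unfolding u(2) h_def
      using x(2) v u(1) assms(2) by (intro rcoset_CU_eq diag_one_U0) (auto simp: op_of_mat_diag_one U0_iff)
    then show "X \<in> h ` carrier ?G" using v by blast
  qed auto
  \<comment> \<open>The resulting isomorphism sends a coset X to the single element of the image of
    X under h, which is the shape of \<open>induced_map\<close>.\<close>
  from FactGroup_iso_set[OF this] show ?thesis
    unfolding ker by (simp add: induced_map_def[abs_def] h_def[abs_def])
qed

theorem corollary3p11:
  assumes "tsr TYPE('a :: unital_cstar_algebra) = 1"
  shows "Dur TYPE('a) = 1"
proof -
  let ?S = "{m. 1 \<le> m \<and> (\<forall>n>m.
     (induced_map m n :: 'a mat set \<Rightarrow> 'a mat set) \<in> iso (U0 m Mod CU m) (U0 n Mod CU n))}"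
  have "1 \<in> ?S" using induced_map_iso[OF tsr_dense_invertibles[OF assms]] by blast
  then have "Inf (enat ` ?S) \<le> enat 1" by (intro Inf_lower imageI)
  moreover have "enat 1 \<le> Inf (enat ` ?S)" by (rule Inf_greatest) auto
  ultimately show ?thesis unfolding Dur_def one_enat_def by (rule antisym)
qed

end
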